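(* Let $k\in\mathbb N\cup\{\infty\}$. Let $(X,|\cdot|)$ be a Banach space with a projectional resolution of identity $\{P_\alpha\}_{\omega\le\alpha\le\mu}$ such that, for each $\gamma\in\Lambda$, the space $Q_\gamma X$ admits an equivalent norm which is $C^1$-smooth, LUR, and a limit (uniform on bounded sets) of $C^k$-smooth norms on $Q_\gamma X$. Let $X$ admit an equivalent $C^k$-smooth norm $\|\cdot\|$. Then $X$ admits an equivalent $C^1$-smooth, LUR norm which is a limit (uniform on bounded sets) of $C^k$-smooth norms on $X$.
   Context: Banach spaces are real. A norm is $C^k$-smooth if it is $k$ times continuously Fréchet differentiable away from the origin ($C^\infty$ if this holds for every $k$). A norm $p$ on $X$ is locally uniformly rotund (LUR) if $\lim_r p(x_r-x)=0$ whenever $x,x_r\in X$ and $\lim_r\left(2p(x_r)^2+2p(x)^2-p(x_r+x)^2\right)=0$. Let $(X,|\cdot|)$ be a Banach space and let $\mu$ be the smallest ordinal with cardinality $|\mu|=\mathrm{dens}(X)$ (the density character). A system $\{P_\alpha\}_{\omega\le\alpha\le\mu}$ of (bounded linear) projections from $X$ into $X$ is a projectional resolution of identity (PRI) if for every $\alpha\in[\omega,\mu]$: (a) $\|P_\alpha\|=1$ (operator norm with respect to the given norm $|\cdot|$ of $X$); (b) $P_\alpha P_\beta=P_\beta P_\alpha=P_\alpha$ for $\omega\le\alpha\le\beta\le\mu$; (c) $\mathrm{dens}(P_\alpha X)\le|\alpha|$; (d) $\bigcup\{P_{\beta+1}X:\beta<\alpha\}$ is norm-dense in $P_\alpha X$;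 (e) $P_\mu=\mathrm{id}_X$. Notation: $\Lambda:=\{0\}\cup[\omega,\mu)$, $Q_\gamma:=P_{\gamma+1}-P_\gamma$ for $\gamma\in[\omega,\mu)$, and $Q_0:=P_\omega$. *)

theory Defs
  imports "HOL-Analysis.Analysis" "HOL-Library.Extended_Nat"
begin

unbundle cardinal_syntax

text \<open>
  A linear subspace Y of a normed space is treated as a normed space in its own right, without
  passing to a separate type: values of a function outside Y never matter.

  HOL has no type for the iterated spaces L(Y, L(Y, ..., L(Y, R))) of varying depth.  We use the
  isometric identification of the m-fold iterate with the bounded m-linear forms on Y; such a form
  takes a list of m arguments.  The first argument of a derivative is the direction of
  differentiation.
\<close>

definition bounded_multilinear_on :: "'a::real_normed_vector set \<Rightarrow> nat \<Rightarrow> ('a list \<Rightarrow> real) \<Rightarrow> bool" where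
  "bounded_multilinear_on Y m T \<longleftrightarrow>
     (\<forall>us vs. length us + length vs + 1 = m \<longrightarrow> set us \<subseteq> Y \<longrightarrow> set vs \<subseteq> Y \<longrightarrow>
        (\<forall>x\<in>Y. \<forall>y\<in>Y. T (us @ (x + y) # vs) = T (us @ x # vs) + T (us @ y # vs)) \<and>
        (\<forall>x\<in>Y. \<forall>a. T (us @ (a *\<^sub>R x) # vs) = a * T (us @ x # vs))) \<and>
     (\<exists>C. \<forall>vs. length vs = m \<longrightarrow> set vs \<subseteq> Y \<longrightarrow> \<bar>T vs\<bar> \<le> C * prod_list (map norm vs))"

definition multilinear_norm_on :: "'a::real_normed_vector set \<Rightarrow> nat \<Rightarrow> ('a list \<Rightarrow> real) \<Rightarrow> real" where
  "multilinear_norm_on Y m T = (SUP vs \<in> {vs. length vs = m \<and> set vs \<subseteq> Y \<inter> cball 0 1}. \<bar>T vs\<bar>)"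

definition has_frechet_derivative_on ::
    "'a::real_normed_vector set \<Rightarrow> nat \<Rightarrow> ('a \<Rightarrow> 'a list \<Rightarrow> real) \<Rightarrow> ('a list \<Rightarrow> real) \<Rightarrow> 'a \<Rightarrow> bool" where
  "has_frechet_derivative_on Y m F T x \<longleftrightarrow>
     bounded_multilinear_on Y (Suc m) T \<and>
     ((\<lambda>h. multilinear_norm_on Y m (\<lambda>vs. F (x + h) vs - F x vs - T (h # vs)) / norm h) \<longlongrightarrow> 0)
       (at 0 within Y)"

text \<open>
  For a set U that is open in Y and a map F from U to the bounded m-linear forms on Y:
  F is n times continuously Frechet differentiable on U.
\<close>

primrec cont_frechet_diff_on ::
    "'a::real_normed_vector set \<Rightarrow> 'a set \<Rightarrow> nat \<Rightarrow> nat \<Rightarrow> ('a \<Rightarrow> 'a list \<Rightarrow> real) \<Rightarrow> bool" where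
  "cont_frechet_diff_on Y U 0 m F \<longleftrightarrow>
     (\<forall>x\<in>U. ((\<lambda>y. multilinear_norm_on Y m (\<lambda>vs. F y vs - F x vs)) \<longlongrightarrow> 0) (at x within U))"
| "cont_frechet_diff_on Y U (Suc n) m F \<longleftrightarrow>
     (\<exists>F'. (\<forall>x\<in>U. has_frechet_derivative_on Y m F (F' x) x) \<and>
           cont_frechet_diff_on Y U n (Suc m) F')"

definition norm_on :: "'a::real_normed_vector set \<Rightarrow> ('a \<Rightarrow> real) \<Rightarrow> bool" where
  "norm_on Y p \<longleftrightarrow>
     (\<forall>x\<in>Y. 0 \<le> p x \<and> (p x = 0 \<longleftrightarrow> x = 0)) \<and>
     (\<forall>x\<in>Y. \<forall>a. p (a *\<^sub>R x) = \<bar>a\<bar> * p x) \<and>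
     (\<forall>x\<in>Y. \<forall>y\<in>Y. p (x + y) \<le> p x + p y)"

definition equivalent_norm_on :: "'a::real_normed_vector set \<Rightarrow> ('a \<Rightarrow> real) \<Rightarrow> bool" where
  "equivalent_norm_on Y p \<longleftrightarrow>
     norm_on Y p \<and> (\<exists>c>0. \<exists>C>0. \<forall>x\<in>Y. c * norm x \<le> p x \<and> p x \<le> C * norm x)"

definition smooth_norm_on :: "'a::real_normed_vector set \<Rightarrow> enat \<Rightarrow> ('a \<Rightarrow> real) \<Rightarrow> bool" where
  "smooth_norm_on Y k p \<longleftrightarrow> norm_on Y p \<and>
     (case k of
        enat n \<Rightarrow> cont_frechet_diff_on Y (Y - {0}) n 0 (\<lambda>x _. p x)
      | \<infinity> \<Rightarrow> (\<forall>n. cont_frechet_diff_on Y (Y - {0}) n 0 (\<lambda>x _. p x)))"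

definition LUR_on :: "'a::real_normed_vector set \<Rightarrow> ('a \<Rightarrow> real) \<Rightarrow> bool" where
  "LUR_on Y p \<longleftrightarrow>
     (\<forall>x\<in>Y. \<forall>xs :: nat \<Rightarrow> 'a. (\<forall>r. xs r \<in> Y) \<longrightarrow>
        (\<lambda>r. 2 * (p (xs r))\<^sup>2 + 2 * (p x)\<^sup>2 - (p (xs r + x))\<^sup>2) \<longlonglongrightarrow> 0 \<longrightarrow>
        (\<lambda>r. p (xs r - x)) \<longlonglongrightarrow> 0)"

definition limit_of_smooth_norms_on :: "'a::real_normed_vector set \<Rightarrow> enat \<Rightarrow> ('a \<Rightarrow> real) \<Rightarrow> bool" where
  "limit_of_smooth_norms_on Y k p \<longleftrightarrow>
     (\<exists>q :: nat \<Rightarrow> 'a \<Rightarrow> real. (\<forall>j. smooth_norm_on Y k (q j)) \<and>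
        (\<forall>B\<subseteq>Y. bounded B \<longrightarrow> uniform_limit B q p sequentially))"

text \<open>
  An element \<open>\<alpha>\<close> of a well-ordered type stands for the ordinal that is the order type of
  \<open>{..<\<alpha>}\<close>; its cardinality is thus \<open>|{..<\<alpha>}|\<close>.  All of the ordinals up to \<open>\<mu>\<close> are available as
  soon as the element \<open>\<mu>\<close> is.
\<close>

definition ord_zero :: "'i::wellorder" where
  "ord_zero = (LEAST \<alpha>. True)"

definition ord_omega :: "'i::wellorder" where
  "ord_omega = (LEAST \<alpha>. infinite {..<\<alpha>})"

definition ord_succ :: "'i::wellorder \<Rightarrow> 'i" where
  "ord_succ \<alpha> = (LEAST \<beta>. \<alpha> < \<beta>)"

definition dense_subset_of :: "'a::topological_space set \<Rightarrow> 'a set \<Rightarrow> bool" where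
  "dense_subset_of D Y \<longleftrightarrow> D \<subseteq> Y \<and> Y \<subseteq> closure D"

definition dens :: "'a::topological_space set \<Rightarrow> 'a rel" where
  "dens Y = |SOME D. dense_subset_of D Y \<and> (\<forall>E. dense_subset_of E Y \<longrightarrow> |D| \<le>o |E| )|"

definition is_density_ordinal :: "'a::topological_space itself \<Rightarrow> 'i::wellorder \<Rightarrow> bool" where
  "is_density_ordinal _ \<mu> \<longleftrightarrow>
     |{..<\<mu>}| =o dens (UNIV :: 'a set) \<and> (\<forall>\<nu><\<mu>. \<not> |{..<\<nu>}| =o dens (UNIV :: 'a set))"

text \<open>
  The condition that a union of ranges be dense in the range of \<open>P \<alpha>\<close> concerns the ordinals \<open>\<beta>\<close>
  with \<open>\<omega> \<le> \<beta> < \<alpha>\<close>.  For \<open>\<alpha> = \<omega>\<close> there are none, and the condition cannot be meant, since the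
  empty set is not dense in the range of \<open>P \<omega>\<close>.
\<close>

definition PRI :: "'i::wellorder \<Rightarrow> ('i \<Rightarrow> 'a::real_normed_vector \<Rightarrow> 'a) \<Rightarrow> bool" where
  "PRI \<mu> P \<longleftrightarrow>
     is_density_ordinal TYPE('a) \<mu> \<and>
     (\<forall>\<alpha>\<in>{ord_omega..\<mu>}. bounded_linear (P \<alpha>) \<and> P \<alpha> \<circ> P \<alpha> = P \<alpha> \<and> onorm (P \<alpha>) = 1) \<and>
     (\<forall>\<alpha> \<beta>. ord_omega \<le> \<alpha> \<longrightarrow> \<alpha> \<le> \<beta> \<longrightarrow> \<beta> \<le> \<mu> \<longrightarrow> P \<alpha> \<circ> P \<beta> = P \<alpha> \<and> P \<beta> \<circ> P \<alpha> = P \<alpha>) \<and>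
     (\<forall>\<alpha>\<in>{ord_omega..\<mu>}. dens (range (P \<alpha>)) \<le>o |{..<\<alpha>}| ) \<and>
     (\<forall>\<alpha>\<in>{ord_omega<..\<mu>}.
        dense_subset_of (\<Union>\<beta>\<in>{ord_omega..<\<alpha>}. range (P (ord_succ \<beta>))) (range (P \<alpha>))) \<and>
     P \<mu> = id"

definition PRI_index :: "'i::wellorder \<Rightarrow> 'i set" where
  "PRI_index \<mu> = {ord_zero} \<union> {ord_omega..<\<mu>}"

definition PRI_diff :: "('i::wellorder \<Rightarrow> 'a::real_normed_vector \<Rightarrow> 'a) \<Rightarrow> 'i \<Rightarrow> 'a \<Rightarrow> 'a" where
  "PRI_diff P \<gamma> =
     (if \<gamma> = ord_zero then P ord_omega else (\<lambda>x. P (ord_succ \<gamma>) x - P \<gamma> x))"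

end

theory Submission
  imports Defs
begin

text \<open>
  The theorem glues the norms \<open>p \<gamma>\<close> of the subspaces \<open>Q \<gamma> X\<close> together without losing rotundity or
  smoothness.  By \<open>PRI_orthogonal_decomposition\<close>, every \<open>x\<close> is a norm limit of sums of \<open>Q \<gamma> x\<close> over
  finite sets \<open>B\<close> of indices, and the norms of the \<open>Q \<gamma> x\<close> form an element of \<open>c\<^sub>0\<close>.  Let the residual
  of \<open>x\<close> for \<open>B\<close> be \<open>x\<close> minus the sum over \<open>B\<close>.  To prove that \<open>x\<^sub>r\<close> tends to \<open>x\<close> it is enough that
  \<open>Q \<gamma> x\<^sub>r\<close> tends to \<open>Q \<gamma> x\<close> for each \<open>\<gamma>\<close> in a finite set \<open>B\<close> with small residual of \<open>x\<close>, and
  that the residual of \<open>x\<^sub>r\<close> is asymptotically small as well.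

  Both are enforced by a convex function.  Let \<open>u\<close> be smooth, convex, zero on \<open>(-\<infinity>, 1]\<close> and strictly
  convex and increasing beyond.  Give each finite set \<open>A\<close> of indices the score
  \<open>(\<Sum>\<gamma>\<in>A. u (p \<gamma> (Q \<gamma> x)) - 1) + w\<^sub>A * (\<Sum>B\<subseteq>A. u (norm of the residual of x for B))\<close>, where the weight
  \<open>w\<^sub>A\<close> keeps the second part below \<open>1 / 4\<close> on a given ball.  An index with a small coordinate costs
  \<open>1\<close> and gains at most \<open>1 / 4\<close>.  Hence, if \<open>\<phi>\<close> is smooth and convex, zero up to a level \<open>n\<close> and
  equal to \<open>1\<close> at \<open>n + 1 / 2\<close>, the sum of \<open>\<phi> (score of A)\<close> over all finite sets \<open>A\<close> is locally finite
  near the set where it is at most \<open>1\<close>, although the index set may be uncountable.  The Minkowski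
  gauge of that set, cut down to a ball, is an equivalent norm.  By the implicit function theorem it is as smooth as
  the ingredients (\<open>gauge_smooth\<close>), and it changes at most by a factor \<open>a\<close> if each \<open>p \<gamma>\<close> does
  (\<open>level_norm_comparison\<close>); replacing \<open>p \<gamma>\<close> by smooth norms therefore approximates it by smooth
  norms.  For a high level the gauge of \<open>x\<close> is small, all coordinates in \<open>B\<close> are large on its scale,
  and a set \<open>A \<supseteq> B\<close> contributes to the sum.  Strict convexity of \<open>\<phi>\<close> and \<open>u\<close> then transfers the
  rotundity condition from the gauge to the \<open>p \<gamma>\<close> with \<open>\<gamma> \<in> B\<close> and bounds the residual of \<open>x\<^sub>r\<close>
  (\<open>transfer\<close>).  The norm sought is the weighted square sum of the gauges over all levels and radii.

  The given smooth norm of \<open>X\<close> measures the residuals and bounds the unit balls.  Composition with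
  \<open>u\<close> removes the singularities of all norms at the origin, which makes the summands differentiable
  everywhere.
\<close>

section \<open>Families of functions that are uniformly continuously differentiable\<close>

text \<open>
  A derivative of order \<open>m\<close> is a multilinear form in \<open>m\<close> directions, and the topology on these forms is
  uniform convergence over directions in the unit ball.  Evaluating at fixed directions turns a map
  with values in multilinear forms into a set of real functions, and the operator norm into
  uniformity over that set.  Differentiability of order \<open>n\<close> is therefore developed for sets of real
  functions, uniformly over the set: one differentiation replaces a set by the set of all its
  directional derivatives in directions from the unit ball.  All orders thereby live in the same
  type, and the rules of calculus are proved by induction on the order for arbitrary sets.
\<close>

definition equi_cont :: "'b::real_normed_vector set \<Rightarrow> ('b \<Rightarrow> real) set \<Rightarrow> bool" where
  "equi_cont U S \<longleftrightarrow> (\<forall>x\<in>U. (\<exists>B. \<forall>f\<in>S. \<bar>f x\<bar> \<le> B) \<and>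
     (\<forall>e>0. \<exists>d>0. \<forall>f\<in>S. \<forall>y. norm (y - x) < d \<longrightarrow> \<bar>f y - f x\<bar> < e))"

definition equi_frechet :: "'b::real_normed_vector set \<Rightarrow> ('b \<Rightarrow> real) set \<Rightarrow> bool" where
  "equi_frechet U S \<longleftrightarrow> (\<forall>x\<in>U. (\<forall>f\<in>S. f differentiable (at x)) \<and>
     (\<forall>e>0. \<exists>d>0. \<forall>f\<in>S. \<forall>h. norm h < d \<longrightarrow>
        \<bar>f (x + h) - f x - frechet_derivative f (at x) h\<bar> \<le> e * norm h))"

definition derivatives :: "('b::real_normed_vector \<Rightarrow> real) set \<Rightarrow> ('b \<Rightarrow> real) set" where
  "derivatives S = {\<lambda>x. frechet_derivative f (at x) h |f h. f \<in> S \<and> norm h \<le> 1}"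

lemma derivativesI:
  "f \<in> S \<Longrightarrow> norm h \<le> 1 \<Longrightarrow> (\<lambda>x. frechet_derivative f (at x) h) \<in> derivatives S"
  unfolding derivatives_def by blast

primrec equi_C :: "nat \<Rightarrow> 'b::real_normed_vector set \<Rightarrow> ('b \<Rightarrow> real) set \<Rightarrow> bool" where
  "equi_C 0 U S \<longleftrightarrow> equi_cont U S"
| "equi_C (Suc n) U S \<longleftrightarrow> equi_cont U S \<and> equi_frechet U S \<and> equi_C n U (derivatives S)"

lemma frechet_derivative_cong_open:
  assumes "open V" "x \<in> V" "\<And>y. y \<in> V \<Longrightarrow> f y = g y"
  shows "frechet_derivative f (at x) = frechet_derivative g (at x)"
    and "f differentiable (at x) \<longleftrightarrow> g differentiable (at x)"
proof -
  have "(f has_derivative D) (at x) \<longleftrightarrow> (g has_derivative D) (at x)" for D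
    using has_derivative_transform_within_open[of f D x UNIV V g]
      has_derivative_transform_within_open[of g D x UNIV V f] assms by auto
  then show "frechet_derivative f (at x) = frechet_derivative g (at x)"
    "f differentiable (at x) \<longleftrightarrow> g differentiable (at x)"
    by (simp_all add: frechet_derivative_def differentiable_def)
qed

text \<open>
  Frechet derivatives at interior points are determined by local values.  This yields locality
  and, at the same time, insensitivity to values outside \<open>U\<close> and monotonicity in the set of functions.
\<close>

lemma equi_C_local:
  fixes U :: "'b::real_normed_vector set"
  assumes "\<And>x. x \<in> U \<Longrightarrow> \<exists>V T. open V \<and> x \<in> V \<and> equi_C n V T \<and> (\<forall>f\<in>S. \<exists>g\<in>T. \<forall>y\<in>V. f y = g y)"
  shows "equi_C n U S"
proof -
  have cont: "equi_cont U S" if loc: "\<And>x. x \<in> U \<Longrightarrow> \<exists>V T. open V \<and> x \<in> V \<and> equi_cont V T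
      \<and> (\<forall>f\<in>S. \<exists>g\<in>T. \<forall>y\<in>V. f y = g y)" for S :: "('b \<Rightarrow> real) set"
    unfolding equi_cont_def
  proof (intro ballI conjI allI impI)
    fix x assume x: "x \<in> U"
    then obtain V T where V: "open V" "x \<in> V" "equi_cont V T" "\<forall>f\<in>S. \<exists>g\<in>T. \<forall>y\<in>V. f y = g y"
      using loc by blast
    obtain B where "\<forall>g\<in>T. \<bar>g x\<bar> \<le> B" using V(2,3) unfolding equi_cont_def by blast
    then have "\<forall>f\<in>S. \<bar>f x\<bar> \<le> B" using V(2,4) by fastforce
    then show "\<exists>B. \<forall>f\<in>S. \<bar>f x\<bar> \<le> B" by blast
    fix e :: real assume "e > 0"
    then obtain d where d: "d > 0" "\<forall>g\<in>T. \<forall>y. norm (y - x) < d \<longrightarrow> \<bar>g y - g x\<bar> < e"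
      using V(2,3) unfolding equi_cont_def by blast
    obtain d' where d': "d' > 0" "ball x d' \<subseteq> V" using V(1,2) open_contains_ball by blast
    have "\<forall>f\<in>S. \<forall>y. norm (y - x) < min d d' \<longrightarrow> \<bar>f y - f x\<bar> < e"
    proof (intro ballI allI impI)
      fix f y assume f: "f \<in> S" and y: "norm (y - x) < min d d'"
      obtain g where g: "g \<in> T" "\<forall>y\<in>V. f y = g y" using V(4) f by blast
      have "y \<in> V" using d'(2) y by (auto simp: dist_norm norm_minus_commute)
      then show "\<bar>f y - f x\<bar> < e" using g d y V(2) by auto
    qed
    then show "\<exists>d>0. \<forall>f\<in>S. \<forall>y. norm (y - x) < d \<longrightarrow> \<bar>f y - f x\<bar> < e"
      using d(1) d'(1) by (intro exI[of _ "min d d'"]) auto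
  qed
  show ?thesis using assms
  proof (induction n arbitrary: S)
    case 0
    then show ?case using cont[of S] by simp
  next
    case (Suc n)
    have "equi_cont U S"
    proof (rule cont)
      fix x assume "x \<in> U"
      from Suc.prems[OF this] show "\<exists>V T. open V \<and> x \<in> V \<and> equi_cont V T \<and> (\<forall>f\<in>S. \<exists>g\<in>T. \<forall>y\<in>V. f y = g y)"
        unfolding equi_C.simps by blast
    qed
    moreover have "equi_frechet U S" unfolding equi_frechet_def
    proof (intro ballI conjI allI impI)
      fix x assume "x \<in> U"
      from Suc.prems[OF this] obtain V T where V: "open V" "x \<in> V" "equi_frechet V T"
          "\<forall>f\<in>S. \<exists>g\<in>T. \<forall>y\<in>V. f y = g y"
        unfolding equi_C.simps by blast
      show "f differentiable at x" if "f \<in> S" for f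
      proof -
        obtain g where g: "g \<in> T" "\<forall>y\<in>V. f y = g y" using V(4) \<open>f \<in> S\<close> by blast
        then have "g differentiable at x" using V(2,3) unfolding equi_frechet_def by blast
        then show ?thesis using frechet_derivative_cong_open(2)[OF V(1,2), of f g] g(2) by blast
      qed
      fix e :: real assume "e > 0"
      then obtain d where d: "d > 0" "\<forall>g\<in>T. \<forall>h. norm h < d \<longrightarrow>
          \<bar>g (x + h) - g x - frechet_derivative g (at x) h\<bar> \<le> e * norm h"
        using V(2,3) unfolding equi_frechet_def by blast
      obtain d' where d': "d' > 0" "ball x d' \<subseteq> V" using V(1,2) open_contains_ball by blast
      have "\<forall>f\<in>S. \<forall>h. norm h < min d d' \<longrightarrow>
         \<bar>f (x + h) - f x - frechet_derivative f (at x) h\<bar> \<le> e * norm h"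
      proof (intro ballI allI impI)
        fix f and h :: 'b assume f: "f \<in> S" and h: "norm h < min d d'"
        obtain g where g: "g \<in> T" "\<forall>y\<in>V. f y = g y" using V(4) f by blast
        have "x + h \<in> V" using d'(2) h by (auto simp: dist_norm)
        moreover have "frechet_derivative f (at x) = frechet_derivative g (at x)"
          using frechet_derivative_cong_open(1)[OF V(1,2)] g(2) by blast
        ultimately show "\<bar>f (x + h) - f x - frechet_derivative f (at x) h\<bar> \<le> e * norm h"
          using g d h V(2) by auto
      qed
      then show "\<exists>d>0. \<forall>f\<in>S. \<forall>h. norm h < d \<longrightarrow>
         \<bar>f (x + h) - f x - frechet_derivative f (at x) h\<bar> \<le> e * norm h"
        using d(1) d'(1) by (intro exI[of _ "min d d'"]) auto
    qed
    moreover have "equi_C n U (derivatives S)"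
    proof (rule Suc.IH)
      fix x assume "x \<in> U"
      from Suc.prems[OF this] obtain V T where V: "open V" "x \<in> V" "equi_C n V (derivatives T)"
          "\<forall>f\<in>S. \<exists>g\<in>T. \<forall>y\<in>V. f y = g y"
        unfolding equi_C.simps by blast
      have "\<forall>f\<in>derivatives S. \<exists>g\<in>derivatives T. \<forall>y\<in>V. f y = g y"
      proof
        fix k assume "k \<in> derivatives S"
        then obtain f h where k: "k = (\<lambda>x. frechet_derivative f (at x) h)" "f \<in> S" "norm h \<le> 1"
          unfolding derivatives_def by blast
        obtain g where g: "g \<in> T" "\<forall>y\<in>V. f y = g y" using V(4) k by blast
        have "\<forall>y\<in>V. k y = frechet_derivative g (at y) h"
          using frechet_derivative_cong_open(1)[OF V(1), of _ f g] g(2) k(1) by simp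
        then show "\<exists>g\<in>derivatives T. \<forall>y\<in>V. k y = g y"
          using derivativesI[OF g(1) k(3)] by fast
      qed
      then show "\<exists>V T. open V \<and> x \<in> V \<and> equi_C n V T \<and> (\<forall>f\<in>derivatives S. \<exists>g\<in>T. \<forall>y\<in>V. f y = g y)"
        using V by blast
    qed
    ultimately show ?case by simp
  qed
qed

lemma equi_C_mono:
  assumes "equi_C n U T" "open U" "\<And>f. f \<in> S \<Longrightarrow> \<exists>g\<in>T. \<forall>y\<in>U. f y = g y"
  shows "equi_C n U S"
  by (rule equi_C_local) (use assms in blast)

lemma equi_C_imp_cont: "equi_C n U S \<Longrightarrow> equi_cont U S"
  by (cases n) auto

lemma equi_C_Suc_imp: "equi_C (Suc n) U S \<Longrightarrow> equi_C n U S"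
  by (induction n arbitrary: S) auto

lemma equi_C_le: "m \<le> n \<Longrightarrow> equi_C n U S \<Longrightarrow> equi_C m U S"
  by (induction rule: inc_induct) (auto intro: equi_C_Suc_imp simp del: equi_C.simps(2))

lemma equi_C_bounded: "equi_C n U S \<Longrightarrow> x \<in> U \<Longrightarrow> \<exists>B>0. \<forall>f\<in>S. \<bar>f x\<bar> \<le> B"
proof -
  assume "equi_C n U S" "x \<in> U"
  then obtain B where "\<forall>f\<in>S. \<bar>f x\<bar> \<le> B"
    using equi_C_imp_cont unfolding equi_cont_def by blast
  then show ?thesis by (intro exI[of _ "max B 1"]) fastforce
qed

text \<open>
  A bound over the unit ball only, as provided by the pointwise boundedness of a set of directional
  derivatives, controls a linear functional everywhere.
\<close>

lemma linear_functional_bound: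
  fixes L :: "'b::real_normed_vector \<Rightarrow> real"
  assumes "linear L" "\<And>h. norm h \<le> 1 \<Longrightarrow> \<bar>L h\<bar> \<le> B"
  shows "\<bar>L h\<bar> \<le> B * norm h"
proof (cases "h = 0")
  case True
  then show ?thesis using assms(1) by (simp add: linear_0)
next
  case False
  have "L h = norm h * L (h /\<^sub>R norm h)"
    using False linear_scale[OF assms(1), of "inverse (norm h)" h] by simp
  moreover have "\<bar>L (h /\<^sub>R norm h)\<bar> \<le> B" by (rule assms(2)) (simp add: False)
  ultimately have "\<bar>L h\<bar> = norm h * \<bar>L (h /\<^sub>R norm h)\<bar>" "\<bar>L (h /\<^sub>R norm h)\<bar> \<le> B"
    by (auto simp add: abs_mult)
  then show ?thesis using mult_left_mono[of "\<bar>L (h /\<^sub>R norm h)\<bar>" B "norm h"] by (simp add: mult.commute)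
qed

text \<open>
  The rule for computing with derivatives: candidates \<open>D\<close> need to agree with members of a set \<open>T\<close> of
  order \<open>n\<close> on \<open>U\<close> only.  Equicontinuity comes for free, since \<open>T\<close> is pointwise bounded.
\<close>

lemma equi_C_SucI:
  fixes D :: "('b::real_normed_vector \<Rightarrow> real) \<Rightarrow> 'b \<Rightarrow> 'b \<Rightarrow> real"
  assumes U: "open U"
    and bdd: "\<And>x. x \<in> U \<Longrightarrow> \<exists>B. \<forall>f\<in>S. \<bar>f x\<bar> \<le> B"
    and lin: "\<And>f x. f \<in> S \<Longrightarrow> x \<in> U \<Longrightarrow> linear (D f x)"
    and fre: "\<And>x e. x \<in> U \<Longrightarrow> e > 0 \<Longrightarrow> \<exists>d>0. \<forall>f\<in>S. \<forall>h. norm h < d \<longrightarrow>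
        \<bar>f (x + h) - f x - D f x h\<bar> \<le> e * norm h"
    and T: "equi_C n U T"
    and DT: "\<And>f h. f \<in> S \<Longrightarrow> norm h \<le> 1 \<Longrightarrow> \<exists>g\<in>T. \<forall>x\<in>U. D f x h = g x"
  shows "equi_C (Suc n) U S"
proof -
  have bd: "\<exists>B>0. \<forall>f\<in>S. \<forall>h. \<bar>D f x h\<bar> \<le> B * norm h" if x: "x \<in> U" for x
  proof -
    obtain B where "B > 0" "\<forall>f\<in>T. \<bar>f x\<bar> \<le> B" using equi_C_bounded[OF T x] by blast
    then have "\<bar>D f x h\<bar> \<le> B" if "f \<in> S" "norm h \<le> 1" for f h using DT[OF that] x by auto
    then have "\<forall>f\<in>S. \<forall>h. \<bar>D f x h\<bar> \<le> B * norm h" using linear_functional_bound[OF lin[OF _ x]] by blast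
    then show ?thesis using \<open>B > 0\<close> by blast
  qed
  have der: "(f has_derivative D f x) (at x)" if fx: "f \<in> S" "x \<in> U" for f x
  proof -
    have "bounded_linear (D f x)"
    proof -
      obtain B where "\<forall>h. \<bar>D f x h\<bar> \<le> B * norm h" using bd[OF fx(2)] fx(1) by blast
      then show ?thesis using lin[OF fx] 
        by (intro bounded_linear.intro bounded_linear_axioms.intro) (auto simp: mult.commute)
    qed
    moreover have "((\<lambda>h. norm (f (x + h) - f x - D f x h) / norm h) \<longlongrightarrow> 0) (at 0)"
    proof (rule LIM_I)
      fix r :: real assume "r > 0"
      then obtain d where d: "d > 0" "\<forall>h. norm h < d \<longrightarrow> \<bar>f (x + h) - f x - D f x h\<bar> \<le> r/2 * norm h"
        using fre[OF fx(2), of "r/2"] fx(1) by (metis half_gt_zero)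
      have "norm (norm (f (x + h) - f x - D f x h) / norm h - 0) < r" if "h \<noteq> 0 \<and> norm (h - 0) < d" for h
      proof -
        have "\<bar>f (x + h) - f x - D f x h\<bar> \<le> r/2 * norm h" using d that by auto
        then have "\<bar>f (x + h) - f x - D f x h\<bar> / norm h \<le> r/2" using that
          by (simp add: divide_simps)
        also have "\<dots> < r" using \<open>r > 0\<close> by simp
        finally show ?thesis by simp
      qed
      then show "\<exists>s>0. \<forall>h. h \<noteq> 0 \<and> norm (h - 0) < s \<longrightarrow> norm (norm (f (x + h) - f x - D f x h) / norm h - 0) < r"
        using d(1) by blast
    qed
    ultimately show ?thesis unfolding has_derivative_at by simp
  qed
  then have fd: "frechet_derivative f (at x) = D f x" if "f \<in> S" "x \<in> U" for f x
    using that frechet_derivative_at by metis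
  have "equi_cont U S" unfolding equi_cont_def
  proof (intro ballI conjI allI impI)
    fix x assume x: "x \<in> U"
    then show "\<exists>B. \<forall>f\<in>S. \<bar>f x\<bar> \<le> B" by (rule bdd)
    fix e :: real assume e: "e > 0"
    obtain B where B: "B > 0" "\<forall>f\<in>S. \<forall>h. \<bar>D f x h\<bar> \<le> B * norm h" using bd[OF x] by blast
    obtain d where d: "d > 0" "\<forall>f\<in>S. \<forall>h. norm h < d \<longrightarrow> \<bar>f (x + h) - f x - D f x h\<bar> \<le> 1 * norm h"
      using fre[OF x, of 1] by auto
    have "\<forall>f\<in>S. \<forall>y. norm (y - x) < min d (e / (B + 1)) \<longrightarrow> \<bar>f y - f x\<bar> < e"
    proof (intro ballI allI impI)
      fix f y assume f: "f \<in> S" and y: "norm (y - x) < min d (e / (B + 1))"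
      have "\<bar>f (x + (y - x)) - f x - D f x (y - x)\<bar> \<le> 1 * norm (y - x)"
        using d(2)[rule_format, OF f, of "y - x"] y by linarith
      moreover have "\<bar>D f x (y - x)\<bar> \<le> B * norm (y - x)" using B f by blast
      ultimately have "\<bar>f y - f x\<bar> \<le> (B + 1) * norm (y - x)" by (simp add: algebra_simps)
      also have "\<dots> < (B + 1) * (e / (B + 1))" using y B(1) by (intro mult_strict_left_mono) auto
      also have "\<dots> = e" using B(1) by simp
      finally show "\<bar>f y - f x\<bar> < e" .
    qed
    then show "\<exists>d>0. \<forall>f\<in>S. \<forall>y. norm (y - x) < d \<longrightarrow> \<bar>f y - f x\<bar> < e"
      using d(1) e B(1) by (intro exI[of _ "min d (e / (B + 1))"]) auto
  qed
  moreover have "equi_frechet U S" unfolding equi_frechet_def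
  proof (intro ballI conjI allI impI)
    fix x assume x: "x \<in> U"
    show "f differentiable at x" if "f \<in> S" for f using der[OF that x] differentiable_def by blast
    fix e :: real assume "e > 0"
    then show "\<exists>d>0. \<forall>f\<in>S. \<forall>h. norm h < d \<longrightarrow>
        \<bar>f (x + h) - f x - frechet_derivative f (at x) h\<bar> \<le> e * norm h"
      using fre[OF x] fd[OF _ x] by simp
  qed
  moreover have "equi_C n U (derivatives S)"
  proof (rule equi_C_mono[OF T U])
    fix k assume "k \<in> derivatives S"
    then obtain f h where k: "k = (\<lambda>x. frechet_derivative f (at x) h)" "f \<in> S" "norm h \<le> 1"
      unfolding derivatives_def by blast
    then show "\<exists>g\<in>T. \<forall>y\<in>U. k y = g y" using DT[OF k(2,3)] fd[OF k(2)] by simp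
  qed
  ultimately show ?thesis by simp
qed

lemma equi_C_SucD:
  assumes "equi_C (Suc n) U S"
  shows "\<And>f x. f \<in> S \<Longrightarrow> x \<in> U \<Longrightarrow> (f has_derivative frechet_derivative f (at x)) (at x)"
    and "\<And>f x. f \<in> S \<Longrightarrow> x \<in> U \<Longrightarrow> linear (frechet_derivative f (at x))"
    and "\<And>x e. x \<in> U \<Longrightarrow> e > 0 \<Longrightarrow> \<exists>d>0. \<forall>f\<in>S. \<forall>h. norm h < d \<longrightarrow>
        \<bar>f (x + h) - f x - frechet_derivative f (at x) h\<bar> \<le> e * norm h"
    and "equi_C n U (derivatives S)"
    and "\<And>x. x \<in> U \<Longrightarrow> \<exists>B>0. \<forall>f\<in>S. \<forall>h. \<bar>frechet_derivative f (at x) h\<bar> \<le> B * norm h"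
proof -
  show d: "(f has_derivative frechet_derivative f (at x)) (at x)" if "f \<in> S" "x \<in> U" for f x
    using assms that by (simp add: equi_frechet_def frechet_derivative_works)
  show l: "linear (frechet_derivative f (at x))" if "f \<in> S" "x \<in> U" for f x
    using d[OF that] has_derivative_linear by blast
  show "\<exists>d>0. \<forall>f\<in>S. \<forall>h. norm h < d \<longrightarrow>
        \<bar>f (x + h) - f x - frechet_derivative f (at x) h\<bar> \<le> e * norm h" if "x \<in> U" "e > 0" for x e
    using assms that by (simp add: equi_frechet_def)
  show C: "equi_C n U (derivatives S)" using assms by simp
  show "\<exists>B>0. \<forall>f\<in>S. \<forall>h. \<bar>frechet_derivative f (at x) h\<bar> \<le> B * norm h" if x: "x \<in> U" for x
  proof -
    obtain B where B: "B > 0" "\<forall>f\<in>derivatives S. \<bar>f x\<bar> \<le> B" using equi_C_bounded[OF C x] by blast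
    have "\<bar>frechet_derivative f (at x) h\<bar> \<le> B" if "f \<in> S" "norm h \<le> 1" for f h
    proof -
      have "(\<lambda>x. frechet_derivative f (at x) h) \<in> derivatives S"
        using derivativesI that by blast
      then have "\<bar>(\<lambda>x. frechet_derivative f (at x) h) x\<bar> \<le> B" using B(2) by fast
      then show ?thesis by simp
    qed
    then have "\<forall>f\<in>S. \<forall>h. \<bar>frechet_derivative f (at x) h\<bar> \<le> B * norm h"
      using linear_functional_bound[OF l[OF _ x]] by blast
    then show ?thesis using B(1) by blast
  qed
qed

definition sum_family :: "('b \<Rightarrow> real) set \<Rightarrow> ('b \<Rightarrow> real) set \<Rightarrow> ('b \<Rightarrow> real) set" where
  "sum_family S T = {\<lambda>x. f x + g x |f g. f \<in> S \<and> g \<in> T}"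

definition product_family :: "('b \<Rightarrow> real) set \<Rightarrow> ('b \<Rightarrow> real) set \<Rightarrow> ('b \<Rightarrow> real) set" where
  "product_family S T = {\<lambda>x. f x * g x |f g. f \<in> S \<and> g \<in> T}"

lemma sum_familyI: "f \<in> S \<Longrightarrow> g \<in> T \<Longrightarrow> (\<lambda>x. f x + g x) \<in> sum_family S T"
  unfolding sum_family_def by blast

lemma sum_familyE:
  assumes "k \<in> sum_family S T"
  obtains f g where "k = (\<lambda>x. f x + g x)" "f \<in> S" "g \<in> T"
  using assms unfolding sum_family_def by blast

lemma product_familyI: "f \<in> S \<Longrightarrow> g \<in> T \<Longrightarrow> (\<lambda>x. f x * g x) \<in> product_family S T"
  unfolding product_family_def by blast

lemma product_familyE:
  assumes "k \<in> product_family S T"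
  obtains f g where "k = (\<lambda>x. f x * g x)" "f \<in> S" "g \<in> T"
  using assms unfolding product_family_def by blast

lemma abs_sum_products_le:
  fixes a :: real
  assumes "a = p * q + r * s + t * v"
  shows "\<bar>a\<bar> \<le> \<bar>p\<bar> * \<bar>q\<bar> + \<bar>r\<bar> * \<bar>s\<bar> + \<bar>t\<bar> * \<bar>v\<bar>"
  unfolding assms abs_mult[symmetric] by linarith

text \<open>
  For a single function uniformity over the set is void, and an ordinary derivative suffices.
\<close>

lemma equi_C_singleI:
  fixes f :: "'b::real_normed_vector \<Rightarrow> real"
  assumes U: "open U"
    and der: "\<And>x. x \<in> U \<Longrightarrow> (f has_derivative D x) (at x)"
    and T: "equi_C n U T"
    and DT: "\<And>h. norm h \<le> 1 \<Longrightarrow> \<exists>g\<in>T. \<forall>x\<in>U. D x h = g x"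
  shows "equi_C (Suc n) U {f}"
proof (rule equi_C_SucI[where D = "\<lambda>_. D" and T = T])
  show "\<exists>B. \<forall>f\<in>{f}. \<bar>f x\<bar> \<le> B" for x by auto
  show "linear (D x)" if "x \<in> U" for x using der[OF that] has_derivative_linear by blast
  fix x :: 'b and e :: real assume x: "x \<in> U" and e: "e > 0"
  obtain d where d: "d > 0" "\<forall>y. norm (y - x) < d \<longrightarrow> norm (f y - f x - D x (y - x)) \<le> e * norm (y - x)"
    using der[OF x] e unfolding has_derivative_at_alt by blast
  have "\<forall>h. norm h < d \<longrightarrow> \<bar>f (x + h) - f x - D x h\<bar> \<le> e * norm h"
  proof (intro allI impI)
    fix h :: 'b assume "norm h < d"
    then show "\<bar>f (x + h) - f x - D x h\<bar> \<le> e * norm h" using d(2)[rule_format, of "x + h"] by simp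
  qed
  then show "\<exists>d>0. \<forall>f\<in>{f}. \<forall>h. norm h < d \<longrightarrow> \<bar>f (x + h) - f x - D x h\<bar> \<le> e * norm h"
    using d(1) by blast
qed (use U T DT in auto)

lemma equi_C_const:
  fixes U :: "'b::real_normed_vector set"
  assumes "open U"
  shows "equi_C n U {\<lambda>x. c |c. \<bar>c\<bar> \<le> B}"
proof (induction n)
  case 0
  have "\<exists>B'. \<forall>f\<in>{\<lambda>x::'b. c |c. \<bar>c\<bar> \<le> B}. \<bar>f x\<bar> \<le> B'" for x by (intro exI[of _ B]) auto
  then show ?case by (auto simp: equi_cont_def intro: exI[of _ 1])
next
  case (Suc n)
  show ?case
  proof (rule equi_C_SucI[OF assms, where D = "\<lambda>_ _ _. 0", OF _ _ _ Suc])
    show "\<exists>B'. \<forall>f\<in>{\<lambda>x::'b. c |c. \<bar>c\<bar> \<le> B}. \<bar>f x\<bar> \<le> B'" for x by (intro exI[of _ B]) auto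
    show "\<exists>g\<in>{\<lambda>x::'b. c |c. \<bar>c\<bar> \<le> B}. \<forall>x\<in>U. 0 = g x" if "f \<in> {\<lambda>x::'b. c |c. \<bar>c\<bar> \<le> B}" for f
      using that by (intro bexI[of _ "\<lambda>_. 0"]) auto
    show "\<exists>d>0. \<forall>f\<in>{\<lambda>x::'b. c |c. \<bar>c\<bar> \<le> B}. \<forall>h. norm h < d \<longrightarrow> \<bar>f (x + h) - f x - 0\<bar> \<le> e * norm h"
      if "e > 0" for x and e :: real
      using that by (auto intro: exI[of _ 1])
    show "linear (\<lambda>h::'b. 0 :: real)" by (rule linear_zero)
  qed
qed

lemma equi_C_add:
  fixes U :: "'b::real_normed_vector set"
  assumes U: "open U"
  shows "equi_C n U S \<Longrightarrow> equi_C n U T \<Longrightarrow> equi_C n U (sum_family S T)"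
proof (induction n arbitrary: S T)
  case 0
  show ?case unfolding equi_C.simps(1) equi_cont_def
  proof (intro ballI conjI allI impI)
    fix x assume x: "x \<in> U"
    obtain A B where "\<forall>f\<in>S. \<bar>f x\<bar> \<le> A" "\<forall>f\<in>T. \<bar>f x\<bar> \<le> B"
      using 0 x unfolding equi_C.simps(1) equi_cont_def by metis
    then have "\<forall>k\<in>sum_family S T. \<bar>k x\<bar> \<le> A + B" by (fastforce elim!: sum_familyE)
    then show "\<exists>B. \<forall>k\<in>sum_family S T. \<bar>k x\<bar> \<le> B" by blast
    fix e :: real assume "e > 0"
    then have e: "e / 2 > 0" by simp
    obtain d1 where d1: "d1 > 0" "\<forall>f\<in>S. \<forall>y. norm (y - x) < d1 \<longrightarrow> \<bar>f y - f x\<bar> < e/2"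
      using 0(1) x e unfolding equi_C.simps(1) equi_cont_def by metis
    obtain d2 where d2: "d2 > 0" "\<forall>f\<in>T. \<forall>y. norm (y - x) < d2 \<longrightarrow> \<bar>f y - f x\<bar> < e/2"
      using 0(2) x e unfolding equi_C.simps(1) equi_cont_def by metis
    have "\<forall>k\<in>sum_family S T. \<forall>y. norm (y - x) < min d1 d2 \<longrightarrow> \<bar>k y - k x\<bar> < e"
    proof (intro ballI allI impI)
      fix k y assume k: "k \<in> sum_family S T" and y: "norm (y - x) < min d1 d2"
      obtain f g where fg: "k = (\<lambda>x. f x + g x)" "f \<in> S" "g \<in> T" using k by (rule sum_familyE)
      have "\<bar>f y - f x\<bar> < e/2" "\<bar>g y - g x\<bar> < e/2" using d1 d2 fg y by auto
      then show "\<bar>k y - k x\<bar> < e" unfolding fg(1) by linarith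
    qed
    then show "\<exists>d>0. \<forall>k\<in>sum_family S T. \<forall>y. norm (y - x) < d \<longrightarrow> \<bar>k y - k x\<bar> < e"
      using d1(1) d2(1) by (intro exI[of _ "min d1 d2"]) auto
  qed
next
  case (Suc n)
  let ?K = "sum_family S T"
  note S = equi_C_SucD[OF Suc.prems(1)]
  note T = equi_C_SucD[OF Suc.prems(2)]
  have der: "((\<lambda>x. f x + g x) has_derivative (\<lambda>h. frechet_derivative f (at x) h + frechet_derivative g (at x) h)) (at x)"
    if "f \<in> S" "g \<in> T" "x \<in> U" for f g x
    using S(1)[OF that(1,3)] T(1)[OF that(2,3)] by (rule has_derivative_add)
  have fd: "frechet_derivative (\<lambda>x. f x + g x) (at x) = (\<lambda>h. frechet_derivative f (at x) h + frechet_derivative g (at x) h)"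
    if "f \<in> S" "g \<in> T" "x \<in> U" for f g x
    using frechet_derivative_at[OF der[OF that]] by simp
  show ?case
  proof (rule equi_C_SucI[OF U, where D = "\<lambda>k x. frechet_derivative k (at x)", OF _ _ _ Suc.IH[OF S(4) T(4)]])
    show "linear (frechet_derivative k (at x))" if "k \<in> ?K" "x \<in> U" for k x
      using that(1) has_derivative_linear[OF der[OF _ _ that(2)]] fd[OF _ _ that(2)] by (auto elim!: sum_familyE)
    fix x assume x: "x \<in> U"
    obtain A B where "\<forall>f\<in>S. \<bar>f x\<bar> \<le> A" "\<forall>f\<in>T. \<bar>f x\<bar> \<le> B"
      using Suc.prems equi_C_bounded[OF _ x] by metis
    then have "\<forall>k\<in>?K. \<bar>k x\<bar> \<le> A + B" by (fastforce elim!: sum_familyE)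
    then show "\<exists>B. \<forall>k\<in>?K. \<bar>k x\<bar> \<le> B" by blast
    fix e :: real assume "e > 0"
    then have e: "e / 2 > 0" by simp
    obtain d1 where d1: "d1 > 0" "\<forall>f\<in>S. \<forall>h. norm h < d1 \<longrightarrow>
        \<bar>f (x + h) - f x - frechet_derivative f (at x) h\<bar> \<le> e/2 * norm h" using S(3)[OF x e] by blast
    obtain d2 where d2: "d2 > 0" "\<forall>f\<in>T. \<forall>h. norm h < d2 \<longrightarrow>
        \<bar>f (x + h) - f x - frechet_derivative f (at x) h\<bar> \<le> e/2 * norm h" using T(3)[OF x e] by blast
    have "\<forall>k\<in>?K. \<forall>h. norm h < min d1 d2 \<longrightarrow> \<bar>k (x + h) - k x - frechet_derivative k (at x) h\<bar> \<le> e * norm h"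
    proof (intro ballI allI impI)
      fix k and h :: 'b assume k: "k \<in> ?K" and y: "norm h < min d1 d2"
      obtain f g where fg: "k = (\<lambda>x. f x + g x)" "f \<in> S" "g \<in> T" using k by (rule sum_familyE)
      have "\<bar>f (x + h) - f x - frechet_derivative f (at x) h\<bar> \<le> e/2 * norm h"
        "\<bar>g (x + h) - g x - frechet_derivative g (at x) h\<bar> \<le> e/2 * norm h"
        using d1(2) d2(2) fg(2,3) y by simp_all
      then have "\<bar>f (x + h) + g (x + h) - (f x + g x) - (frechet_derivative f (at x) h + frechet_derivative g (at x) h)\<bar>
           \<le> e/2 * norm h + e/2 * norm h" by linarith
      then show "\<bar>k (x + h) - k x - frechet_derivative k (at x) h\<bar> \<le> e * norm h"
        unfolding fg(1) fd[OF fg(2,3) x] by simp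
    qed
    then show "\<exists>d>0. \<forall>k\<in>?K. \<forall>h. norm h < d \<longrightarrow> \<bar>k (x + h) - k x - frechet_derivative k (at x) h\<bar> \<le> e * norm h"
      using d1(1) d2(1) by (intro exI[of _ "min d1 d2"]) auto
  next
    fix k and h :: 'b assume k: "k \<in> ?K" and h: "norm h \<le> 1"
    obtain f g where fg: "k = (\<lambda>x. f x + g x)" "f \<in> S" "g \<in> T" using k by (rule sum_familyE)
    show "\<exists>g\<in>sum_family (derivatives S) (derivatives T). \<forall>x\<in>U. frechet_derivative k (at x) h = g x"
      by (rule bexI[OF _ sum_familyI[OF derivativesI[OF fg(2) h] derivativesI[OF fg(3) h]]])
         (simp add: fg(1) fd[OF fg(2,3)])
  qed
qed

text \<open>
  By the product rule, the derivatives of products are sums of two products, each with one factor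
  differentiated; both are covered by the induction hypothesis, which is why products have to be
  treated for sets of functions even when only products of two functions are of interest.
\<close>

lemma equi_C_mult:
  fixes U :: "'b::real_normed_vector set"
  assumes U: "open U"
  shows "equi_C n U S \<Longrightarrow> equi_C n U T \<Longrightarrow> equi_C n U (product_family S T)"
proof (induction n arbitrary: S T)
  case 0
  show ?case unfolding equi_C.simps(1) equi_cont_def
  proof (intro ballI conjI allI impI)
    fix x assume x: "x \<in> U"
    obtain A B where AB: "A > 0" "B > 0" "\<forall>f\<in>S. \<bar>f x\<bar> \<le> A" "\<forall>f\<in>T. \<bar>f x\<bar> \<le> B"
      using 0 equi_C_bounded[OF _ x] by metis
    have "\<forall>k\<in>product_family S T. \<bar>k x\<bar> \<le> A * B"
      using AB by (auto simp: abs_mult elim!: product_familyE intro!: mult_mono)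
    then show "\<exists>B. \<forall>k\<in>product_family S T. \<bar>k x\<bar> \<le> B" by blast
    fix e :: real assume e: "e > 0"
    define e1 where "e1 = min 1 (e / (A + B + 1))"
    have e1: "e1 > 0" "e1 \<le> 1" "e1 \<le> e / (A + B + 1)" using e AB by (auto simp: e1_def)
    obtain d1 where d1: "d1 > 0" "\<forall>f\<in>S. \<forall>y. norm (y - x) < d1 \<longrightarrow> \<bar>f y - f x\<bar> < e1"
      using 0(1) x e1(1) unfolding equi_C.simps(1) equi_cont_def by metis
    obtain d2 where d2: "d2 > 0" "\<forall>f\<in>T. \<forall>y. norm (y - x) < d2 \<longrightarrow> \<bar>f y - f x\<bar> < e1"
      using 0(2) x e1(1) unfolding equi_C.simps(1) equi_cont_def by metis
    have "\<forall>k\<in>product_family S T. \<forall>y. norm (y - x) < min d1 d2 \<longrightarrow> \<bar>k y - k x\<bar> < e"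
    proof (intro ballI allI impI)
      fix k y assume k: "k \<in> product_family S T" and y: "norm (y - x) < min d1 d2"
      obtain f g where fg: "k = (\<lambda>x. f x * g x)" "f \<in> S" "g \<in> T" using k by (rule product_familyE)
      have 1: "\<bar>f y - f x\<bar> < e1" "\<bar>g y - g x\<bar> < e1" using d1 d2 fg y by auto
      have 2: "\<bar>f x\<bar> \<le> A" "\<bar>g x\<bar> \<le> B" using AB fg by auto
      have "f y * g y - f x * g x = (f y - f x) * (g y - g x) + f x * (g y - g x) + (f y - f x) * g x"
        by (simp add: algebra_simps)
      from abs_sum_products_le[OF this] have "\<bar>f y * g y - f x * g x\<bar> \<le> \<bar>f y - f x\<bar> * \<bar>g y - g x\<bar> + \<bar>f x\<bar> * \<bar>g y - g x\<bar> + \<bar>f y - f x\<bar> * \<bar>g x\<bar>" .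
      also have "\<bar>f y - f x\<bar> * \<bar>g y - g x\<bar> < 1 * e1" using 1 e1 by (intro mult_strict_mono') auto
      also have "\<bar>f x\<bar> * \<bar>g y - g x\<bar> \<le> A * e1" using 1 2 e1 by (intro mult_mono) auto
      also have "\<bar>f y - f x\<bar> * \<bar>g x\<bar> \<le> e1 * B" using 1 2 e1 by (intro mult_mono) auto
      finally have "\<bar>f y * g y - f x * g x\<bar> < (A + B + 1) * e1" by (simp add: algebra_simps)
      also have "\<dots> \<le> e" using e1(3) AB by (simp add: field_simps)
      finally show "\<bar>k y - k x\<bar> < e" unfolding fg(1) .
    qed
    then show "\<exists>d>0. \<forall>k\<in>product_family S T. \<forall>y. norm (y - x) < d \<longrightarrow> \<bar>k y - k x\<bar> < e"
      using d1(1) d2(1) by (intro exI[of _ "min d1 d2"]) auto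
  qed
next
  case (Suc n)
  let ?K = "product_family S T"
  note S = equi_C_SucD[OF Suc.prems(1)]
  note T = equi_C_SucD[OF Suc.prems(2)]
  have der: "((\<lambda>x. f x * g x) has_derivative (\<lambda>h. f x * frechet_derivative g (at x) h + frechet_derivative f (at x) h * g x)) (at x)"
    if "f \<in> S" "g \<in> T" "x \<in> U" for f g x
    using S(1)[OF that(1,3)] T(1)[OF that(2,3)] by (rule has_derivative_mult)
  have fd: "frechet_derivative (\<lambda>x. f x * g x) (at x) = (\<lambda>h. f x * frechet_derivative g (at x) h + frechet_derivative f (at x) h * g x)"
    if "f \<in> S" "g \<in> T" "x \<in> U" for f g x
    using frechet_derivative_at[OF der[OF that]] by simp
  note P = equi_C_add[OF U Suc.IH[OF equi_C_Suc_imp[OF Suc.prems(1)] T(4)] Suc.IH[OF S(4) equi_C_Suc_imp[OF Suc.prems(2)]]]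
  show ?case
  proof (rule equi_C_SucI[OF U, where D = "\<lambda>k x. frechet_derivative k (at x)", OF _ _ _ P])
    show "linear (frechet_derivative k (at x))" if "k \<in> ?K" "x \<in> U" for k x
      using that(1) has_derivative_linear[OF der[OF _ _ that(2)]] fd[OF _ _ that(2)] by (auto elim!: product_familyE)
    fix x assume x: "x \<in> U"
    obtain A B where AB: "A > 0" "B > 0" "\<forall>f\<in>S. \<bar>f x\<bar> \<le> A" "\<forall>f\<in>T. \<bar>f x\<bar> \<le> B"
      using Suc.prems equi_C_bounded[OF _ x] by metis
    have "\<forall>k\<in>?K. \<bar>k x\<bar> \<le> A * B" using AB by (auto simp: abs_mult elim!: product_familyE intro!: mult_mono)
    then show "\<exists>B. \<forall>k\<in>?K. \<bar>k x\<bar> \<le> B" by blast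
    obtain L where L: "L > 0" "\<forall>f\<in>S. \<forall>h. \<bar>frechet_derivative f (at x) h\<bar> \<le> L * norm h" using S(5)[OF x] by blast
    fix e :: real assume e: "e > 0"
    define e1 where "e1 = min 1 (e / (A + B + L + 1))"
    have e1: "e1 > 0" "e1 \<le> 1" "e1 \<le> e / (A + B + L + 1)" using e AB L by (auto simp: e1_def)
    obtain d1 where d1: "d1 > 0" "\<forall>f\<in>S. \<forall>h. norm h < d1 \<longrightarrow>
        \<bar>f (x + h) - f x - frechet_derivative f (at x) h\<bar> \<le> e1 * norm h" using S(3)[OF x e1(1)] by blast
    obtain d2 where d2: "d2 > 0" "\<forall>f\<in>T. \<forall>h. norm h < d2 \<longrightarrow>
        \<bar>f (x + h) - f x - frechet_derivative f (at x) h\<bar> \<le> e1 * norm h" using T(3)[OF x e1(1)] by blast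
    obtain d3 where d3: "d3 > 0" "\<forall>f\<in>T. \<forall>y. norm (y - x) < d3 \<longrightarrow> \<bar>f y - f x\<bar> < e1"
      using equi_C_imp_cont[OF Suc.prems(2)] x e1(1) unfolding equi_cont_def by metis
    have "\<forall>k\<in>?K. \<forall>h. norm h < min (min d1 d2) d3 \<longrightarrow> \<bar>k (x + h) - k x - frechet_derivative k (at x) h\<bar> \<le> e * norm h"
    proof (intro ballI allI impI)
      fix k and h :: 'b assume k: "k \<in> ?K" and y: "norm h < min (min d1 d2) d3"
      obtain f g where fg: "k = (\<lambda>x. f x * g x)" "f \<in> S" "g \<in> T" using k by (rule product_familyE)
      define df dg where "df = frechet_derivative f (at x) h" and "dg = frechet_derivative g (at x) h"
      have 1: "\<bar>f (x + h) - f x - df\<bar> \<le> e1 * norm h" "\<bar>g (x + h) - g x - dg\<bar> \<le> e1 * norm h"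
        using d1(2) d2(2) fg(2,3) y by (simp_all add: df_def dg_def)
      have 2: "\<bar>g (x + h) - g x\<bar> < e1" using d3(2)[rule_format, OF fg(3), of "x + h"] y by simp
      have 3: "\<bar>f x\<bar> \<le> A" "\<bar>g x\<bar> \<le> B" using AB fg by auto
      have 4: "\<bar>df\<bar> \<le> L * norm h" using L(2) fg(2) by (simp add: df_def)
      have "f (x + h) * g (x + h) - f x * g x - (f x * dg + df * g x)
          = (f (x + h) - f x - df) * g (x + h) + f x * (g (x + h) - g x - dg) + df * (g (x + h) - g x)"
        by (simp add: algebra_simps)
      from abs_sum_products_le[OF this]
      have "\<bar>f (x + h) * g (x + h) - f x * g x - (f x * dg + df * g x)\<bar>
          \<le> \<bar>f (x + h) - f x - df\<bar> * \<bar>g (x + h)\<bar> + \<bar>f x\<bar> * \<bar>g (x + h) - g x - dg\<bar> + \<bar>df\<bar> * \<bar>g (x + h) - g x\<bar>" .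
      also have "\<bar>f (x + h) - f x - df\<bar> * \<bar>g (x + h)\<bar> \<le> (e1 * norm h) * (B + 1)"
        using 1 2 3 e1 by (intro mult_mono) auto
      also have "\<bar>f x\<bar> * \<bar>g (x + h) - g x - dg\<bar> \<le> A * (e1 * norm h)" using 1 3 AB by (intro mult_mono) auto
      also have "\<bar>df\<bar> * \<bar>g (x + h) - g x\<bar> \<le> (L * norm h) * e1" using 2 4 L by (intro mult_mono) auto
      finally have "\<bar>f (x + h) * g (x + h) - f x * g x - (f x * dg + df * g x)\<bar> \<le> ((A + B + L + 1) * e1) * norm h"
        by (simp add: algebra_simps)
      also have "\<dots> \<le> e * norm h" using e1(3) AB L by (intro mult_right_mono) (simp_all add: field_simps)
      finally show "\<bar>k (x + h) - k x - frechet_derivative k (at x) h\<bar> \<le> e * norm h"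
        unfolding fg(1) fd[OF fg(2,3) x] df_def dg_def .
    qed
    then show "\<exists>d>0. \<forall>k\<in>?K. \<forall>h. norm h < d \<longrightarrow> \<bar>k (x + h) - k x - frechet_derivative k (at x) h\<bar> \<le> e * norm h"
      using d1(1) d2(1) d3(1) by (intro exI[of _ "min (min d1 d2) d3"]) auto
  next
    fix k and h :: 'b assume k: "k \<in> ?K" and h: "norm h \<le> 1"
    obtain f g where fg: "k = (\<lambda>x. f x * g x)" "f \<in> S" "g \<in> T" using k by (rule product_familyE)
    show "\<exists>g\<in>sum_family (product_family S (derivatives T)) (product_family (derivatives S) T).
        \<forall>x\<in>U. frechet_derivative k (at x) h = g x"
      by (rule bexI[OF _ sum_familyI[OF product_familyI[OF fg(2) derivativesI[OF fg(3) h]]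
            product_familyI[OF derivativesI[OF fg(2) h] fg(3)]]])
         (simp add: fg(1) fd[OF fg(2,3)])
  qed
qed

text \<open>
  The derivative of \<open>f \<circ> L\<close> in direction \<open>h\<close> is that of \<open>f\<close> in direction \<open>L h\<close>.  If \<open>M\<close> bounds the norm
  of \<open>L\<close>, the vector \<open>L h / M\<close> is again in the unit ball.
\<close>

lemma equi_C_bounded_linear:
  fixes L :: "'b::real_normed_vector \<Rightarrow> 'c::real_normed_vector"
  assumes L: "bounded_linear L" and U: "open U" "\<And>x. x \<in> U \<Longrightarrow> L x \<in> V"
  shows "equi_C n V S \<Longrightarrow> equi_C n U {\<lambda>x. f (L x) |f. f \<in> S}"
proof -
  interpret L: bounded_linear L by fact
  obtain M where M: "M > 0" "\<And>x. norm (L x) \<le> norm x * M" using L.pos_bounded by blast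
  show "equi_C n V S \<Longrightarrow> equi_C n U {\<lambda>x. f (L x) |f. f \<in> S}"
  proof (induction n arbitrary: S)
    case 0
    show ?case unfolding equi_C.simps(1) equi_cont_def
    proof (intro ballI conjI allI impI)
      fix x assume x: "x \<in> U"
      obtain A where "\<forall>f\<in>S. \<bar>f (L x)\<bar> \<le> A" using 0 equi_C_bounded[OF _ U(2)[OF x]] by metis
      then show "\<exists>B. \<forall>k\<in>{\<lambda>x. f (L x) |f. f \<in> S}. \<bar>k x\<bar> \<le> B" by blast
      fix e :: real assume e: "e > 0"
      obtain d where d: "d > 0" "\<forall>f\<in>S. \<forall>y. norm (y - L x) < d \<longrightarrow> \<bar>f y - f (L x)\<bar> < e"
        using 0 U(2)[OF x] e unfolding equi_C.simps(1) equi_cont_def by metis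
      have "\<forall>k\<in>{\<lambda>x. f (L x) |f. f \<in> S}. \<forall>y. norm (y - x) < d / M \<longrightarrow> \<bar>k y - k x\<bar> < e"
      proof (intro ballI allI impI)
        fix k y assume k: "k \<in> {\<lambda>x. f (L x) |f. f \<in> S}" and y: "norm (y - x) < d / M"
        have "norm (L y - L x) < d"
          using M(2)[of "y - x"] y M(1) by (simp add: L.diff pos_less_divide_eq)
        then show "\<bar>k y - k x\<bar> < e" using k d(2) by blast
      qed
      then show "\<exists>d>0. \<forall>k\<in>{\<lambda>x. f (L x) |f. f \<in> S}. \<forall>y. norm (y - x) < d \<longrightarrow> \<bar>k y - k x\<bar> < e"
        using d(1) M(1) by (intro exI[of _ "d / M"]) auto
    qed
  next
    case (Suc n)
    let ?K = "{\<lambda>x. f (L x) |f. f \<in> S}"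
    note S = equi_C_SucD[OF Suc.prems]
    have der: "((\<lambda>x. f (L x)) has_derivative (\<lambda>h. frechet_derivative f (at (L x)) (L h))) (at x)"
      if "f \<in> S" "x \<in> U" for f x
      using has_derivative_compose[OF L.has_derivative[OF has_derivative_ident] S(1)[OF that(1) U(2)[OF that(2)]]] .
    have fd: "frechet_derivative (\<lambda>x. f (L x)) (at x) = (\<lambda>h. frechet_derivative f (at (L x)) (L h))"
      if "f \<in> S" "x \<in> U" for f x
      using frechet_derivative_at[OF der[OF that]] by simp
    note P = equi_C_mult[OF U(1) equi_C_const[OF U(1), of n M] Suc.IH[OF S(4)]]
    show ?case
    proof (rule equi_C_SucI[OF U(1), where D = "\<lambda>k x. frechet_derivative k (at x)", OF _ _ _ P])
      show "linear (frechet_derivative k (at x))" if "k \<in> ?K" "x \<in> U" for k x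
        using that(1) has_derivative_linear[OF der[OF _ that(2)]] fd[OF _ that(2)] by auto
      fix x assume x: "x \<in> U"
      obtain A where "\<forall>f\<in>S. \<bar>f (L x)\<bar> \<le> A" using Suc.prems equi_C_bounded[OF _ U(2)[OF x]] by metis
      then show "\<exists>B. \<forall>k\<in>?K. \<bar>k x\<bar> \<le> B" by blast
      fix e :: real assume e: "e > 0"
      then have e': "e / M > 0" using M by simp
      obtain d where d: "d > 0" "\<forall>f\<in>S. \<forall>h. norm h < d \<longrightarrow>
          \<bar>f (L x + h) - f (L x) - frechet_derivative f (at (L x)) h\<bar> \<le> e / M * norm h" using S(3)[OF U(2)[OF x] e'] by blast
      have "\<forall>k\<in>?K. \<forall>h. norm h < d / M \<longrightarrow> \<bar>k (x + h) - k x - frechet_derivative k (at x) h\<bar> \<le> e * norm h"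
      proof (intro ballI allI impI)
        fix k and h :: 'b assume k: "k \<in> ?K" and y: "norm h < d / M"
        obtain f where f: "k = (\<lambda>x. f (L x))" "f \<in> S" using k by blast
        have "norm (L h) < d" using M(2)[of h] y M(1) by (simp add: pos_less_divide_eq)
        then have "\<bar>f (L x + L h) - f (L x) - frechet_derivative f (at (L x)) (L h)\<bar> \<le> e / M * norm (L h)"
          using d f(2) by blast
        also have "\<dots> \<le> e / M * (norm h * M)" using M(2) e' by (intro mult_left_mono) auto
        also have "\<dots> = e * norm h" using M(1) by simp
        finally show "\<bar>k (x + h) - k x - frechet_derivative k (at x) h\<bar> \<le> e * norm h"
          unfolding f(1) fd[OF f(2) x] L.add .
      qed
      then show "\<exists>d>0. \<forall>k\<in>?K. \<forall>h. norm h < d \<longrightarrow> \<bar>k (x + h) - k x - frechet_derivative k (at x) h\<bar> \<le> e * norm h"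
        using d(1) M(1) by (intro exI[of _ "d / M"]) auto
    next
      fix k and h :: 'b assume k: "k \<in> ?K" and h: "norm h \<le> 1"
      obtain f where f: "k = (\<lambda>x. f (L x))" "f \<in> S" using k by blast
      define w where "w = L h /\<^sub>R M"
      have "norm (L h) \<le> M"
        using order_trans[OF M(2)[of h] mult_right_mono[OF h, of M]] M(1) by simp
      then have w: "norm w \<le> 1" using M(1) unfolding w_def by (simp add: field_simps)
      define a where "a = (\<lambda>y. frechet_derivative f (at y) w)"
      have a: "a \<in> derivatives S" unfolding a_def by (rule derivativesI[OF f(2) w])
      have "\<forall>x\<in>U. frechet_derivative k (at x) h = (\<lambda>x. M * a (L x)) x"
      proof
        fix x assume x: "x \<in> U"
        have "frechet_derivative k (at x) h = frechet_derivative f (at (L x)) (M *\<^sub>R w)"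
          unfolding f(1) fd[OF f(2) x] w_def using M(1) by simp
        then show "frechet_derivative k (at x) h = (\<lambda>x. M * a (L x)) x"
          using linear_scale[OF S(2)[OF f(2) U(2)[OF x]], of M w] unfolding a_def by simp
      qed
      moreover have "(\<lambda>x. M * a (L x)) \<in> product_family {\<lambda>x. c |c. \<bar>c\<bar> \<le> M} {\<lambda>x. f (L x) |f. f \<in> derivatives S}"
        by (rule product_familyI) (use a M(1) in auto)
      ultimately show "\<exists>g\<in>product_family {\<lambda>x. c |c. \<bar>c\<bar> \<le> M} {\<lambda>x. f (L x) |f. f \<in> derivatives S}.
          \<forall>x\<in>U. frechet_derivative k (at x) h = g x"
        by (intro bexI[of _ "\<lambda>x. M * a (L x)"])
    qed
  qed
qed

text \<open>
  Composition with \<open>x \<mapsto> (x, m x)\<close> suffices as a chain rule.  With \<open>f\<close> depending on the last argument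
  only it gives composition with a real function, and it is what differentiating an implicitly
  defined function requires.  The derivative splits into the partial derivative in the direction
  \<open>(h, 0)\<close> and the product of \<open>Dm h\<close> with the partial derivative in the direction \<open>(0, 1)\<close>; both
  directions have norm at most 1.
\<close>

lemma equi_C_graph:
  fixes U :: "'b::real_normed_vector set" and m :: "'b \<Rightarrow> real"
  assumes U: "open U" and mem: "\<And>x. x \<in> U \<Longrightarrow> (x, m x) \<in> W"
  shows "equi_C n W S \<Longrightarrow> equi_C n U {m} \<Longrightarrow> equi_C n U {\<lambda>x. f (x, m x) |f. f \<in> S}"
proof (induction n arbitrary: S)
  case 0
  show ?case unfolding equi_C.simps(1) equi_cont_def
  proof (intro ballI conjI allI impI)
    fix x assume x: "x \<in> U"
    obtain A where "\<forall>f\<in>S. \<bar>f (x, m x)\<bar> \<le> A" using equi_C_bounded[OF 0(1) mem[OF x]] by blast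
    then show "\<exists>B. \<forall>k\<in>{\<lambda>x. f (x, m x) |f. f \<in> S}. \<bar>k x\<bar> \<le> B" by blast
    fix e :: real assume e: "e > 0"
    obtain d where d: "d > 0" "\<forall>f\<in>S. \<forall>y. norm (y - (x, m x)) < d \<longrightarrow> \<bar>f y - f (x, m x)\<bar> < e"
      using 0(1)[unfolded equi_C.simps(1) equi_cont_def, rule_format, OF mem[OF x]] e by meson
    have "d / 2 > 0" using d by simp
    then obtain d' where d': "d' > 0" "\<forall>y. norm (y - x) < d' \<longrightarrow> \<bar>m y - m x\<bar> < d / 2"
      using 0(2) x unfolding equi_C.simps(1) equi_cont_def by blast
    have "\<forall>k\<in>{\<lambda>x. f (x, m x) |f. f \<in> S}. \<forall>y. norm (y - x) < min (d / 2) d' \<longrightarrow> \<bar>k y - k x\<bar> < e"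
    proof (intro ballI allI impI)
      fix k y assume k: "k \<in> {\<lambda>x. f (x, m x) |f. f \<in> S}" and y: "norm (y - x) < min (d / 2) d'"
      have "norm ((y, m y) - (x, m x)) \<le> norm (y - x) + \<bar>m y - m x\<bar>"
        using norm_Pair_le[of "y - x" "m y - m x"] by simp
      also have "\<dots> < d / 2 + d / 2" using y d'(2) by (intro add_strict_mono) simp_all
      finally have "norm ((y, m y) - (x, m x)) < d" by simp
      then show "\<bar>k y - k x\<bar> < e" using k d(2) by blast
    qed
    then show "\<exists>d>0. \<forall>k\<in>{\<lambda>x. f (x, m x) |f. f \<in> S}. \<forall>y. norm (y - x) < d \<longrightarrow> \<bar>k y - k x\<bar> < e"
      using d(1) d'(1) by (intro exI[of _ "min (d / 2) d'"]) auto
  qed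
next
  case (Suc n)
  let ?K = "{\<lambda>x. f (x, m x) |f. f \<in> S}"
  note S = equi_C_SucD[OF Suc.prems(1)]
  note M = equi_C_SucD[OF Suc.prems(2)]
  define dm where "dm = (\<lambda>x. frechet_derivative m (at x))"
  have derm: "(m has_derivative dm x) (at x)" if "x \<in> U" for x using M(1)[of m x] that by (simp add: dm_def)
  have der: "((\<lambda>x. f (x, m x)) has_derivative (\<lambda>h. frechet_derivative f (at (x, m x)) (h, dm x h))) (at x)"
    if "f \<in> S" "x \<in> U" for f x
    using has_derivative_compose[OF has_derivative_Pair[OF has_derivative_ident derm[OF that(2)]] S(1)[OF that(1) mem[OF that(2)]]] .
  have fd: "frechet_derivative (\<lambda>x. f (x, m x)) (at x) = (\<lambda>h. frechet_derivative f (at (x, m x)) (h, dm x h))"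
    if "f \<in> S" "x \<in> U" for f x
    using frechet_derivative_at[OF der[OF that]] by simp
  note G = Suc.IH[OF S(4) equi_C_Suc_imp[OF Suc.prems(2)]]
  note P = equi_C_add[OF U G equi_C_mult[OF U M(4) G]]
  show ?case
  proof (rule equi_C_SucI[OF U, where D = "\<lambda>k x. frechet_derivative k (at x)", OF _ _ _ P])
    show "linear (frechet_derivative k (at x))" if "k \<in> ?K" "x \<in> U" for k x
      using that(1) has_derivative_linear[OF der[OF _ that(2)]] fd[OF _ that(2)] by auto
    fix x assume x: "x \<in> U"
    obtain A where "\<forall>f\<in>S. \<bar>f (x, m x)\<bar> \<le> A" using equi_C_bounded[OF Suc.prems(1) mem[OF x]] by blast
    then show "\<exists>B. \<forall>k\<in>?K. \<bar>k x\<bar> \<le> B" by blast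
    fix e :: real assume e: "e > 0"
    obtain K where K: "K > 0" "\<forall>f\<in>S. \<forall>h. \<bar>frechet_derivative f (at (x, m x)) h\<bar> \<le> K * norm h"
      using S(5)[OF mem[OF x]] by blast
    obtain L where L: "L > 0" "\<forall>h. \<bar>dm x h\<bar> \<le> L * norm h" using M(5)[OF x] by (auto simp: dm_def)
    \<comment> \<open>Half of \<open>e\<close> pays for linearising \<open>f\<close>, the other half for linearising \<open>m\<close>.\<close>
    define e1 where "e1 = min 1 (e / (2 * K))"
    have e1: "e1 > 0" "e1 \<le> 1" "K * e1 \<le> e / 2" using e K by (auto simp: e1_def min_def field_simps)
    define e2 where "e2 = e / (2 * (L + 2))"
    have e2: "e2 > 0" "e2 * (L + 2) = e / 2" using e L by (auto simp: e2_def field_simps)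
    obtain d1 where d1: "d1 > 0" "\<forall>h. norm h < d1 \<longrightarrow> \<bar>m (x + h) - m x - dm x h\<bar> \<le> e1 * norm h"
      using M(3)[OF x e1(1)] by (auto simp: dm_def)
    obtain d2 where d2: "d2 > 0" "\<forall>f\<in>S. \<forall>h. norm h < d2 \<longrightarrow>
        \<bar>f ((x, m x) + h) - f (x, m x) - frechet_derivative f (at (x, m x)) h\<bar> \<le> e2 * norm h"
      using S(3)[OF mem[OF x] e2(1)] by blast
    have "\<forall>k\<in>?K. \<forall>h. norm h < min d1 (d2 / (L + 2)) \<longrightarrow> \<bar>k (x + h) - k x - frechet_derivative k (at x) h\<bar> \<le> e * norm h"
    proof (intro ballI allI impI)
      fix k and h :: 'b assume k: "k \<in> ?K" and y: "norm h < min d1 (d2 / (L + 2))"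
      obtain f where f: "k = (\<lambda>x. f (x, m x))" "f \<in> S" using k by blast
      define t where "t = m (x + h) - m x"
      have 1: "\<bar>t - dm x h\<bar> \<le> e1 * norm h" using d1(2) y by (simp add: t_def)
      have 2: "e1 * norm h \<le> norm h" using e1(2) mult_right_mono[of e1 1 "norm h"] by simp
      have 3: "\<bar>dm x h\<bar> \<le> L * norm h" using L by blast
      have "norm (h, t) \<le> norm h + \<bar>t\<bar>" using norm_Pair_le[of h t] by simp
      also have "\<dots> \<le> (L + 2) * norm h" using 1 2 3 by (simp add: algebra_simps)
      finally have 4: "norm (h, t) \<le> (L + 2) * norm h" .
      also have "\<dots> < d2" using y L(1) by (simp add: field_simps)
      finally have "\<bar>f ((x, m x) + (h, t)) - f (x, m x) - frechet_derivative f (at (x, m x)) (h, t)\<bar> \<le> e2 * norm (h, t)"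
        using d2(2) f(2) by blast
      also have "\<dots> \<le> e2 * ((L + 2) * norm h)" using 4 e2(1) by (intro mult_left_mono) auto
      also have "\<dots> = e / 2 * norm h" by (simp only: mult.assoc[symmetric] e2(2))
      finally have 5: "\<bar>f (x + h, m (x + h)) - f (x, m x) - frechet_derivative f (at (x, m x)) (h, t)\<bar> \<le> e / 2 * norm h"
        by (simp add: t_def)
      have "frechet_derivative f (at (x, m x)) (h, t) - frechet_derivative f (at (x, m x)) (h, dm x h)
          = frechet_derivative f (at (x, m x)) (0, t - dm x h)"
        using linear_diff[OF S(2)[OF f(2) mem[OF x]], of "(h, t)" "(h, dm x h)"] by simp
      also have "\<bar>\<dots>\<bar> \<le> K * norm (0 :: 'b, t - dm x h)" using K f(2) by blast
      also have "\<dots> \<le> K * (e1 * norm h)" using 1 K(1) by (intro mult_left_mono) (auto simp: norm_Pair)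
      also have "\<dots> \<le> e / 2 * norm h" using mult_right_mono[OF e1(3), of "norm h"] by (simp add: mult.assoc)
      finally have "\<bar>f (x + h, m (x + h)) - f (x, m x) - frechet_derivative f (at (x, m x)) (h, dm x h)\<bar> \<le> e * norm h"
        using 5 by linarith
      then show "\<bar>k (x + h) - k x - frechet_derivative k (at x) h\<bar> \<le> e * norm h"
        unfolding f(1) fd[OF f(2) x] .
    qed
    then show "\<exists>d>0. \<forall>k\<in>?K. \<forall>h. norm h < d \<longrightarrow> \<bar>k (x + h) - k x - frechet_derivative k (at x) h\<bar> \<le> e * norm h"
      using d1(1) d2(1) L(1) by (intro exI[of _ "min d1 (d2 / (L + 2))"]) auto
  next
    fix k and h :: 'b assume k: "k \<in> ?K" and h: "norm h \<le> 1"
    obtain f where f: "k = (\<lambda>x. f (x, m x))" "f \<in> S" using k by blast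
    define a b where "a = (\<lambda>p. frechet_derivative f (at p) (h, 0))" and "b = (\<lambda>p. frechet_derivative f (at p) (0 :: 'b, 1 :: real))"
    have ab: "a \<in> derivatives S" "b \<in> derivatives S"
      unfolding a_def b_def using f(2) h by (auto intro!: derivativesI simp: norm_Pair)
    have dm': "(\<lambda>x. dm x h) \<in> derivatives {m}" unfolding dm_def by (rule derivativesI) (use h in auto)
    have "\<forall>x\<in>U. frechet_derivative k (at x) h = a (x, m x) + dm x h * b (x, m x)"
    proof
      fix x assume x: "x \<in> U"
      note lin = S(2)[OF f(2) mem[OF x]]
      have "(h, dm x h) = (h, 0) + dm x h *\<^sub>R (0, 1)" by simp
      then show "frechet_derivative k (at x) h = a (x, m x) + dm x h * b (x, m x)"
        unfolding f(1) fd[OF f(2) x] a_def b_def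
        using linear_add[OF lin, of "(h, 0)" "dm x h *\<^sub>R (0, 1)"] linear_scale[OF lin, of "dm x h" "(0, 1)"] by simp
    qed
    moreover have "(\<lambda>x. a (x, m x) + dm x h * b (x, m x)) \<in>
        sum_family {\<lambda>x. f (x, m x) |f. f \<in> derivatives S} (product_family (derivatives {m}) {\<lambda>x. f (x, m x) |f. f \<in> derivatives S})"
      by (intro sum_familyI product_familyI) (use ab dm' in auto)
    ultimately show "\<exists>g\<in>sum_family {\<lambda>x. f (x, m x) |f. f \<in> derivatives S} (product_family (derivatives {m}) {\<lambda>x. f (x, m x) |f. f \<in> derivatives S}).
       \<forall>x\<in>U. frechet_derivative k (at x) h = g x"
      by (intro bexI[of _ "\<lambda>x. a (x, m x) + dm x h * b (x, m x)"])
  qed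
qed

lemma equi_C_single_const: "open U \<Longrightarrow> equi_C n U {\<lambda>x::'b::real_normed_vector. c}"
  by (rule equi_C_mono[OF equi_C_const[of U n "\<bar>c\<bar>"]]) auto

lemma equi_C_single_add:
  assumes "open U" "equi_C n U {f}" "equi_C n U {g}"
  shows "equi_C n U {\<lambda>x. f x + g x}"
  by (rule equi_C_mono[OF equi_C_add[OF assms] assms(1)]) (auto simp: sum_family_def)

lemma equi_C_single_mult:
  assumes "open U" "equi_C n U {f}" "equi_C n U {g}"
  shows "equi_C n U {\<lambda>x. f x * g x}"
  by (rule equi_C_mono[OF equi_C_mult[OF assms] assms(1)]) (auto simp: product_family_def)

lemma equi_C_single_sum:
  assumes "open U" "\<And>i. i \<in> I \<Longrightarrow> equi_C n U {f i}"
  shows "equi_C n U {\<lambda>x. \<Sum>i\<in>I. f i x}"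
  using assms(2)
  by (induction I rule: infinite_finite_induct)
     (auto intro!: equi_C_single_const equi_C_single_add simp: assms(1))

lemma equi_C_single_linear:
  fixes L :: "'b::real_normed_vector \<Rightarrow> 'c::real_normed_vector"
  assumes "bounded_linear L" "open U" "\<And>x. x \<in> U \<Longrightarrow> L x \<in> V" "equi_C n V {f}"
  shows "equi_C n U {\<lambda>x. f (L x)}"
  by (rule equi_C_mono[OF equi_C_bounded_linear[OF assms] assms(2)]) auto

lemma equi_C_single_compose:
  fixes \<psi> :: "real \<Rightarrow> real" and f :: "'b::real_normed_vector \<Rightarrow> real"
  assumes V: "open V" and U: "open U" and \<psi>: "equi_C n V {\<psi>}" and f: "equi_C n U {f}"
    and mem: "\<And>x. x \<in> U \<Longrightarrow> f x \<in> V"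
  shows "equi_C n U {\<lambda>x. \<psi> (f x)}"
proof -
  have "equi_C n (UNIV \<times> V) {\<lambda>p::'b \<times> real. \<psi> (snd p)}"
    by (rule equi_C_single_linear[OF bounded_linear_snd _ _ \<psi>]) (auto intro!: open_Times V)
  from equi_C_graph[OF U _ this f] mem
  have "equi_C n U {\<lambda>x. k (x, f x) |k. k \<in> {\<lambda>p. \<psi> (snd p)}}" by auto
  then show ?thesis by (rule equi_C_mono[OF _ U]) auto
qed

lemma equi_C_realI:
  assumes V: "open V" and der: "\<And>t. t \<in> V \<Longrightarrow> (\<psi> has_real_derivative \<psi>' t) (at t)"
    and C: "equi_C n V {\<psi>'}"
  shows "equi_C (Suc n) V {\<psi>}"
proof (rule equi_C_singleI[OF V, where D = "\<lambda>t h. \<psi>' t * h"])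
  show "(\<psi> has_derivative (\<lambda>h. \<psi>' t * h)) (at t)" if "t \<in> V" for t
    using der[OF that] by (simp add: has_field_derivative_def)
  show "equi_C n V (product_family {\<psi>'} {\<lambda>x. c |c. \<bar>c\<bar> \<le> 1})"
    by (rule equi_C_mult[OF V C equi_C_const[OF V]])
  fix h :: real assume "norm h \<le> 1"
  then have "(\<lambda>t. \<psi>' t * h) \<in> product_family {\<psi>'} {\<lambda>x. c |c. \<bar>c\<bar> \<le> 1}"
    by (intro product_familyI) auto
  then show "\<exists>g\<in>product_family {\<psi>'} {\<lambda>x. c |c. \<bar>c\<bar> \<le> 1}. \<forall>t\<in>V. \<psi>' t * h = g t"
    by (intro bexI[of _ "\<lambda>t. \<psi>' t * h"]) auto
qed

lemma equi_C_cont_realI: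
  assumes "open V" "continuous_on V \<psi>"
  shows "equi_C 0 V {\<psi> :: real \<Rightarrow> real}"
proof -
  have "\<exists>d>0. \<forall>y. norm (y - x) < d \<longrightarrow> \<bar>\<psi> y - \<psi> x\<bar> < e" if "x \<in> V" "e > 0" for x e
  proof -
    have "isCont \<psi> x" using assms that(1) by (simp add: continuous_on_eq_continuous_at)
    then show ?thesis using that(2) by (auto simp: continuous_at_eps_delta dist_norm)
  qed
  then show ?thesis by (auto simp: equi_cont_def)
qed

lemma equi_C_inverse: "equi_C n (- {0}) {inverse :: real \<Rightarrow> real}"
proof (induction n)
  case 0
  show ?case by (rule equi_C_cont_realI) (auto intro!: continuous_intros)
next
  case (Suc n)
  show ?case
  proof (rule equi_C_realI)
    show "equi_C n (- {0}) {\<lambda>t::real. (- 1) * (inverse t * inverse t)}"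
      by (intro equi_C_single_mult equi_C_single_const Suc) auto
    show "(inverse has_real_derivative (- 1) * (inverse t * inverse t)) (at t)" if "t \<in> - {0}" for t
      using that by (auto intro!: derivative_eq_intros simp: power2_eq_square)
  qed auto
qed

lemma equi_C_sqrt: "equi_C n {0<..} {sqrt}"
proof (induction n)
  case 0
  show ?case by (rule equi_C_cont_realI) (auto intro!: continuous_intros)
next
  case (Suc n)
  show ?case
  proof (rule equi_C_realI)
    show "equi_C n {0<..} {\<lambda>t::real. inverse (2 * sqrt t)}"
      by (rule equi_C_single_compose[OF _ _ equi_C_inverse])
         (auto intro!: equi_C_single_mult equi_C_single_const Suc)
    show "(sqrt has_real_derivative inverse (2 * sqrt t)) (at t)" if "t \<in> {0<..}" for t
      using that by (auto intro!: derivative_eq_intros simp: field_simps)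
  qed auto
qed

text \<open>
  Differentiating \<open>H (x, m x) = c\<close> gives \<open>Dm h = - DH (h, 0) / DH (0, 1)\<close>, where \<open>DH\<close> is taken at
  \<open>(x, m x)\<close>.  The right-hand side is as often differentiable as \<open>m\<close> itself, up to the order of
  \<open>DH\<close>, so the order of \<open>m\<close> increases step by step.  The local Lipschitz condition replaces the
  existence part of the implicit function theorem: the function \<open>m\<close> is given.
\<close>

lemma equi_C_implicit:
  fixes U :: "'b::real_normed_vector set" and m :: "'b \<Rightarrow> real"
  assumes U: "open U" and mem: "\<And>x. x \<in> U \<Longrightarrow> (x, m x) \<in> W"
    and H: "equi_C (Suc n) W {H}"
    and eq: "\<And>x. x \<in> U \<Longrightarrow> H (x, m x) = c"
    and lip: "\<And>x. x \<in> U \<Longrightarrow> \<exists>K d. d > 0 \<and> (\<forall>y. norm (y - x) < d \<longrightarrow> \<bar>m y - m x\<bar> \<le> K * norm (y - x))"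
    and nz: "\<And>x. x \<in> U \<Longrightarrow> frechet_derivative H (at (x, m x)) (0, 1) \<noteq> 0"
  shows "equi_C (Suc n) U {m}"
proof -
  define DH where "DH = (\<lambda>x. frechet_derivative H (at (x, m x)))"
  define dm where "dm = (\<lambda>x h. - DH x (h, 0) * inverse (DH x (0, 1)))"
  note HD = equi_C_SucD[OF H]
  have lin: "linear (DH x)" if "x \<in> U" for x unfolding DH_def using HD(2)[of H] mem[OF that] by blast
  have nz': "DH x (0, 1) \<noteq> 0" if "x \<in> U" for x using nz[OF that] by (simp add: DH_def)
  have split: "DH x (h, t) = DH x (h, 0) + t * DH x (0, 1)" if "x \<in> U" for x h t
  proof -
    have "(h, t) = (h, 0) + t *\<^sub>R (0, 1)" by simp
    then show ?thesis
      using linear_add[OF lin[OF that], of "(h, 0)" "t *\<^sub>R (0, 1)"] linear_scale[OF lin[OF that], of t "(0, 1)"] by simp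
  qed
  have lindm: "linear (dm x)" if "x \<in> U" for x
  proof (rule linearI)
    show "dm x (h + k) = dm x h + dm x k" for h k
      using linear_add[OF lin[OF that], of "(h, 0)" "(k, 0)"] by (simp add: dm_def algebra_simps)
    show "dm x (r *\<^sub>R h) = r *\<^sub>R dm x h" for r h
      using linear_scale[OF lin[OF that], of r "(h, 0)"] by (simp add: dm_def algebra_simps)
  qed
  have fre: "\<exists>d>0. \<forall>f\<in>{m}. \<forall>h. norm h < d \<longrightarrow> \<bar>f (x + h) - f x - dm x h\<bar> \<le> e * norm h"
    if x: "x \<in> U" and e: "e > 0" for x and e :: real
  proof -
    obtain K0 d0 where K0: "d0 > 0" "\<forall>y. norm (y - x) < d0 \<longrightarrow> \<bar>m y - m x\<bar> \<le> K0 * norm (y - x)" using lip[OF x] by blast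
    define K where "K = max K0 1"
    define a where "a = DH x (0, 1)"
    have a: "a \<noteq> 0" using nz'[OF x] by (simp add: a_def)
    have K: "K \<ge> 1" "\<forall>y. norm (y - x) < d0 \<longrightarrow> \<bar>m y - m x\<bar> \<le> K * norm (y - x)"
    proof -
      show "K \<ge> 1" by (simp add: K_def)
      show "\<forall>y. norm (y - x) < d0 \<longrightarrow> \<bar>m y - m x\<bar> \<le> K * norm (y - x)"
      proof (intro allI impI)
        fix y assume "norm (y - x) < d0"
        then have "\<bar>m y - m x\<bar> \<le> K0 * norm (y - x)" using K0(2) by blast
        also have "\<dots> \<le> K * norm (y - x)" by (intro mult_right_mono) (auto simp: K_def)
        finally show "\<bar>m y - m x\<bar> \<le> K * norm (y - x)" .
      qed
    qed
    define e1 where "e1 = e * \<bar>a\<bar> / (1 + K)"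
    have e1: "e1 > 0" "e1 * (1 + K) = e * \<bar>a\<bar>" using e a K(1) by (auto simp: e1_def)
    obtain d1 where d1: "d1 > 0" "\<forall>h. norm h < d1 \<longrightarrow> \<bar>H ((x, m x) + h) - H (x, m x) - DH x h\<bar> \<le> e1 * norm h"
      using HD(3)[OF mem[OF x] e1(1)] by (auto simp: DH_def)
    obtain d2 where d2: "d2 > 0" "ball x d2 \<subseteq> U" using U x open_contains_ball by blast
    have "\<bar>m (x + h) - m x - dm x h\<bar> \<le> e * norm h" if h: "norm h < min (min d0 d2) (d1 / (1 + K))" for h
    proof -
      define t where "t = m (x + h) - m x"
      have xh: "x + h \<in> U" using d2(2) h by (auto simp: dist_norm)
      have "\<bar>t\<bar> \<le> K * norm h" using K(2)[rule_format, of "x + h"] h by (simp add: t_def)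
      then have n: "norm (h, t) \<le> (1 + K) * norm h" using norm_Pair_le[of h t] by (simp add: algebra_simps)
      also have "\<dots> < d1" using h K(1) by (simp add: field_simps)
      finally have "\<bar>H ((x, m x) + (h, t)) - H (x, m x) - DH x (h, t)\<bar> \<le> e1 * norm (h, t)" using d1(2) by blast
      also have "\<dots> \<le> e1 * ((1 + K) * norm h)" using n e1(1) by (intro mult_left_mono) auto
      also have "\<dots> = \<bar>a\<bar> * (e * norm h)" by (simp only: mult.assoc[symmetric] e1(2)) simp
      also have "H ((x, m x) + (h, t)) = H (x, m x)" using eq[OF xh] eq[OF x] by (simp add: t_def)
      finally have "\<bar>DH x (h, 0) + t * a\<bar> \<le> \<bar>a\<bar> * (e * norm h)" unfolding split[OF x, of h t] a_def by simp
      moreover have "DH x (h, 0) + t * a = a * (t - dm x h)"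
        using a unfolding dm_def a_def by (simp add: field_simps)
      ultimately have "\<bar>a\<bar> * \<bar>t - dm x h\<bar> \<le> \<bar>a\<bar> * (e * norm h)" by (simp add: abs_mult)
      then show ?thesis using a by (simp add: t_def)
    qed
    then show ?thesis using K0(1) d2(1) d1(1) K(1)
      by (intro exI[of _ "min (min d0 d2) (d1 / (1 + K))"]) auto
  qed
  have step: "equi_C (Suc j) U {m}" if m: "equi_C j U {m}" and j: "j \<le> n" for j
  proof -
    have dH: "equi_C j W (derivatives {H})" using equi_C_le[OF j HD(4)] .
    note G = equi_C_graph[OF U mem dH m]
    have den: "equi_C j U {\<lambda>x. DH x (0, 1)}"
    proof (rule equi_C_mono[OF G U])
      have "(\<lambda>p. frechet_derivative H (at p) (0, 1)) \<in> derivatives {H}" by (rule derivativesI) (auto simp: norm_Pair)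
      then show "\<exists>g\<in>{\<lambda>x. f (x, m x) |f. f \<in> derivatives {H}}. \<forall>y\<in>U. f y = g y" if "f \<in> {\<lambda>x. DH x (0, 1)}" for f
        using that by (intro bexI[of _ f]) (auto simp: DH_def)
    qed
    have inv: "equi_C j U {\<lambda>x. - 1 * inverse (DH x (0, 1))}"
      by (intro equi_C_single_mult equi_C_single_const equi_C_single_compose[OF _ _ equi_C_inverse] U den)
         (use nz' in auto)
    note P = equi_C_mult[OF U G inv]
    show ?thesis
    proof (rule equi_C_SucI[OF U, where D = "\<lambda>_. dm", OF _ _ _ P])
      show "\<exists>B. \<forall>f\<in>{m}. \<bar>f x\<bar> \<le> B" for x by auto
      show "linear (dm x)" if "x \<in> U" for x by (rule lindm[OF that])
      show "\<exists>d>0. \<forall>f\<in>{m}. \<forall>h. norm h < d \<longrightarrow> \<bar>f (x + h) - f x - dm x h\<bar> \<le> e * norm h"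
        if "x \<in> U" "e > 0" for x e by (rule fre[OF that])
      fix h :: 'b assume h: "norm h \<le> 1"
      have "(\<lambda>p. frechet_derivative H (at p) (h, 0)) \<in> derivatives {H}"
        by (rule derivativesI) (use h in \<open>auto simp: norm_Pair\<close>)
      then have "(\<lambda>x. DH x (h, 0) * (- 1 * inverse (DH x (0, 1)))) \<in>
         product_family {\<lambda>x. f (x, m x) |f. f \<in> derivatives {H}} {\<lambda>x. - 1 * inverse (DH x (0, 1))}"
        by (intro product_familyI) (auto simp: DH_def)
      then show "\<exists>g\<in>product_family {\<lambda>x. f (x, m x) |f. f \<in> derivatives {H}} {\<lambda>x. - 1 * inverse (DH x (0, 1))}.
          \<forall>x\<in>U. dm x h = g x"
        by (rule bexI[rotated]) (simp add: dm_def)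
    qed
  qed
  have zero: "equi_C 0 U {m}" unfolding equi_C.simps equi_cont_def
  proof (intro ballI conjI allI impI)
    fix x assume x: "x \<in> U"
    show "\<exists>B. \<forall>f\<in>{m}. \<bar>f x\<bar> \<le> B" by auto
    fix e :: real assume e: "e > 0"
    obtain K d where K: "d > 0" "\<forall>y. norm (y - x) < d \<longrightarrow> \<bar>m y - m x\<bar> \<le> K * norm (y - x)" using lip[OF x] by blast
    have "\<bar>m y - m x\<bar> < e" if y: "norm (y - x) < min d (e / (\<bar>K\<bar> + 1))" for y
    proof -
      have "\<bar>m y - m x\<bar> \<le> K * norm (y - x)" using K y by simp
      also have "\<dots> \<le> (\<bar>K\<bar> + 1) * norm (y - x)" by (intro mult_right_mono) auto
      also have "\<dots> < e" using y by (simp add: field_simps)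
      finally show ?thesis .
    qed
    then show "\<exists>d>0. \<forall>f\<in>{m}. \<forall>y. norm (y - x) < d \<longrightarrow> \<bar>f y - f x\<bar> < e"
      using K(1) e by (intro exI[of _ "min d (e / (\<bar>K\<bar> + 1))"]) auto
  qed
  have "equi_C j U {m}" if "j \<le> Suc n" for j
    using that by (induction j) (use zero step in \<open>auto simp del: equi_C.simps\<close>)
  then show ?thesis by blast
qed

section \<open>Higher derivatives as multilinear forms\<close>

definition unit_lists :: "'a::real_normed_vector set \<Rightarrow> nat \<Rightarrow> 'a list set" where
  "unit_lists Y m = {vs. length vs = m \<and> set vs \<subseteq> Y \<inter> cball 0 1}"

lemma prod_list_norm_unit:
  "set vs \<subseteq> cball 0 1 \<Longrightarrow> 0 \<le> prod_list (map norm vs) \<and> prod_list (map norm vs) \<le> 1"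
proof (induction vs)
  case (Cons v vs)
  then have "norm v \<le> 1" "0 \<le> prod_list (map norm vs)" "prod_list (map norm vs) \<le> 1" by auto
  then show ?case using mult_mono[of "norm v" 1 "prod_list (map norm vs)" 1] by auto
qed auto

lemma bounded_multilinear_on_unit_bound:
  assumes "bounded_multilinear_on Y m T"
  obtains B where "\<And>vs. vs \<in> unit_lists Y m \<Longrightarrow> \<bar>T vs\<bar> \<le> B"
proof -
  obtain C where C: "\<forall>vs. length vs = m \<longrightarrow> set vs \<subseteq> Y \<longrightarrow> \<bar>T vs\<bar> \<le> C * prod_list (map norm vs)"
    using assms unfolding bounded_multilinear_on_def by blast
  have "\<bar>T vs\<bar> \<le> \<bar>C\<bar>" if "vs \<in> unit_lists Y m" for vs
  proof -
    have vs: "length vs = m" "set vs \<subseteq> Y" "set vs \<subseteq> cball 0 1" using that by (auto simp: unit_lists_def)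
    have p: "0 \<le> prod_list (map norm vs)" "prod_list (map norm vs) \<le> 1" using prod_list_norm_unit[OF vs(3)] by auto
    have "\<bar>T vs\<bar> \<le> C * prod_list (map norm vs)" using C vs by blast
    also have "\<dots> \<le> \<bar>C\<bar> * prod_list (map norm vs)" using p by (intro mult_right_mono) auto
    also have "\<dots> \<le> \<bar>C\<bar> * 1" using p by (intro mult_left_mono) auto
    finally show ?thesis by simp
  qed
  then show ?thesis by (rule that)
qed

text \<open>
  The supremum of an unbounded set of reals is unspecified; the bound \<open>B\<close> makes it meaningful.
\<close>

lemma multilinear_norm_on_upper:
  assumes "vs \<in> unit_lists Y m" "\<And>vs. vs \<in> unit_lists Y m \<Longrightarrow> \<bar>T vs\<bar> \<le> B"
  shows "\<bar>T vs\<bar> \<le> multilinear_norm_on Y m T"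
  using cSUP_upper[of vs "unit_lists Y m" "\<lambda>vs. \<bar>T vs\<bar>"] assms
  unfolding multilinear_norm_on_def unit_lists_def bdd_above_def by auto

lemma multilinear_norm_on_least:
  assumes "0 \<in> Y" "\<And>vs. vs \<in> unit_lists Y m \<Longrightarrow> \<bar>T vs\<bar> \<le> B"
  shows "multilinear_norm_on Y m T \<le> B" and "0 \<le> multilinear_norm_on Y m T"
proof -
  have ne: "replicate m 0 \<in> unit_lists Y m" using assms(1) by (auto simp: unit_lists_def)
  then show "multilinear_norm_on Y m T \<le> B"
    using cSUP_least[of "unit_lists Y m" "\<lambda>vs. \<bar>T vs\<bar>" B] assms(2)
    unfolding multilinear_norm_on_def unit_lists_def by blast
  show "0 \<le> multilinear_norm_on Y m T"
    using multilinear_norm_on_upper[of _ Y m T B, OF ne assms(2)] by linarith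
qed

lemma bounded_multilinear_on_head:
  assumes "bounded_multilinear_on Y (Suc m) T" "length vs = m" "set vs \<subseteq> Y" "x \<in> Y"
  shows "T ((a *\<^sub>R x) # vs) = a * T (x # vs)"
    and "y \<in> Y \<Longrightarrow> T ((x + y) # vs) = T (x # vs) + T (y # vs)"
proof -
  have "length [] + length vs + 1 = Suc m" "set [] \<subseteq> Y" using assms(2) by auto
  then have "(\<forall>x\<in>Y. \<forall>y\<in>Y. T ([] @ (x + y) # vs) = T ([] @ x # vs) + T ([] @ y # vs)) \<and>
        (\<forall>x\<in>Y. \<forall>a. T ([] @ (a *\<^sub>R x) # vs) = a * T ([] @ x # vs))"
    using assms(1,3) unfolding bounded_multilinear_on_def by blast
  then show "T ((a *\<^sub>R x) # vs) = a * T (x # vs)"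
    "y \<in> Y \<Longrightarrow> T ((x + y) # vs) = T (x # vs) + T (y # vs)" using assms(4) by auto
qed

text \<open>
  Composition with a map \<open>Q\<close> into the subspace \<open>Y\<close> is built in, because the calculus above is for
  functions on a whole space while the given norms live on subspaces.  The proof is the one of
  the chain rule for a linear inner map, with \<open>F' (Q x) (Q h # vs)\<close> as derivative in direction \<open>h\<close>.
\<close>

lemma equi_C_of_cont_frechet_diff_on:
  fixes Y :: "'a::real_normed_vector set" and Q :: "'b::real_normed_vector \<Rightarrow> 'a"
  assumes Q: "bounded_linear Q" "\<And>x. Q x \<in> Y" and Y: "subspace Y"
    and U: "\<And>x. x \<in> U \<Longrightarrow> \<exists>d>0. \<forall>y\<in>Y. norm (y - x) < d \<longrightarrow> y \<in> U"
  shows "cont_frechet_diff_on Y U n m F \<Longrightarrow> (\<And>x. x \<in> U \<Longrightarrow> bounded_multilinear_on Y m (F x)) \<Longrightarrow>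
    equi_C n {x. Q x \<in> U} {\<lambda>x. F (Q x) vs |vs. vs \<in> unit_lists Y m}"
proof -
  interpret Q: bounded_linear Q by fact
  obtain M where M: "M > 0" "\<And>x. norm (Q x) \<le> norm x * M" using Q.pos_bounded by blast
  have openU: "open {x. Q x \<in> U}" unfolding open_dist
  proof (intro ballI)
    fix x assume "x \<in> {x. Q x \<in> U}"
    then obtain d where d: "d > 0" "\<forall>y\<in>Y. norm (y - Q x) < d \<longrightarrow> y \<in> U" using U by blast
    have "y \<in> {x. Q x \<in> U}" if "dist y x < d / M" for y
    proof -
      have "norm (Q y - Q x) < d" using M(2)[of "y - x"] that M(1) by (simp add: Q.diff dist_norm pos_less_divide_eq)
      then show ?thesis using d Q(2) by blast
    qed
    then show "\<exists>e>0. \<forall>y. dist y x < e \<longrightarrow> y \<in> {x. Q x \<in> U}"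
      using d(1) M(1) by (intro exI[of _ "d / M"]) auto
  qed
  show "cont_frechet_diff_on Y U n m F \<Longrightarrow> (\<And>x. x \<in> U \<Longrightarrow> bounded_multilinear_on Y m (F x)) \<Longrightarrow>
    equi_C n {x. Q x \<in> U} {\<lambda>x. F (Q x) vs |vs. vs \<in> unit_lists Y m}"
  proof (induction n arbitrary: m F)
    case 0
    show ?case unfolding equi_C.simps equi_cont_def
    proof (intro ballI conjI allI impI)
      fix x assume "x \<in> {x. Q x \<in> U}"
      then have x: "Q x \<in> U" by simp
      obtain B where B: "\<And>vs. vs \<in> unit_lists Y m \<Longrightarrow> \<bar>F (Q x) vs\<bar> \<le> B"
        using bounded_multilinear_on_unit_bound[OF 0(2)[OF x]] by blast
      then show "\<exists>B. \<forall>f\<in>{\<lambda>x. F (Q x) vs |vs. vs \<in> unit_lists Y m}. \<bar>f x\<bar> \<le> B" by blast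
      fix e :: real assume e: "e > 0"
      have "((\<lambda>y. multilinear_norm_on Y m (\<lambda>vs. F y vs - F (Q x) vs)) \<longlongrightarrow> 0) (at (Q x) within U)"
        using 0(1) x by simp
      from tendstoD[OF this e] obtain d1 where d1: "d1 > 0" "\<forall>y\<in>U. y \<noteq> Q x \<and> dist y (Q x) < d1 \<longrightarrow>
          dist (multilinear_norm_on Y m (\<lambda>vs. F y vs - F (Q x) vs)) 0 < e"
        unfolding eventually_at by blast
      obtain d2 where d2: "d2 > 0" "\<forall>y\<in>Y. norm (y - Q x) < d2 \<longrightarrow> y \<in> U" using U[OF x] by blast
      have "\<bar>F (Q y) vs - F (Q x) vs\<bar> < e" if vs: "vs \<in> unit_lists Y m" and y: "norm (y - x) < min d1 d2 / M" for vs y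
      proof (cases "Q y = Q x")
        case False
        have n: "norm (Q y - Q x) < min d1 d2" using M(2)[of "y - x"] y M(1) by (simp add: Q.diff pos_less_divide_eq)
        then have y': "Q y \<in> U" using d2 Q(2) by simp
        obtain B' where B': "\<And>vs. vs \<in> unit_lists Y m \<Longrightarrow> \<bar>F (Q y) vs\<bar> \<le> B'"
          using bounded_multilinear_on_unit_bound[OF 0(2)[OF y']] by blast
        have "\<bar>F (Q y) vs - F (Q x) vs\<bar> \<le> B' + B" if "vs \<in> unit_lists Y m" for vs
          using B[OF that] B'[OF that] by linarith
        from multilinear_norm_on_upper[where T = "\<lambda>vs. F (Q y) vs - F (Q x) vs" and B = "B' + B", OF vs this]
        have "\<bar>F (Q y) vs - F (Q x) vs\<bar> \<le> multilinear_norm_on Y m (\<lambda>vs. F (Q y) vs - F (Q x) vs)" .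
        also have "\<dots> < e" using d1(2)[rule_format, OF y'] False n by (auto simp: dist_norm)
        finally show ?thesis .
      qed (use e in simp)
      then show "\<exists>d>0. \<forall>f\<in>{\<lambda>x. F (Q x) vs |vs. vs \<in> unit_lists Y m}. \<forall>y. norm (y - x) < d \<longrightarrow> \<bar>f y - f x\<bar> < e"
        using d1(1) d2(1) M(1) by (intro exI[of _ "min d1 d2 / M"]) auto
    qed
  next
    case (Suc n)
    from Suc.prems(1) obtain F' where F': "\<And>x. x \<in> U \<Longrightarrow> has_frechet_derivative_on Y m F (F' x) x"
      "cont_frechet_diff_on Y U n (Suc m) F'" by auto
    have mul': "bounded_multilinear_on Y (Suc m) (F' x)" if "x \<in> U" for x
      using F'(1)[OF that] by (simp add: has_frechet_derivative_on_def)
    note C = Suc.IH[OF F'(2) mul']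
    have scale: "F' y (a *\<^sub>R w # vs) = a * F' y (w # vs)" if "y \<in> U" "vs \<in> unit_lists Y m" "w \<in> Y" for y a w vs
      using bounded_multilinear_on_head(1)[OF mul'[OF that(1)]] that unfolding unit_lists_def by blast
    have fre: "\<exists>d>0. \<forall>vs\<in>unit_lists Y m. \<forall>h. norm h < d \<longrightarrow>
        \<bar>F (Q (x + h)) vs - F (Q x) vs - F' (Q x) (Q h # vs)\<bar> \<le> e * norm h"
      if x: "Q x \<in> U" and e: "e > 0" for x and e :: real
    proof -
      have e': "e / M > 0" using e M by simp
      have "((\<lambda>h. multilinear_norm_on Y m (\<lambda>vs. F (Q x + h) vs - F (Q x) vs - F' (Q x) (h # vs)) / norm h) \<longlongrightarrow> 0)
          (at 0 within Y)" using F'(1)[OF x] by (simp add: has_frechet_derivative_on_def)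
      from tendstoD[OF this e'] obtain d1 where d1: "d1 > 0" "\<forall>h\<in>Y. h \<noteq> 0 \<and> dist h 0 < d1 \<longrightarrow>
          dist (multilinear_norm_on Y m (\<lambda>vs. F (Q x + h) vs - F (Q x) vs - F' (Q x) (h # vs)) / norm h) 0 < e / M"
        unfolding eventually_at by blast
      obtain d2 where d2: "d2 > 0" "\<forall>y\<in>Y. norm (y - Q x) < d2 \<longrightarrow> y \<in> U" using U[OF x] by blast
      obtain B where B: "\<And>vs. vs \<in> unit_lists Y m \<Longrightarrow> \<bar>F (Q x) vs\<bar> \<le> B"
        using bounded_multilinear_on_unit_bound[OF Suc.prems(2)[OF x]] by blast
      obtain B1 where B1: "\<And>vs. vs \<in> unit_lists Y (Suc m) \<Longrightarrow> \<bar>F' (Q x) vs\<bar> \<le> B1"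
        using bounded_multilinear_on_unit_bound[OF mul'[OF x]] by blast
      have "\<bar>F (Q (x + h)) vs - F (Q x) vs - F' (Q x) (Q h # vs)\<bar> \<le> e * norm h"
        if vs: "vs \<in> unit_lists Y m" and h: "norm h < min d1 d2 / M" for vs h
      proof (cases "Q h = 0")
        case True
        then have "F' (Q x) (Q h # vs) = 0" using scale[OF x vs Q(2), of 0 h] by simp
        then show ?thesis using e by (simp add: Q.add True)
      next
        case False
        have n: "norm (Q h) < min d1 d2" using M(2)[of h] h M(1) by (simp add: pos_less_divide_eq)
        have "Q x + Q h \<in> Y" using Q(2)[of "x + h"] by (simp add: Q.add)
        then have y': "Q x + Q h \<in> U" using d2 n by simp
        obtain B' where B': "\<And>vs. vs \<in> unit_lists Y m \<Longrightarrow> \<bar>F (Q x + Q h) vs\<bar> \<le> B'"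
          using bounded_multilinear_on_unit_bound[OF Suc.prems(2)[OF y']] by blast
        let ?T = "\<lambda>vs. F (Q x + Q h) vs - F (Q x) vs - F' (Q x) (Q h # vs)"
        have "\<bar>?T vs\<bar> \<le> B' + B + norm (Q h) * B1" if vs: "vs \<in> unit_lists Y m" for vs
        proof -
          have sg: "sgn (Q h) \<in> Y" using Q(2) Y by (simp add: sgn_div_norm subspace_scale)
          have "F' (Q x) (Q h # vs) = norm (Q h) * F' (Q x) (sgn (Q h) # vs)"
            using scale[OF x vs sg, of "norm (Q h)"] False by (simp add: sgn_div_norm)
          moreover have "sgn (Q h) # vs \<in> unit_lists Y (Suc m)" using vs sg by (auto simp: unit_lists_def norm_sgn)
          ultimately have "\<bar>F' (Q x) (Q h # vs)\<bar> \<le> norm (Q h) * B1"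
            using B1 by (simp add: abs_mult mult_left_mono)
          then show ?thesis using B[OF vs] B'[OF vs] by linarith
        qed
        from multilinear_norm_on_upper[where T = ?T and B = "B' + B + norm (Q h) * B1", OF vs this]
        have "\<bar>?T vs\<bar> \<le> multilinear_norm_on Y m ?T" .
        also have "\<dots> \<le> e / M * norm (Q h)"
        proof -
          have "multilinear_norm_on Y m ?T / norm (Q h) < e / M"
            using d1(2)[rule_format, OF Q(2)[of h]] False n divide_right_mono[OF abs_ge_self norm_ge_zero]
            by (fastforce simp: dist_norm intro: le_less_trans)
          then show ?thesis using False by (simp add: divide_less_eq)
        qed
        also have "\<dots> \<le> e / M * (norm h * M)" using M(2) e' by (intro mult_left_mono) auto
        finally show ?thesis using M(1) by (simp add: Q.add)
      qed
      then show ?thesis using d1(1) d2(1) M(1) by (intro exI[of _ "min d1 d2 / M"]) auto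
    qed
    have der: "((\<lambda>x. F (Q x) vs) has_derivative (\<lambda>h. F' (Q x) (Q h # vs))) (at x)"
      if x: "Q x \<in> U" and vs: "vs \<in> unit_lists Y m" for x vs
      unfolding has_derivative_at_alt
    proof (intro conjI allI impI)
      have add: "F' (Q x) ((v + w) # vs) = F' (Q x) (v # vs) + F' (Q x) (w # vs)" if "v \<in> Y" "w \<in> Y" for v w
        using bounded_multilinear_on_head(2)[OF mul'[OF x]] vs that unfolding unit_lists_def by blast
      obtain B1 where B1: "\<And>vs. vs \<in> unit_lists Y (Suc m) \<Longrightarrow> \<bar>F' (Q x) vs\<bar> \<le> B1"
        using bounded_multilinear_on_unit_bound[OF mul'[OF x]] by blast
      have bdd: "\<bar>F' (Q x) (Q h # vs)\<bar> \<le> norm h * (M * \<bar>B1\<bar>)" for h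
      proof -
        have sg: "sgn (Q h) \<in> Y" using Q(2) Y by (simp add: sgn_div_norm subspace_scale)
        have "F' (Q x) (Q h # vs) = norm (Q h) * F' (Q x) (sgn (Q h) # vs)"
          using scale[OF x vs sg, of "norm (Q h)"] scale[OF x vs sg, of 0] by (cases "Q h = 0") (simp_all add: sgn_div_norm)
        moreover have "sgn (Q h) # vs \<in> unit_lists Y (Suc m)" using vs sg by (auto simp: unit_lists_def norm_sgn)
        then have "\<bar>F' (Q x) (sgn (Q h) # vs)\<bar> \<le> \<bar>B1\<bar>" using B1 by force
        ultimately have "\<bar>F' (Q x) (Q h # vs)\<bar> \<le> norm (Q h) * \<bar>B1\<bar>"
          by (simp add: abs_mult mult_left_mono)
        also have "\<dots> \<le> (norm h * M) * \<bar>B1\<bar>" using M(2) by (intro mult_right_mono) auto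
        finally show ?thesis by (simp add: mult.assoc)
      qed
      show "bounded_linear (\<lambda>h. F' (Q x) (Q h # vs))"
        by (rule bounded_linear_intro[where K = "M * \<bar>B1\<bar>"])
           (use add[OF Q(2) Q(2)] scale[OF x vs Q(2)] bdd in \<open>auto simp: Q.add Q.scaleR\<close>)
      fix e :: real assume "e > 0"
      then obtain d where d: "d > 0" "\<forall>h. norm h < d \<longrightarrow>
          \<bar>F (Q (x + h)) vs - F (Q x) vs - F' (Q x) (Q h # vs)\<bar> \<le> e * norm h"
        using fre[OF x] vs by blast
      have "norm (F (Q y) vs - F (Q x) vs - F' (Q x) (Q (y - x) # vs)) \<le> e * norm (y - x)" if "norm (y - x) < d" for y
        using d(2)[rule_format, OF that] by simp
      then show "\<exists>d>0. \<forall>y. norm (y - x) < d \<longrightarrow>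
         norm (F (Q y) vs - F (Q x) vs - F' (Q x) (Q (y - x) # vs)) \<le> e * norm (y - x)" using d(1) by blast
    qed
    have fd: "frechet_derivative (\<lambda>x. F (Q x) vs) (at x) = (\<lambda>h. F' (Q x) (Q h # vs))"
      if x: "Q x \<in> U" and vs: "vs \<in> unit_lists Y m" for x vs
      using frechet_derivative_at[OF der[OF that]] by simp
    let ?K = "{\<lambda>x. F (Q x) vs |vs. vs \<in> unit_lists Y m}"
    let ?K' = "{\<lambda>x. F' (Q x) vs |vs. vs \<in> unit_lists Y (Suc m)}"
    note P = equi_C_mult[OF openU equi_C_const[OF openU, of n M] C]
    show ?case
    proof (rule equi_C_SucI[OF openU, where D = "\<lambda>k x. frechet_derivative k (at x)", OF _ _ _ P])
      show "\<exists>B. \<forall>f\<in>?K. \<bar>f x\<bar> \<le> B" if x: "x \<in> {x. Q x \<in> U}" for x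
      proof -
        obtain B where "\<And>vs. vs \<in> unit_lists Y m \<Longrightarrow> \<bar>F (Q x) vs\<bar> \<le> B"
          using bounded_multilinear_on_unit_bound[OF Suc.prems(2), of "Q x"] x by blast
        then show ?thesis by auto
      qed
      show "linear (frechet_derivative k (at x))" if k: "k \<in> ?K" and x: "x \<in> {x. Q x \<in> U}" for k x
      proof -
        obtain vs where "k = (\<lambda>x. F (Q x) vs)" "vs \<in> unit_lists Y m" using k by blast
        then show ?thesis using fd[of x vs] has_derivative_linear[OF der[of x vs]] x by simp
      qed
      show "\<exists>d>0. \<forall>k\<in>?K. \<forall>h. norm h < d \<longrightarrow> \<bar>k (x + h) - k x - frechet_derivative k (at x) h\<bar> \<le> e * norm h"
        if x: "x \<in> {x. Q x \<in> U}" and e: "e > 0" for x and e :: real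
      proof -
        have x': "Q x \<in> U" using x by simp
        obtain d where d: "d > 0" "\<forall>vs\<in>unit_lists Y m. \<forall>h. norm h < d \<longrightarrow>
          \<bar>F (Q (x + h)) vs - F (Q x) vs - F' (Q x) (Q h # vs)\<bar> \<le> e * norm h" using fre[OF x' e] by blast
        then have "\<forall>k\<in>?K. \<forall>h. norm h < d \<longrightarrow> \<bar>k (x + h) - k x - frechet_derivative k (at x) h\<bar> \<le> e * norm h"
          using fd[OF x'] by auto
        then show ?thesis using d(1) by blast
      qed
      fix k and h :: 'b assume k: "k \<in> ?K" and h: "norm h \<le> 1"
      obtain vs where vs: "k = (\<lambda>x. F (Q x) vs)" "vs \<in> unit_lists Y m" using k by blast
      define w where "w = Q h /\<^sub>R M"
      have "norm (Q h) \<le> M" using order_trans[OF M(2)[of h] mult_right_mono[OF h, of M]] M(1) by simp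
      then have w: "norm w \<le> 1" "w \<in> Y" using M(1) Q(2) Y unfolding w_def by (auto simp: field_simps subspace_scale)
      have "w # vs \<in> unit_lists Y (Suc m)" using w vs by (auto simp: unit_lists_def)
      then have "(\<lambda>x. M * F' (Q x) (w # vs)) \<in> product_family {\<lambda>x. c |c. \<bar>c\<bar> \<le> M} ?K'"
        by (intro product_familyI) (use M(1) in auto)
      moreover have "\<forall>x\<in>{x. Q x \<in> U}. frechet_derivative k (at x) h = M * F' (Q x) (w # vs)"
      proof
        fix x assume "x \<in> {x. Q x \<in> U}"
        then have x: "Q x \<in> U" by simp
        have "Q h = M *\<^sub>R w" using M(1) by (simp add: w_def)
        then show "frechet_derivative k (at x) h = M * F' (Q x) (w # vs)"
          unfolding vs(1) fd[OF x vs(2)] using scale[OF x vs(2) w(2)] by simp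
      qed
      ultimately show "\<exists>g\<in>product_family {\<lambda>x. c |c. \<bar>c\<bar> \<le> M} ?K'. \<forall>x\<in>{x. Q x \<in> U}. frechet_derivative k (at x) h = g x"
        by (intro bexI[of _ "\<lambda>x. M * F' (Q x) (w # vs)"])
    qed
  qed
qed

text \<open>
  Lists of arbitrary directions are thus reduced to lists from the unit ball.
\<close>

lemma bounded_multilinear_on_normalize:
  assumes T: "bounded_multilinear_on (UNIV :: 'a::real_normed_vector set) m T"
  shows "length us + length vs = m \<Longrightarrow> T (us @ vs) = prod_list (map norm vs) * T (us @ map sgn vs)"
proof (induction vs arbitrary: us)
  case (Cons v vs)
  have hom: "T (us @ (a *\<^sub>R x) # ws) = a * T (us @ x # ws)" if "length us + length ws + 1 = m" for a x us ws
    using T that unfolding bounded_multilinear_on_def by blast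
  have v: "v = norm v *\<^sub>R sgn v" by (cases "v = 0") (simp_all add: sgn_div_norm)
  have "T (us @ v # vs) = T ((us @ [v]) @ vs)" by simp
  also have "\<dots> = prod_list (map norm vs) * T ((us @ [v]) @ map sgn vs)"
    using Cons.prems by (intro Cons.IH) simp
  also have "T ((us @ [v]) @ map sgn vs) = norm v * T (us @ sgn v # map sgn vs)"
    using hom[of us "map sgn vs" "norm v" "sgn v"] Cons.prems v by simp
  finally show ?case by simp
qed simp

text \<open>
  The form \<open>F' x (h # vs)\<close> has to be the derivative of \<open>\<lambda>y. F y vs\<close> at \<open>x\<close> in direction \<open>h\<close>.  It is
  multilinear in \<open>vs\<close> because differentiation is linear, and it is defined for all \<open>vs\<close> since
  normalisation reduces to directions in the unit ball.
\<close>

lemma cont_frechet_diff_on_of_equi_C: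
  fixes U :: "'a::real_normed_vector set"
  assumes U: "open U"
  shows "equi_C n U {\<lambda>x. F x vs |vs. vs \<in> unit_lists UNIV m} \<Longrightarrow>
    (\<And>x. x \<in> U \<Longrightarrow> bounded_multilinear_on UNIV m (F x)) \<Longrightarrow> cont_frechet_diff_on UNIV U n m F"
proof (induction n arbitrary: m F)
  case 0
  let ?K = "{\<lambda>x. F x vs |vs. vs \<in> unit_lists UNIV m}"
  show ?case unfolding cont_frechet_diff_on.simps
  proof (intro ballI tendstoI)
    fix x and e :: real assume x: "x \<in> U" and e: "e > 0"
    then have "e / 2 > 0" by simp
    then obtain d where d: "d > 0" "\<forall>f\<in>?K. \<forall>y. norm (y - x) < d \<longrightarrow> \<bar>f y - f x\<bar> < e / 2"
      using 0(1) x unfolding equi_C.simps equi_cont_def by meson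
    have "dist (multilinear_norm_on UNIV m (\<lambda>vs. F y vs - F x vs)) 0 < e" if "dist y x < d" for y
    proof -
      have "\<bar>F y vs - F x vs\<bar> \<le> e / 2" if "vs \<in> unit_lists UNIV m" for vs
      proof -
        have "(\<lambda>x. F x vs) \<in> ?K" using that by blast
        from d(2)[rule_format, OF this, of y] show ?thesis using \<open>dist y x < d\<close> by (simp add: dist_norm)
      qed
      from multilinear_norm_on_least[where Y = UNIV and m = m and T = "\<lambda>vs. F y vs - F x vs" and B = "e / 2", OF UNIV_I this]
      show ?thesis using e by (simp add: dist_norm)
    qed
    then show "\<forall>\<^sub>F y in at x within U. dist (multilinear_norm_on UNIV m (\<lambda>vs. F y vs - F x vs)) 0 < e"
      unfolding eventually_at using d(1) by blast
  qed
next
  case (Suc n)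
  let ?K = "{\<lambda>x. F x vs |vs. vs \<in> unit_lists UNIV m}"
  note E = equi_C_SucD[OF Suc.prems(1)]
  define D where "D = (\<lambda>x vs h. frechet_derivative (\<lambda>y. F y vs) (at x) h)"
  have inK: "(\<lambda>y. F y vs) \<in> ?K" if "vs \<in> unit_lists UNIV m" for vs using that by blast
  have unit: "map sgn vs \<in> unit_lists UNIV m" if "length vs = m" for vs :: "'a list"
    using that by (auto simp: unit_lists_def norm_sgn)
  have derunit: "((\<lambda>y. F y vs) has_derivative D x vs) (at x)" if "x \<in> U" "vs \<in> unit_lists UNIV m" for x vs
    unfolding D_def using E(1)[OF inK[OF that(2)] that(1)] by simp
  have norml: "F y vs = prod_list (map norm vs) * F y (map sgn vs)" if "y \<in> U" "length vs = m" for y vs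
    using bounded_multilinear_on_normalize[OF Suc.prems(2)[OF that(1)], of "[]" vs] that(2) by simp
  have der0: "((\<lambda>y. F y vs) has_derivative (\<lambda>h. prod_list (map norm vs) * D x (map sgn vs) h)) (at x)"
    if x: "x \<in> U" and vs: "length vs = m" for x vs
  proof (rule has_derivative_transform_within_open[OF _ U x])
    show "((\<lambda>y. prod_list (map norm vs) * F y (map sgn vs)) has_derivative
        (\<lambda>h. prod_list (map norm vs) * D x (map sgn vs) h)) (at x)"
      by (rule has_derivative_mult_right[OF derunit[OF x unit[OF vs]]])
  qed (rule norml[OF _ vs, symmetric])
  have D0: "D x vs = (\<lambda>h. prod_list (map norm vs) * D x (map sgn vs) h)" if "x \<in> U" "length vs = m" for x vs
  proof -
    have "D x vs = frechet_derivative (\<lambda>y. F y vs) (at x)" by (simp add: D_def)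
    also have "\<dots> = (\<lambda>h. prod_list (map norm vs) * D x (map sgn vs) h)"
      by (rule frechet_derivative_at[OF der0[OF that], symmetric])
    finally show ?thesis .
  qed
  have der: "((\<lambda>y. F y vs) has_derivative D x vs) (at x)" if "x \<in> U" "length vs = m" for x vs
    by (subst D0[OF that]) (rule der0[OF that])
  define F' where "F' = (\<lambda>x ws. case ws of [] \<Rightarrow> 0 | h # vs \<Rightarrow> D x vs h)"
  have F'_Cons[simp]: "F' x (h # vs) = D x vs h" for x h vs by (simp add: F'_def)
  have Dadd: "D x (us @ (a + b) # vs) = (\<lambda>h. D x (us @ a # vs) h + D x (us @ b # vs) h)"
    if x: "x \<in> U" and l: "length us + length vs + 1 = m" for x us vs a b
  proof -
    have "((\<lambda>y. F y (us @ (a + b) # vs)) has_derivative (\<lambda>h. D x (us @ a # vs) h + D x (us @ b # vs) h)) (at x)"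
    proof (rule has_derivative_transform_within_open[OF _ U x])
      show "((\<lambda>y. F y (us @ a # vs) + F y (us @ b # vs)) has_derivative (\<lambda>h. D x (us @ a # vs) h + D x (us @ b # vs) h)) (at x)"
        by (rule has_derivative_add) (rule der[OF x], use l in simp)+
      show "F y (us @ a # vs) + F y (us @ b # vs) = F y (us @ (a + b) # vs)" if "y \<in> U" for y
        using Suc.prems(2)[OF that] l unfolding bounded_multilinear_on_def by simp
    qed
    then show ?thesis using has_derivative_unique[OF der[OF x, of "us @ (a + b) # vs"]] l by auto
  qed
  have Dscale: "D x (us @ (c *\<^sub>R a) # vs) = (\<lambda>h. c * D x (us @ a # vs) h)"
    if x: "x \<in> U" and l: "length us + length vs + 1 = m" for x us vs a c
  proof -
    have "((\<lambda>y. F y (us @ (c *\<^sub>R a) # vs)) has_derivative (\<lambda>h. c * D x (us @ a # vs) h)) (at x)"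
    proof (rule has_derivative_transform_within_open[OF _ U x])
      show "((\<lambda>y. c * F y (us @ a # vs)) has_derivative (\<lambda>h. c * D x (us @ a # vs) h)) (at x)"
        by (rule has_derivative_mult_right, rule der[OF x]) (use l in simp)
      show "c * F y (us @ a # vs) = F y (us @ (c *\<^sub>R a) # vs)" if "y \<in> U" for y
        using Suc.prems(2)[OF that] l unfolding bounded_multilinear_on_def by simp
    qed
    then show ?thesis using has_derivative_unique[OF der[OF x, of "us @ (c *\<^sub>R a) # vs"]] l by auto
  qed
  have mul': "bounded_multilinear_on UNIV (Suc m) (F' x)" if x: "x \<in> U" for x
    unfolding bounded_multilinear_on_def
  proof (intro conjI allI impI ballI)
    fix us vs :: "'a list" and a b :: 'a and c :: real assume l: "length us + length vs + 1 = Suc m"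
    show "F' x (us @ (a + b) # vs) = F' x (us @ a # vs) + F' x (us @ b # vs)"
    proof (cases us)
      case Nil
      then show ?thesis using linear_add[OF has_derivative_linear[OF der[OF x, of vs]]] l by simp
    next
      case (Cons h us')
      then show ?thesis using Dadd[OF x, of us' vs a b] l by simp
    qed
    show "F' x (us @ (c *\<^sub>R a) # vs) = c * F' x (us @ a # vs)"
    proof (cases us)
      case Nil
      then show ?thesis using linear_scale[OF has_derivative_linear[OF der[OF x, of vs]]] l by simp
    next
      case (Cons h us')
      then show ?thesis using Dscale[OF x, of us' vs c a] l by simp
    qed
  next
    obtain B where B: "\<forall>f\<in>?K. \<forall>h. \<bar>frechet_derivative f (at x) h\<bar> \<le> B * norm h" using E(5)[OF x] by blast
    have "\<bar>F' x ws\<bar> \<le> B * prod_list (map norm ws)" if ws: "length ws = Suc m" for ws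
    proof -
      obtain h vs where hv: "ws = h # vs" "length vs = m" using ws by (cases ws) auto
      have "0 \<le> prod_list (map norm vs)" by (induction vs) auto
      moreover have "\<bar>D x (map sgn vs) h\<bar> \<le> B * norm h" unfolding D_def using B inK[OF unit[OF hv(2)]] by meson
      ultimately have "prod_list (map norm vs) * \<bar>D x (map sgn vs) h\<bar> \<le> prod_list (map norm vs) * (B * norm h)"
        by (intro mult_left_mono)
      then show ?thesis unfolding hv(1) F'_Cons using D0[OF x hv(2)] \<open>0 \<le> prod_list (map norm vs)\<close>
        by (simp add: abs_mult mult_ac)
    qed
    then show "\<exists>C. \<forall>vs. length vs = Suc m \<longrightarrow> set vs \<subseteq> UNIV \<longrightarrow> \<bar>F' x vs\<bar> \<le> C * prod_list (map norm vs)" by blast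
  qed
  have "has_frechet_derivative_on UNIV m F (F' x) x" if x: "x \<in> U" for x
    unfolding has_frechet_derivative_on_def
  proof (intro conjI mul'[OF x] tendstoI)
    fix e :: real assume e: "e > 0"
    then have "e / 2 > 0" by simp
    then obtain d where d: "d > 0" "\<forall>f\<in>?K. \<forall>h. norm h < d \<longrightarrow> \<bar>f (x + h) - f x - frechet_derivative f (at x) h\<bar> \<le> e / 2 * norm h"
      using E(3)[OF x] by blast
    have "dist (multilinear_norm_on UNIV m (\<lambda>vs. F (x + h) vs - F x vs - F' x (h # vs)) / norm h) 0 < e"
      if h: "h \<noteq> 0" "dist h 0 < d" for h
    proof -
      have "\<bar>F (x + h) vs - F x vs - F' x (h # vs)\<bar> \<le> e / 2 * norm h" if "vs \<in> unit_lists UNIV m" for vs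
        using d(2)[rule_format, OF inK[OF that], of h] h(2) by (simp add: D_def)
      from multilinear_norm_on_least[where Y = UNIV and m = m and B = "e / 2 * norm h"
          and T = "\<lambda>vs. F (x + h) vs - F x vs - F' x (h # vs)", OF UNIV_I this]
      have n: "0 \<le> multilinear_norm_on UNIV m (\<lambda>vs. F (x + h) vs - F x vs - F' x (h # vs))"
        "multilinear_norm_on UNIV m (\<lambda>vs. F (x + h) vs - F x vs - F' x (h # vs)) \<le> e / 2 * norm h" by auto
      note n(2)
      also have "e / 2 * norm h < e * norm h" using e h(1) by simp
      finally show ?thesis using n(1) h(1) by (simp add: dist_norm divide_less_eq)
    qed
    then show "\<forall>\<^sub>F h in at 0. dist (multilinear_norm_on UNIV m (\<lambda>vs. F (x + h) vs - F x vs - F' x (h # vs)) / norm h) 0 < e"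
      unfolding eventually_at using d(1) by blast
  qed
  moreover have "cont_frechet_diff_on UNIV U n (Suc m) F'"
  proof (rule Suc.IH[OF _ mul'])
    show "equi_C n U {\<lambda>x. F' x ws |ws. ws \<in> unit_lists UNIV (Suc m)}"
    proof (rule equi_C_mono[OF E(4) U])
      fix k assume "k \<in> {\<lambda>x. F' x ws |ws. ws \<in> unit_lists UNIV (Suc m)}"
      then obtain ws where ws: "k = (\<lambda>x. F' x ws)" "ws \<in> unit_lists UNIV (Suc m)" by blast
      then obtain h vs where hv: "ws = h # vs" "vs \<in> unit_lists UNIV m" "norm h \<le> 1"
        by (cases ws) (auto simp: unit_lists_def)
      have "k = (\<lambda>x. frechet_derivative (\<lambda>y. F y vs) (at x) h)" by (simp add: ws(1) hv(1) D_def)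
      then have "k \<in> derivatives ?K" using derivativesI[OF inK[OF hv(2)] hv(3)] by simp
      then show "\<exists>g\<in>derivatives ?K. \<forall>y\<in>U. k y = g y" by blast
    qed
  qed
  ultimately show ?case by auto
qed

lemma unit_lists_0: "unit_lists Y 0 = {[]}"
  by (auto simp: unit_lists_def)

text \<open>
  A real function is a map into the \<open>0\<close>-linear forms; the only list of directions is the empty one.
\<close>

lemma smooth_norm_onD:
  fixes Y :: "'a::real_normed_vector set"
  assumes q: "smooth_norm_on Y k q" and n: "enat n \<le> k"
    and Q: "bounded_linear Q" "\<And>x. Q x \<in> Y" and Y: "subspace Y"
  shows "equi_C n {x. Q x \<noteq> 0} {\<lambda>x. q (Q x)}"
proof -
  obtain N where N: "n \<le> N" "cont_frechet_diff_on Y (Y - {0}) N 0 (\<lambda>x _. q x)"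
    using q n unfolding smooth_norm_on_def by (cases k) auto
  have "equi_C N {x. Q x \<in> Y - {0}} {\<lambda>x. (\<lambda>x _. q x) (Q x) vs |vs. vs \<in> unit_lists Y 0}"
  proof (rule equi_C_of_cont_frechet_diff_on[OF Q Y _ N(2)])
    show "\<exists>d>0. \<forall>y\<in>Y. norm (y - x) < d \<longrightarrow> y \<in> Y - {0}" if "x \<in> Y - {0}" for x
      using that by (intro exI[of _ "norm x"]) auto
    show "bounded_multilinear_on Y 0 (\<lambda>_. q x)" for x
      by (auto simp: bounded_multilinear_on_def)
  qed
  moreover have "{x. Q x \<in> Y - {0}} = {x. Q x \<noteq> 0}" using Q(2) by auto
  ultimately have "equi_C N {x. Q x \<noteq> 0} {\<lambda>x. q (Q x)}" by (simp add: unit_lists_0)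
  then show ?thesis using equi_C_le[OF N(1)] by blast
qed

lemma smooth_norm_onI:
  fixes p :: "'a::real_normed_vector \<Rightarrow> real"
  assumes "norm_on UNIV p" "\<And>n. enat n \<le> k \<Longrightarrow> equi_C n (- {0}) {p}"
  shows "smooth_norm_on UNIV k p"
proof -
  have "cont_frechet_diff_on UNIV (UNIV - {0}) n 0 (\<lambda>x _. p x)" if "enat n \<le> k" for n
  proof (rule cont_frechet_diff_on_of_equi_C)
    show "equi_C n (UNIV - {0}) {\<lambda>x. (\<lambda>x _. p x) x vs |vs. vs \<in> unit_lists UNIV 0}"
      using assms(2)[OF that] by (simp add: unit_lists_0 Compl_eq_Diff_UNIV)
    show "bounded_multilinear_on UNIV 0 (\<lambda>_. p x)" for x
      by (auto simp: bounded_multilinear_on_def)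
  qed auto
  then show ?thesis using assms(1) unfolding smooth_norm_on_def by (cases k) auto
qed

section \<open>A flat convex function and convexity gaps\<close>

text \<open>
  The derivatives of \<open>\<lambda>t. exp (- 1 / t)\<close> are combinations of the functions \<open>flat k\<close>, which are closed
  under differentiation also at \<open>0\<close>.
\<close>

definition flat :: "nat \<Rightarrow> real \<Rightarrow> real" where
  "flat k t = (if t > 0 then inverse t ^ k * exp (- inverse t) else 0)"

lemma flat_nonneg: "0 \<le> flat k t"
  by (simp add: flat_def)

text \<open>
  With \<open>s = 1 / t\<close> this is the estimate of \<open>exp s\<close> from below by one term of its power series.
\<close>

lemma flat_bound: "\<bar>flat k t\<bar> \<le> fact (Suc k) * \<bar>t\<bar>"
proof (cases "t > 0")
  case True
  define s where "s = inverse t"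
  have s: "s > 0" using True by (simp add: s_def)
  have "(\<lambda>n. s ^ n /\<^sub>R fact n) sums exp s" by (rule exp_converges)
  then have "(\<Sum>n\<in>{Suc k}. s ^ n /\<^sub>R fact n) \<le> exp s"
    using sum_le_suminf[of "\<lambda>n. s ^ n /\<^sub>R fact n" "{Suc k}"] s by (simp add: sums_iff)
  then have "s ^ Suc k / fact (Suc k) \<le> exp s" by (simp add: divide_inverse mult.commute)
  then have "s ^ Suc k \<le> fact (Suc k) * exp s" by (simp add: divide_le_eq mult.commute)
  then have "s * (s ^ k * exp (- s)) \<le> fact (Suc k)"
    by (simp add: exp_minus field_simps del: fact_Suc)
  then have "s ^ k * exp (- s) \<le> fact (Suc k) * t"
    using True by (simp add: s_def field_simps del: fact_Suc)
  then show ?thesis using True flat_nonneg[of k t] by (simp add: flat_def s_def del: fact_Suc)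
qed (simp add: flat_def mult_nonneg_nonpos del: fact_Suc)

lemma flat_deriv: "(flat k has_real_derivative flat (k + 2) t - k * flat (k + 1) t) (at t)"
proof -
  consider "t > 0" | "t < 0" | "t = 0" by linarith
  then show ?thesis
  proof cases
    case 1
    have "((\<lambda>t. inverse t ^ k * exp (- inverse t)) has_real_derivative flat (k + 2) t - k * flat (k + 1) t) (at t)"
    proof -
      have t: "t \<noteq> 0" using 1 by simp
      have "((\<lambda>t. exp (- inverse t)) has_real_derivative exp (- inverse t) * inverse t ^ 2) (at t)"
        using t by (auto intro!: derivative_eq_intros simp: power2_eq_square)
      from DERIV_mult[OF DERIV_power[OF DERIV_inverse[OF t], of k] this]
      have "((\<lambda>t. inverse t ^ k * exp (- inverse t)) has_real_derivative
          real k * (- (inverse t ^ Suc (Suc 0)) * inverse t ^ (k - Suc 0)) * exp (- inverse t) +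
          exp (- inverse t) * inverse t ^ 2 * inverse t ^ k) (at t)" by simp
      moreover have "real k * (- (inverse t ^ Suc (Suc 0)) * inverse t ^ (k - Suc 0)) * exp (- inverse t) +
          exp (- inverse t) * inverse t ^ 2 * inverse t ^ k = flat (k + 2) t - k * flat (k + 1) t"
        using 1 by (cases k) (simp_all add: flat_def power2_eq_square algebra_simps)
      ultimately show ?thesis by simp
    qed
    then show ?thesis
      by (rule has_field_derivative_transform_within_open[where S = "{0<..}"]) (use 1 in \<open>auto simp: flat_def\<close>)
  next
    case 2
    have "((\<lambda>t. 0) has_real_derivative flat (k + 2) t - k * flat (k + 1) t) (at t)"
      using 2 by (simp add: flat_def)
    then show ?thesis
      by (rule has_field_derivative_transform_within_open[where S = "{..<0}"]) (use 2 in \<open>auto simp: flat_def\<close>)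
  next
    case 3
    have "((\<lambda>h. (flat k (0 + h) - flat k 0) / h) \<longlongrightarrow> 0) (at 0)"
    proof (rule tendsto_0_le[where f = "\<lambda>h. h" and K = "fact (k + 2)"])
      show "((\<lambda>h::real. h) \<longlongrightarrow> 0) (at 0)" by (rule tendsto_ident_at)
      have "norm ((flat k (0 + h) - flat k 0) / h) \<le> norm h * fact (k + 2)" for h
      proof -
        have "(flat k (0 + h) - flat k 0) / h = flat (Suc k) h" by (simp add: flat_def field_simps)
        then show ?thesis using flat_bound[of "Suc k" h] by (simp add: mult.commute)
      qed
      then show "\<forall>\<^sub>F h in at 0. norm ((flat k (0 + h) - flat k 0) / h) \<le> norm h * fact (k + 2)" by simp
    qed
    then show ?thesis using 3 by (simp add: DERIV_def flat_def)
  qed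
qed

lemma equi_C_flat: "equi_C n UNIV {flat k}"
proof (induction n arbitrary: k)
  case 0
  show ?case
    by (rule equi_C_cont_realI) (auto intro!: DERIV_continuous_on DERIV_subset[OF flat_deriv])
next
  case (Suc n)
  show ?case
  proof (rule equi_C_realI)
    show "(flat k has_real_derivative flat (k + 2) t + (- real k) * flat (k + 1) t) (at t)" for t
      using flat_deriv[of k t] by simp
    show "equi_C n UNIV {\<lambda>t. flat (k + 2) t + (- real k) * flat (k + 1) t}"
      by (intro equi_C_single_add equi_C_single_mult equi_C_single_const Suc) auto
  qed auto
qed

text \<open>
  The function \<open>t exp (- 1 / t)\<close>, extended by zero, is smooth; it is convex because its second
  derivative is \<open>flat 3\<close>.  It lies between \<open>t - 1\<close> and \<open>t\<close> on the positive axis, so it grows without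
  bound but is 1-Lipschitz.  Composing a norm with \<open>\<lambda>t. ramp (t - d)\<close>, where \<open>d > 0\<close>, removes the
  singularity of the norm at the origin.
\<close>

definition ramp :: "real \<Rightarrow> real" where
  "ramp t = t * flat 0 t"

definition ramp' :: "real \<Rightarrow> real" where
  "ramp' t = flat 0 t + flat 1 t"

lemma equi_C_ramp: "equi_C n UNIV {ramp}"
proof -
  have "equi_C n UNIV {\<lambda>t::real. t}"
  proof (cases n)
    case 0
    then show ?thesis using equi_C_cont_realI[of UNIV "\<lambda>t. t"] by simp
  next
    case (Suc m)
    show ?thesis unfolding Suc
      by (rule equi_C_realI[where \<psi>' = "\<lambda>_. 1"]) (auto intro: equi_C_single_const)
  qed
  from equi_C_single_mult[OF open_UNIV this equi_C_flat[of n 0]]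
  show ?thesis by (simp add: ramp_def[abs_def])
qed

lemma ramp_deriv: "(ramp has_real_derivative ramp' t) (at t)"
proof -
  have "t * flat 2 t = flat 1 t" by (simp add: flat_def power2_eq_square)
  then show ?thesis unfolding ramp_def[abs_def] ramp'_def
    using DERIV_mult[OF DERIV_ident flat_deriv[of 0 t]] by (simp add: mult.commute add.commute numeral_2_eq_2)
qed

lemma ramp'_deriv: "(ramp' has_real_derivative flat 3 t) (at t)"
  unfolding ramp'_def[abs_def]
  using DERIV_add[OF flat_deriv[of 0 t] flat_deriv[of 1 t]] by (simp add: numeral_2_eq_2 numeral_3_eq_3)

lemma ramp'_mono: "s \<le> t \<Longrightarrow> ramp' s \<le> ramp' t"
  using DERIV_nonneg_imp_nondecreasing[of s t ramp'] ramp'_deriv flat_nonneg by blast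

lemma ramp'_strict_mono:
  assumes "s < t" "0 < t"
  shows "ramp' s < ramp' t"
proof -
  have "ramp' (max s (t / 2)) < ramp' t"
  proof (rule DERIV_pos_imp_increasing[where f = ramp'])
    fix x assume "max s (t / 2) \<le> x" "x \<le> t"
    then show "\<exists>y. (ramp' has_real_derivative y) (at x) \<and> 0 < y"
      using ramp'_deriv[of x] assms by (intro exI[of _ "flat 3 x"]) (auto simp: flat_def)
  qed (use assms in auto)
  then show ?thesis using ramp'_mono[of s "max s (t / 2)"] by simp
qed

lemma ramp'_bounds: "0 \<le> ramp' t" "ramp' t \<le> 1"
proof -
  show "0 \<le> ramp' t" by (simp add: ramp'_def flat_nonneg)
  show "ramp' t \<le> 1"
  proof (cases "t > 0")
    case True
    have "1 + inverse t \<le> exp (inverse t)" by (rule exp_ge_add_one_self)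
    then have "(1 + inverse t) * exp (- inverse t) \<le> exp (inverse t) * exp (- inverse t)"
      by (intro mult_right_mono) auto
    then show ?thesis using True by (simp add: ramp'_def flat_def algebra_simps flip: exp_add)
  qed (simp add: ramp'_def flat_def)
qed

lemma ramp_eq_0: "t \<le> 0 \<Longrightarrow> ramp t = 0"
  by (simp add: ramp_def flat_def)

lemma ramp_nonneg: "0 \<le> ramp t"
  by (simp add: ramp_def flat_def)

lemma ramp_mono: "s \<le> t \<Longrightarrow> ramp s \<le> ramp t"
  using DERIV_nonneg_imp_nondecreasing[of s t ramp] ramp_deriv ramp'_bounds(1) by blast

lemma ramp_lipschitz: "\<bar>ramp s - ramp t\<bar> \<le> \<bar>s - t\<bar>"
proof -
  have le: "ramp b - ramp a \<le> b - a" if "a \<le> b" for a b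
  proof -
    have "(\<lambda>t. t - ramp t) a \<le> (\<lambda>t. t - ramp t) b"
    proof (rule DERIV_nonneg_imp_nondecreasing[OF that])
      show "\<exists>y. ((\<lambda>t. t - ramp t) has_real_derivative y) (at x) \<and> 0 \<le> y" for x
        using DERIV_diff[OF DERIV_ident ramp_deriv[of x]] ramp'_bounds(2)[of x]
        by (intro exI[of _ "1 - ramp' x"]) auto
    qed
    then show ?thesis by simp
  qed
  show ?thesis using le[of s t] le[of t s] ramp_mono[of s t] ramp_mono[of t s] by linarith
qed

lemma ramp_le: "0 \<le> t \<Longrightarrow> ramp t \<le> t"
  using ramp_lipschitz[of t 0] ramp_eq_0[of 0] by simp

lemma ramp_ge: "t - 1 \<le> ramp t"
proof (cases "t > 0")
  case True
  have "1 + - inverse t \<le> exp (- inverse t)" by (rule exp_ge_add_one_self)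
  then have "t * (1 + - inverse t) \<le> t * exp (- inverse t)" using True by (intro mult_left_mono) auto
  then show ?thesis using True by (simp add: ramp_def flat_def algebra_simps)
next
  case False
  then show ?thesis using ramp_nonneg[of t] by simp
qed

lemma ramp_strict_mono:
  assumes "0 \<le> s" "s < t"
  shows "ramp s < ramp t"
proof (rule DERIV_pos_imp_increasing_open[where f = ramp, OF assms(2)])
  fix x assume "s < x" "x < t"
  then show "\<exists>y. (ramp has_real_derivative y) (at x) \<and> 0 < y"
    using ramp_deriv[of x] assms(1) by (intro exI[of _ "ramp' x"]) (auto simp: ramp'_def flat_def add_pos_pos)
next
  show "continuous_on {s..t} ramp"
    by (auto intro!: DERIV_continuous_on DERIV_subset[OF ramp_deriv])
qed

lemma ramp_pos: "0 < t \<Longrightarrow> 0 < ramp t"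
  using ramp_strict_mono[of 0 t] ramp_eq_0[of 0] by simp

lemma ramp_convex: "convex_on UNIV ramp"
  by (rule f''_ge0_imp_convex[where f' = ramp' and f'' = "flat 3"])
     (auto intro: ramp_deriv ramp'_deriv flat_nonneg)

text \<open>
  The failure of equality in the convexity inequality at the point dividing the segment in the
  ratio \<open>s : 1 - s\<close>.  For sums of convex functions gaps add up and are nonnegative, so a small gap of
  the sum forces small gaps of all terms.
\<close>

definition gap :: "real \<Rightarrow> ('a::real_vector \<Rightarrow> real) \<Rightarrow> 'a \<Rightarrow> 'a \<Rightarrow> real" where
  "gap s f x y = (1 - s) * f x + s * f y - f ((1 - s) *\<^sub>R x + s *\<^sub>R y)"

lemma gap_nonneg: "convex_on UNIV f \<Longrightarrow> 0 \<le> s \<Longrightarrow> s \<le> 1 \<Longrightarrow> 0 \<le> gap s f x y"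
  using convex_onD[of UNIV f s x y] by (simp add: gap_def)

lemma gap_sum:
  "gap s (\<lambda>x. \<Sum>i\<in>I. f i x) x y = (\<Sum>i\<in>I. gap s (f i) x y)"
  by (simp add: gap_def sum_subtractf sum.distrib sum_distrib_left)

lemma ramp_gap_deriv:
  "((\<lambda>b. gap s ramp a b) has_real_derivative s * (ramp' b - ramp' ((1 - s) * a + s * b))) (at b)"
proof -
  have "((\<lambda>b. ramp ((1 - s) * a + s * b)) has_real_derivative ramp' ((1 - s) * a + s * b) * s) (at b)"
    by (rule DERIV_chain2[OF ramp_deriv]) (auto intro!: derivative_eq_intros)
  from DERIV_diff[OF DERIV_add[OF DERIV_const[of "(1 - s) * ramp a"] DERIV_cmult[OF ramp_deriv[of b], of s]] this]
  show ?thesis unfolding gap_def real_scaleR_def by (simp add: right_diff_distrib mult.commute)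
qed

lemma ramp_gap_mono:
  assumes s: "0 < s" "s < 1" and bc: "a \<le> b" "b \<le> c"
  shows "gap s ramp a b \<le> gap s ramp a c"
proof (rule DERIV_nonneg_imp_nondecreasing[OF bc(2)])
  fix x assume x: "b \<le> x" "x \<le> c"
  have "(1 - s) * a + s * x \<le> (1 - s) * x + s * x" using s x bc by (intro add_mono mult_left_mono) auto
  then have "ramp' ((1 - s) * a + s * x) \<le> ramp' x" by (intro ramp'_mono) (simp add: algebra_simps)
  then show "\<exists>y. (gap s ramp a has_real_derivative y) (at x) \<and> 0 \<le> y"
    using ramp_gap_deriv[of s a x] s by (intro exI[of _ "s * (ramp' x - ramp' ((1 - s) * a + s * x))"]) auto
qed

lemma ramp_gap_antimono:
  assumes s: "0 < s" "s < 1" and bc: "b \<le> c" "c \<le> a"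
  shows "gap s ramp a c \<le> gap s ramp a b"
proof (rule DERIV_nonpos_imp_nonincreasing[OF bc(1)])
  fix x assume x: "b \<le> x" "x \<le> c"
  have "(1 - s) * x + s * x \<le> (1 - s) * a + s * x" using s x bc by (intro add_mono mult_left_mono) auto
  then have "ramp' x \<le> ramp' ((1 - s) * a + s * x)" by (intro ramp'_mono) (simp add: algebra_simps)
  then show "\<exists>y. (gap s ramp a has_real_derivative y) (at x) \<and> y \<le> 0"
    using ramp_gap_deriv[of s a x] s
    by (intro exI[of _ "s * (ramp' x - ramp' ((1 - s) * a + s * x))"]) (auto simp: mult_le_0_iff)
qed

lemma ramp_gap_pos_above:
  assumes s: "0 < s" "s < 1" and b: "max a 0 < b"
  shows "0 < gap s ramp a b"
proof -
  define c where "c = (max a 0 + b) / 2"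
  have c: "max a 0 < c" "c < b" using b by (auto simp: c_def)
  have "gap s ramp a c < gap s ramp a b"
  proof (rule DERIV_pos_imp_increasing[OF c(2)])
    fix x assume x: "c \<le> x" "x \<le> b"
    have "(1 - s) * a < (1 - s) * x" using s x c by (intro mult_strict_left_mono) auto
    then have "(1 - s) * a + s * x < x" by (simp add: algebra_simps)
    then have "ramp' ((1 - s) * a + s * x) < ramp' x" using x c by (intro ramp'_strict_mono) auto
    then show "\<exists>y. (gap s ramp a has_real_derivative y) (at x) \<and> 0 < y"
      using ramp_gap_deriv[of s a x] s by (intro exI[of _ "s * (ramp' x - ramp' ((1 - s) * a + s * x))"]) auto
  qed
  then show ?thesis using gap_nonneg[OF ramp_convex, of s a c] s by linarith
qed

lemma ramp_gap_pos_below: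
  assumes s: "0 < s" "s < 1" and a: "0 < a" and b: "b < a"
  shows "0 < gap s ramp a b"
proof -
  define c where "c = max b (a / 2)"
  have c: "0 < c" "c < a" "b \<le> c" using a b by (auto simp: c_def)
  have "gap s ramp a a < gap s ramp a c"
  proof (rule DERIV_neg_imp_decreasing_open[OF c(2)])
    fix x assume x: "c < x" "x < a"
    have "(1 - s) * x < (1 - s) * a" using s x c by (intro mult_strict_left_mono) auto
    then have "x < (1 - s) * a + s * x" by (simp add: algebra_simps)
    then have "ramp' x < ramp' ((1 - s) * a + s * x)" using x c by (intro ramp'_strict_mono) auto
    then show "\<exists>y. (gap s ramp a has_real_derivative y) (at x) \<and> y < 0"
      using ramp_gap_deriv[of s a x] s
      by (intro exI[of _ "s * (ramp' x - ramp' ((1 - s) * a + s * x))"]) (auto simp: mult_less_0_iff)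
  next
    show "continuous_on {c..a} (gap s ramp a)"
      by (intro DERIV_continuous_on[where D = "\<lambda>b. s * (ramp' b - ramp' ((1 - s) * a + s * b))"] DERIV_subset[OF ramp_gap_deriv]) auto
  qed
  moreover have "gap s ramp a c \<le> gap s ramp a b" using c by (intro ramp_gap_antimono s) auto
  moreover have "gap s ramp a a = 0" by (simp add: gap_def algebra_simps)
  ultimately show ?thesis by linarith
qed

text \<open>
  The gap of \<open>ramp\<close> between \<open>a\<close> and \<open>b\<close> increases strictly when \<open>b\<close> moves up from \<open>max a 0\<close>; on the
  negative axis \<open>ramp\<close> vanishes and the gap gives no information.
\<close>

lemma ramp_gap_limsup:
  assumes s: "0 < s" "s < 1" and lim: "(\<lambda>r. gap s ramp a (b r)) \<longlonglongrightarrow> 0" and e: "0 < e"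
  shows "\<forall>\<^sub>F r in sequentially. b r < max a 0 + e"
proof -
  have "0 < gap s ramp a (max a 0 + e)" by (rule ramp_gap_pos_above[OF s]) (use e in simp)
  from order_tendstoD(2)[OF lim this]
  show ?thesis
  proof eventually_elim
    case (elim r)
    show ?case
    proof (rule ccontr)
      assume "\<not> ?thesis"
      then have "gap s ramp a (max a 0 + e) \<le> gap s ramp a (b r)"
        using e by (intro ramp_gap_mono s) auto
      then show False using elim by linarith
    qed
  qed
qed

lemma ramp_gap_tendsto:
  assumes s: "0 < s" "s < 1" and a: "0 < a" and lim: "(\<lambda>r. gap s ramp a (b r)) \<longlonglongrightarrow> 0"
  shows "b \<longlonglongrightarrow> a"
proof (rule order_tendstoI)
  show "\<forall>\<^sub>F r in sequentially. b r < u" if "a < u" for u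
    using ramp_gap_limsup[OF s lim, of "u - a"] that a by simp
  fix l assume l: "l < a"
  have "0 < gap s ramp a l" by (rule ramp_gap_pos_below[OF s a l])
  from order_tendstoD(2)[OF lim this]
  show "\<forall>\<^sub>F r in sequentially. l < b r"
  proof eventually_elim
    case (elim r)
    show ?case
    proof (rule ccontr)
      assume "\<not> ?thesis"
      then have "gap s ramp a l \<le> gap s ramp a (b r)"
        using l by (intro ramp_gap_antimono s) auto
      then show False using elim by linarith
    qed
  qed
qed

lemma ramp_tendsto_inverse:
  assumes "0 < a" "(\<lambda>r. ramp (c r)) \<longlonglongrightarrow> ramp a"
  shows "c \<longlonglongrightarrow> a"
proof (rule order_tendstoI)
  fix u assume u: "a < u"
  have "\<forall>\<^sub>F r in sequentially. ramp (c r) < ramp u"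
    by (rule order_tendstoD(2)[OF assms(2)]) (use u assms(1) in \<open>auto intro: ramp_strict_mono\<close>)
  then show "\<forall>\<^sub>F r in sequentially. c r < u"
    by eventually_elim (use ramp_mono in \<open>fastforce simp: not_le[symmetric]\<close>)
next
  fix l assume l: "l < a"
  have "ramp l < ramp a"
    using ramp_strict_mono[of l a] ramp_eq_0[of l] ramp_pos[of a] l assms(1) by (cases "0 \<le> l") auto
  from order_tendstoD(1)[OF assms(2) this]
  show "\<forall>\<^sub>F r in sequentially. l < c r"
    by eventually_elim (use ramp_mono in \<open>fastforce simp: not_le[symmetric]\<close>)
qed

text \<open>
  The gap of \<open>ramp (f - d)\<close> is the sum of two nonnegative quantities: the gap of \<open>ramp\<close> between the
  values of \<open>f - d\<close> at the end points, and the loss caused by the convexity of \<open>f\<close> inside the monotone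
  function \<open>ramp\<close>.  Where \<open>ramp\<close> is strictly convex and strictly increasing the first one forces
  convergence of the values of \<open>f\<close>, and then the second one forces the gap of \<open>f\<close> to vanish.
\<close>

lemma gap_ramp_compose:
  assumes s: "0 < s" "s < 1" and f: "convex_on UNIV f" and c: "0 < c"
    and lim: "(\<lambda>r. gap s (\<lambda>x. c * ramp (f x - d)) x (xs r)) \<longlonglongrightarrow> 0"
  shows "\<And>e. 0 < e \<Longrightarrow> \<forall>\<^sub>F r in sequentially. f (xs r) < max (f x) d + e"
    and "d < f x \<Longrightarrow> (\<lambda>r. f (xs r)) \<longlonglongrightarrow> f x"
    and "d < f x \<Longrightarrow> (\<lambda>r. gap s f x (xs r)) \<longlonglongrightarrow> 0"
proof -
  define y where "y = (\<lambda>r. (1 - s) *\<^sub>R x + s *\<^sub>R xs r)"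
  define a where "a = f x - d"
  define b where "b = (\<lambda>r. f (xs r) - d)"
  have fy: "f (y r) - d \<le> (1 - s) * a + s * b r" for r
    using gap_nonneg[OF f, of s x "xs r"] s unfolding gap_def y_def a_def b_def by (simp add: algebra_simps)
  have lim': "(\<lambda>r. gap s (\<lambda>x. ramp (f x - d)) x (xs r)) \<longlonglongrightarrow> 0"
  proof -
    have "gap s (\<lambda>x. ramp (f x - d)) x (xs r) = inverse c * gap s (\<lambda>x. c * ramp (f x - d)) x (xs r)" for r
      using c by (simp add: gap_def field_simps)
    then show ?thesis using tendsto_mult_left[OF lim, of "inverse c"] by simp
  qed
  have split: "gap s (\<lambda>x. ramp (f x - d)) x (xs r)
      = gap s ramp a (b r) + (ramp ((1 - s) * a + s * b r) - ramp (f (y r) - d))" for r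
    by (simp add: gap_def a_def b_def y_def)
  have nonneg: "0 \<le> gap s ramp a (b r)" "0 \<le> ramp ((1 - s) * a + s * b r) - ramp (f (y r) - d)" for r
    using gap_nonneg[OF ramp_convex, of s a "b r"] s ramp_mono[OF fy[of r]] by auto
  have l1: "(\<lambda>r. gap s ramp a (b r)) \<longlonglongrightarrow> 0"
    by (rule tendsto_sandwich[OF _ _ tendsto_const lim']) (use nonneg split in auto)
  have l2: "(\<lambda>r. ramp ((1 - s) * a + s * b r) - ramp (f (y r) - d)) \<longlonglongrightarrow> 0"
    by (rule tendsto_sandwich[OF _ _ tendsto_const lim']) (use nonneg split in auto)
  show "\<forall>\<^sub>F r in sequentially. f (xs r) < max (f x) d + e" if "0 < e" for e
    using ramp_gap_limsup[OF s l1 that] by eventually_elim (auto simp: a_def b_def max_def split: if_splits)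
  assume "d < f x"
  then have a: "0 < a" by (simp add: a_def)
  have bl: "b \<longlonglongrightarrow> a" by (rule ramp_gap_tendsto[OF s a l1])
  then show fl: "(\<lambda>r. f (xs r)) \<longlonglongrightarrow> f x"
    using tendsto_add[OF bl tendsto_const[of d]] by (simp add: a_def b_def)
  have mid: "(\<lambda>r. (1 - s) * a + s * b r) \<longlonglongrightarrow> a"
    using tendsto_add[OF tendsto_const[of "(1 - s) * a"] tendsto_mult_left[OF bl, of s]] by (simp add: algebra_simps)
  have "isCont ramp a" using ramp_deriv DERIV_isCont by blast
  from isCont_tendsto_compose[OF this mid]
  have "(\<lambda>r. ramp ((1 - s) * a + s * b r)) \<longlonglongrightarrow> ramp a" .
  from tendsto_diff[OF this l2] have "(\<lambda>r. ramp (f (y r) - d)) \<longlonglongrightarrow> ramp a" by simp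
  from ramp_tendsto_inverse[OF a this] have "(\<lambda>r. f (y r) - d) \<longlonglongrightarrow> a" .
  from tendsto_add[OF this tendsto_const[of d]] have "(\<lambda>r. f (y r)) \<longlonglongrightarrow> f x" by (simp add: a_def)
  then have "(\<lambda>r. (1 - s) * f x + s * f (xs r) - f (y r)) \<longlonglongrightarrow> (1 - s) * f x + s * f x - f x"
    by (intro tendsto_intros fl)
  then show "(\<lambda>r. gap s f x (xs r)) \<longlonglongrightarrow> 0" by (simp add: gap_def y_def algebra_simps)
qed

section \<open>Seminorms and Lipschitz functions\<close>

definition seminorm :: "('a::real_vector \<Rightarrow> real) \<Rightarrow> bool" where
  "seminorm p \<longleftrightarrow> (\<forall>x y. p (x + y) \<le> p x + p y) \<and> (\<forall>a x. p (a *\<^sub>R x) = \<bar>a\<bar> * p x)"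

lemma seminorm_triangle: "seminorm p \<Longrightarrow> p (x + y) \<le> p x + p y"
  by (simp add: seminorm_def)

lemma seminorm_scale: "seminorm p \<Longrightarrow> p (a *\<^sub>R x) = \<bar>a\<bar> * p x"
  by (simp add: seminorm_def)

lemma seminorm_0: "seminorm p \<Longrightarrow> p 0 = 0"
  using seminorm_scale[of p 0 0] by simp

lemma seminorm_minus: "seminorm p \<Longrightarrow> p (- x) = p x"
  using seminorm_scale[of p "- 1" x] by simp

lemma seminorm_nonneg: "seminorm p \<Longrightarrow> 0 \<le> p x"
  using seminorm_triangle[of p x "- x"] by (simp add: seminorm_0 seminorm_minus)

lemma seminorm_diff_le:
  assumes "seminorm p"
  shows "\<bar>p x - p y\<bar> \<le> p (x - y)"
  using seminorm_triangle[OF assms, of "x - y" y] seminorm_triangle[OF assms, of "y - x" x]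
    seminorm_minus[OF assms, of "x - y"] by simp

lemma seminorm_convex: "seminorm p \<Longrightarrow> convex_on UNIV p"
  by (rule convex_onI) (auto intro: order_trans[OF seminorm_triangle] simp: seminorm_scale)

lemma seminorm_linear: "seminorm p \<Longrightarrow> linear Q \<Longrightarrow> seminorm (\<lambda>x. p (Q x))"
  by (simp add: seminorm_def linear_add linear_scale)

definition is_lipschitz :: "('a::real_normed_vector \<Rightarrow> real) \<Rightarrow> bool" where
  "is_lipschitz f \<longleftrightarrow> (\<exists>L. \<forall>x y. \<bar>f x - f y\<bar> \<le> L * norm (x - y))"

lemma is_lipschitz_add: "is_lipschitz f \<Longrightarrow> is_lipschitz g \<Longrightarrow> is_lipschitz (\<lambda>x. f x + g x)"
  unfolding is_lipschitz_def
proof (elim exE)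
  fix K L assume "\<forall>x y. \<bar>f x - f y\<bar> \<le> K * norm (x - y)" "\<forall>x y. \<bar>g x - g y\<bar> \<le> L * norm (x - y)"
  then have "\<bar>f x + g x - (f y + g y)\<bar> \<le> (K + L) * norm (x - y)" for x y
    unfolding distrib_right by (smt (verit))
  then show "\<exists>L. \<forall>x y. \<bar>f x + g x - (f y + g y)\<bar> \<le> L * norm (x - y)" by blast
qed

lemma is_lipschitz_const: "is_lipschitz (\<lambda>x. c)"
  unfolding is_lipschitz_def by (intro exI[of _ 0]) auto

lemma is_lipschitz_cmult: "is_lipschitz f \<Longrightarrow> is_lipschitz (\<lambda>x. c * f x)"
  unfolding is_lipschitz_def
proof (elim exE)
  fix K assume "\<forall>x y. \<bar>f x - f y\<bar> \<le> K * norm (x - y)"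
  then have "\<bar>c * f x - c * f y\<bar> \<le> (\<bar>c\<bar> * K) * norm (x - y)" for x y
    by (simp add: mult.assoc mult_left_mono abs_mult flip: right_diff_distrib)
  then show "\<exists>L. \<forall>x y. \<bar>c * f x - c * f y\<bar> \<le> L * norm (x - y)" by blast
qed

lemma is_lipschitz_sum: "(\<And>i. i \<in> I \<Longrightarrow> is_lipschitz (f i)) \<Longrightarrow> is_lipschitz (\<lambda>x. \<Sum>i\<in>I. f i x)"
  by (induction I rule: infinite_finite_induct) (auto intro: is_lipschitz_add is_lipschitz_const)

lemma is_lipschitz_seminorm:
  assumes "seminorm p" "\<And>x. p x \<le> C * norm x"
  shows "is_lipschitz p"
  unfolding is_lipschitz_def using seminorm_diff_le[OF assms(1)] assms(2) order_trans by blast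

lemma is_lipschitz_continuous: "is_lipschitz f \<Longrightarrow> continuous_on S f"
proof -
  assume "is_lipschitz f"
  then obtain L where L: "\<forall>x y. \<bar>f x - f y\<bar> \<le> L * norm (x - y)" unfolding is_lipschitz_def by blast
  have "\<bar>f x - f y\<bar> \<le> \<bar>L\<bar> * norm (x - y)" for x y
    using L[rule_format, of x y] mult_right_mono[OF abs_ge_self[of L] norm_ge_zero[of "x - y"]] by linarith
  then have "\<bar>L\<bar>-lipschitz_on UNIV f" by (intro lipschitz_onI) (auto simp: dist_norm)
  from lipschitz_on_continuous_on[OF this] show ?thesis by (rule continuous_on_subset) auto
qed

lemma is_lipschitz_ramp:
  assumes "is_lipschitz f"
  shows "is_lipschitz (\<lambda>x. ramp (f x - d))"
proof -
  obtain L where "\<forall>x y. \<bar>f x - f y\<bar> \<le> L * norm (x - y)" using assms unfolding is_lipschitz_def by blast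
  then have "\<bar>ramp (f x - d) - ramp (f y - d)\<bar> \<le> L * norm (x - y)" for x y
    using ramp_lipschitz[of "f x - d" "f y - d"] by (smt (verit))
  then show ?thesis unfolding is_lipschitz_def by blast
qed

lemma equivalent_norm_onI:
  fixes p :: "'a::real_normed_vector \<Rightarrow> real"
  assumes p: "seminorm p" and "\<exists>c>0. \<forall>x. c * norm x \<le> p x" "\<exists>C>0. \<forall>x. p x \<le> C * norm x"
  shows "equivalent_norm_on UNIV p"
proof -
  obtain c where c: "c > 0" "\<forall>x. c * norm x \<le> p x" using assms(2) by blast
  have "p x = 0 \<longleftrightarrow> x = 0" for x
  proof
    assume "p x = 0"
    then have "c * norm x \<le> 0" using c(2) by metis
    then show "x = 0" using c(1) by (simp add: mult_le_0_iff)
  qed (simp add: seminorm_0[OF p])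
  then have "norm_on UNIV p"
    using seminorm_nonneg[OF p] p by (auto simp: norm_on_def seminorm_def)
  then show ?thesis unfolding equivalent_norm_on_def using c assms(3) by blast
qed

lemma equivalent_norm_on_UNIV_D:
  assumes "equivalent_norm_on UNIV p"
  shows "seminorm p" "x \<noteq> 0 \<Longrightarrow> 0 < p x"
  using assms by (auto simp: equivalent_norm_on_def norm_on_def seminorm_def less_le)

lemma seminorm_sum_le:
  assumes "seminorm p"
  shows "p (\<Sum>i\<in>I. f i) \<le> (\<Sum>i\<in>I. p (f i))"
proof (induction I rule: infinite_finite_induct)
  case (insert i I)
  then show ?case using seminorm_triangle[OF assms, of "f i" "\<Sum>i\<in>I. f i"] by simp
qed (simp_all add: seminorm_0[OF assms])

section \<open>Gauges of locally finite sums\<close>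

definition minkowski_gauge :: "'a::real_vector set \<Rightarrow> 'a \<Rightarrow> real" where
  "minkowski_gauge A x = Inf {t. 0 < t \<and> x /\<^sub>R t \<in> A}"

definition joint_sublevel :: "'j set \<Rightarrow> ('j \<Rightarrow> 'a \<Rightarrow> real) \<Rightarrow> 'a set" where
  "joint_sublevel I g = {x. \<forall>J. finite J \<longrightarrow> J \<subseteq> I \<longrightarrow> (\<Sum>i\<in>J. g i x) \<le> 1}"

text \<open>
  The unit ball \<open>K\<close> is the set where the sum of all \<open>g i\<close> is at most \<open>1\<close>, expressed by finite partial
  sums so that no value \<open>\<infinity>\<close> is needed.  Near a point of \<open>K\<close> only finitely many terms are
  nonzero, hence near the unit sphere the gauge \<open>M\<close> is determined by a finite sum.
\<close>

locale locally_finite_gauge =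
  fixes I :: "'j set" and g :: "'j \<Rightarrow> 'a::real_normed_vector \<Rightarrow> real"
  assumes convex: "\<And>i. i \<in> I \<Longrightarrow> convex_on UNIV (g i)"
    and even: "\<And>i x. i \<in> I \<Longrightarrow> g i (- x) = g i x"
    and nonneg: "\<And>i x. i \<in> I \<Longrightarrow> 0 \<le> g i x"
    and zero: "\<And>i. i \<in> I \<Longrightarrow> g i 0 = 0"
    and lipschitz: "\<And>i. i \<in> I \<Longrightarrow> is_lipschitz (g i)"
    and locally_finite: "\<And>x. x \<in> joint_sublevel I g \<Longrightarrow>
      \<exists>V J. open V \<and> x \<in> V \<and> finite J \<and> J \<subseteq> I \<and> (\<forall>i\<in>I - J. \<forall>y\<in>V. g i y = 0)"
    and bounded: "\<exists>R. \<forall>x\<in>joint_sublevel I g. norm x \<le> R"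
begin

abbreviation "K \<equiv> joint_sublevel I g"
abbreviation "M \<equiv> minkowski_gauge K"

lemma sum_lipschitz: "J \<subseteq> I \<Longrightarrow> is_lipschitz (\<lambda>x. \<Sum>i\<in>J. g i x)"
  using lipschitz by (intro is_lipschitz_sum) blast

lemma sum_continuous: "J \<subseteq> I \<Longrightarrow> isCont (\<lambda>x. \<Sum>i\<in>J. g i x) x"
  using is_lipschitz_continuous[OF sum_lipschitz, of J UNIV] by (simp add: continuous_on_eq_continuous_at)

lemma sum_convex: "finite J \<Longrightarrow> J \<subseteq> I \<Longrightarrow> convex_on UNIV (\<lambda>x. \<Sum>i\<in>J. g i x)"
  by (induction J rule: finite_induct) (auto intro: convex_on_add convex simp: convex_on_const)

lemma sum_zero: "J \<subseteq> I \<Longrightarrow> (\<Sum>i\<in>J. g i 0) = 0"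
  using zero by (simp add: subset_iff)

lemma sum_scale_le:
  assumes "finite J" "J \<subseteq> I" "0 \<le> s" "s \<le> 1"
  shows "(\<Sum>i\<in>J. g i (s *\<^sub>R x)) \<le> s * (\<Sum>i\<in>J. g i x)"
  using convex_onD[OF sum_convex[OF assms(1,2)], of s 0 x] assms sum_zero[OF assms(2)] by simp

lemma convex_body: "convex K"
proof (rule convexI)
  fix x y and u v :: real assume xy: "x \<in> K" "y \<in> K" and uv: "0 \<le> u" "0 \<le> v" "u + v = 1"
  have "(\<Sum>i\<in>J. g i (u *\<^sub>R x + v *\<^sub>R y)) \<le> 1" if J: "finite J" "J \<subseteq> I" for J
  proof -
    have "(\<Sum>i\<in>J. g i (u *\<^sub>R x + v *\<^sub>R y)) \<le> u * (\<Sum>i\<in>J. g i x) + v * (\<Sum>i\<in>J. g i y)"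
      using sum_convex[OF J] uv unfolding convex_on_def by simp
    also have "\<dots> \<le> u * 1 + v * 1"
      using xy J uv by (intro add_mono mult_left_mono) (auto simp: joint_sublevel_def)
    finally show ?thesis using uv by simp
  qed
  then show "u *\<^sub>R x + v *\<^sub>R y \<in> K" by (auto simp: joint_sublevel_def)
qed

lemma zero_in_body: "0 \<in> K"
  by (simp add: joint_sublevel_def sum_zero)

lemma scale_body: "x \<in> K \<Longrightarrow> 0 \<le> s \<Longrightarrow> s \<le> 1 \<Longrightarrow> s *\<^sub>R x \<in> K"
  using convexD[OF convex_body _ zero_in_body, of x s "1 - s"] by simp

lemma uminus_body: "x \<in> K \<Longrightarrow> - x \<in> K"
  using even by (simp add: joint_sublevel_def subset_iff)

text \<open>
  Where only the terms with index in \<open>J\<close> are nonzero, the partial sum over \<open>J\<close> dominates all others.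
\<close>

lemma body_local:
  assumes "finite J" "J \<subseteq> I" "\<forall>i\<in>I - J. g i y = 0" "(\<Sum>i\<in>J. g i y) \<le> 1"
  shows "y \<in> K"
  unfolding joint_sublevel_def
proof (intro CollectI allI impI)
  fix J' assume J': "finite J'" "J' \<subseteq> I"
  have "(\<Sum>i\<in>J'. g i y) = (\<Sum>i\<in>J' \<inter> J. g i y)"
    using J' assms by (intro sum.mono_neutral_right) auto
  also have "\<dots> \<le> (\<Sum>i\<in>J. g i y)" using assms nonneg by (intro sum_mono2) auto
  finally show "(\<Sum>i\<in>J'. g i y) \<le> 1" using assms(4) by simp
qed

lemma body_contains_ball: "\<exists>r>0. \<forall>x. norm x \<le> r \<longrightarrow> x \<in> K"
proof -
  obtain V J where V: "open V" "0 \<in> V" "finite J" "J \<subseteq> I" "\<forall>i\<in>I - J. \<forall>y\<in>V. g i y = 0"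
    using locally_finite[OF zero_in_body] by blast
  have "((\<lambda>x. \<Sum>i\<in>J. g i x) \<longlongrightarrow> 0) (at 0)"
    using sum_continuous[OF V(4), of 0] sum_zero[OF V(4)] by (simp add: isCont_def)
  then have "\<forall>\<^sub>F x in at 0. (\<Sum>i\<in>J. g i x) < 1"
    by (rule order_tendstoD(2)) simp
  then obtain d where d: "d > 0" "\<forall>x. x \<noteq> 0 \<and> dist x 0 < d \<longrightarrow> (\<Sum>i\<in>J. g i x) < 1"
    unfolding eventually_at by blast
  obtain d' where d': "d' > 0" "ball 0 d' \<subseteq> V" using V open_contains_ball by blast
  have "x \<in> K" if "norm x \<le> min d d' / 2" for x
  proof (cases "x = 0")
    case False
    then have "x \<in> V" "(\<Sum>i\<in>J. g i x) \<le> 1" using d d' that by (auto simp: dist_norm less_imp_le subset_iff)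
    then show ?thesis using V by (intro body_local[OF V(3,4)]) auto
  qed (use zero_in_body in simp)
  then show ?thesis using d(1) d'(1) by (intro exI[of _ "min d d' / 2"]) auto
qed

lemma bdd_gauge: "bdd_below {t. 0 < t \<and> x /\<^sub>R t \<in> A}"
  by (rule bdd_belowI[of _ 0]) auto

lemma gauge_le: "0 < t \<Longrightarrow> x /\<^sub>R t \<in> K \<Longrightarrow> M x \<le> t"
  unfolding minkowski_gauge_def by (rule cInf_lower[OF _ bdd_gauge]) simp

lemma gauge_nonempty: "\<exists>t>0. x /\<^sub>R t \<in> K"
proof -
  obtain r where r: "r > 0" "\<forall>x. norm x \<le> r \<longrightarrow> x \<in> K" using body_contains_ball by blast
  have pos: "0 < norm x + 1" by (simp add: add_nonneg_pos)
  have "norm (x /\<^sub>R ((norm x + 1) / r)) = r * norm x / (norm x + 1)" using r(1) pos by (simp add: divide_simps)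
  also have "\<dots> \<le> r" unfolding pos_divide_le_eq[OF pos] using r(1) by simp
  finally have "norm (x /\<^sub>R ((norm x + 1) / r)) \<le> r" .
  then show ?thesis using r pos by (intro exI[of _ "(norm x + 1) / r"]) (auto intro!: divide_pos_pos)
qed

lemma gauge_nonneg: "0 \<le> M x"
  unfolding minkowski_gauge_def by (rule cInf_greatest) (use gauge_nonempty in auto)

lemma gauge_less: 
  assumes "M x < t"
  shows "x /\<^sub>R t \<in> K"
proof -
  have "{t. 0 < t \<and> x /\<^sub>R t \<in> K} \<noteq> {}" using gauge_nonempty by blast
  from cInf_lessD[OF this] assms obtain s where s: "0 < s" "x /\<^sub>R s \<in> K" "s < t"
    unfolding minkowski_gauge_def by blast
  have "(s / t) *\<^sub>R (x /\<^sub>R s) \<in> K" by (rule scale_body[OF s(2)]) (use s in auto)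
  then show ?thesis using s by (simp add: field_simps)
qed

lemma gauge_upper: "\<exists>C>0. \<forall>x. M x \<le> C * norm x"
proof -
  obtain r where r: "r > 0" "\<forall>x. norm x \<le> r \<longrightarrow> x \<in> K" using body_contains_ball by blast
  have "M x \<le> (1 / r) * norm x" for x
  proof (cases "x = 0")
    case True
    have "M 0 \<le> e" if "e > 0" for e using zero_in_body that by (intro gauge_le) auto
    then have "M 0 \<le> 0" using field_le_epsilon[of "M 0" 0] by simp
    then show ?thesis using True by simp
  next
    case False
    then show ?thesis using r by (intro gauge_le) auto
  qed
  then show ?thesis using r(1) by (intro exI[of _ "1 / r"]) auto
qed

lemma gauge_lower: "\<exists>c>0. \<forall>x. c * norm x \<le> M x"
proof -
  obtain R where R: "\<forall>x\<in>K. norm x \<le> R" using bounded by blast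
  define R' where "R' = max R 1"
  have R': "R' > 0" "\<forall>x\<in>K. norm x \<le> R'" using R by (auto simp: R'_def intro: le_max_iff_disj[THEN iffD2])
  have "norm x / R' \<le> M x" for x unfolding minkowski_gauge_def
  proof (rule cInf_greatest)
    show "{t. 0 < t \<and> x /\<^sub>R t \<in> K} \<noteq> {}" using gauge_nonempty by blast
    fix t assume "t \<in> {t. 0 < t \<and> x /\<^sub>R t \<in> K}"
    then have t: "0 < t" "norm (x /\<^sub>R t) \<le> R'" using R' by auto
    then show "norm x / R' \<le> t" using R'(1) by (simp add: field_simps)
  qed
  then show ?thesis using R'(1) by (intro exI[of _ "1 / R'"]) auto
qed

lemma gauge_zero: "M 0 = 0"
proof -
  obtain C where "\<forall>x. M x \<le> C * norm x" using gauge_upper by blast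
  then have "M 0 \<le> C * norm (0 :: 'a)" by blast
  then show ?thesis using gauge_nonneg[of 0] by simp
qed

lemma gauge_scale: "M (a *\<^sub>R x) = \<bar>a\<bar> * M x"
proof -
  have le: "M (a *\<^sub>R x) \<le> \<bar>a\<bar> * M x" if a: "a \<noteq> 0" for a x
  proof (rule field_le_epsilon)
    fix e :: real assume e: "e > 0"
    define t where "t = M x + e / \<bar>a\<bar>"
    have t: "M x < t" "0 < t" using e a gauge_nonneg[of x] by (auto simp: t_def add_nonneg_pos)
    have "x /\<^sub>R t \<in> K" by (rule gauge_less[OF t(1)])
    then have "(a *\<^sub>R x) /\<^sub>R (\<bar>a\<bar> * t) \<in> K" using a t uminus_body[of "x /\<^sub>R t"]
      by (cases "a > 0") (simp_all add: field_simps)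
    then have "M (a *\<^sub>R x) \<le> \<bar>a\<bar> * t" using a t by (intro gauge_le) auto
    then show "M (a *\<^sub>R x) \<le> \<bar>a\<bar> * M x + e" using a by (simp add: t_def distrib_left)
  qed
  show ?thesis
  proof (cases "a = 0")
    case False
    have "M x = M (inverse a *\<^sub>R (a *\<^sub>R x))" using False by simp
    also have "\<dots> \<le> \<bar>inverse a\<bar> * M (a *\<^sub>R x)" using False by (intro le) auto
    finally have "\<bar>a\<bar> * M x \<le> M (a *\<^sub>R x)" using False by (simp add: field_simps)
    then show ?thesis using le[OF False, of x] by simp
  qed (simp add: gauge_zero)
qed

lemma gauge_triangle: "M (x + y) \<le> M x + M y"
proof (rule field_le_epsilon)
  fix e :: real assume e: "e > 0"
  define t u where "t = M x + e / 2" and "u = M y + e / 2"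
  have t: "M x < t" "0 < t" "M y < u" "0 < u" using e gauge_nonneg[of x] gauge_nonneg[of y]
    by (auto simp: t_def u_def)
  have "(t / (t + u)) *\<^sub>R (x /\<^sub>R t) + (u / (t + u)) *\<^sub>R (y /\<^sub>R u) \<in> K"
  proof (rule convexD[OF convex_body gauge_less[OF t(1)] gauge_less[OF t(3)]])
    show "t / (t + u) + u / (t + u) = 1" using t by (simp flip: add_divide_distrib)
  qed (use t in auto)
  also have "(t / (t + u)) *\<^sub>R (x /\<^sub>R t) + (u / (t + u)) *\<^sub>R (y /\<^sub>R u) = (x + y) /\<^sub>R (t + u)"
  proof -
    have "t / (t + u) * inverse t = inverse (t + u)" "u / (t + u) * inverse u = inverse (t + u)"
      using t by (simp_all add: divide_inverse)
    then show ?thesis by (simp add: scaleR_add_right)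
  qed
  finally have "M (x + y) \<le> t + u" using t by (intro gauge_le) auto
  then show "M (x + y) \<le> M x + M y + e" by (simp add: t_def u_def)
qed

lemma gauge_seminorm: "seminorm M"
  by (simp add: seminorm_def gauge_triangle gauge_scale)

lemma gauge_equivalent_norm: "equivalent_norm_on UNIV M"
  by (rule equivalent_norm_onI[OF gauge_seminorm gauge_lower gauge_upper])

lemmas gauge_pos = equivalent_norm_on_UNIV_D(2)[OF gauge_equivalent_norm]

lemma gauge_lipschitz: "is_lipschitz M"
  using gauge_upper is_lipschitz_seminorm[OF gauge_seminorm] by blast

lemma gauge_normalize: "x \<noteq> 0 \<Longrightarrow> M (x /\<^sub>R M x) = 1"
  using gauge_scale[of "inverse (M x)" x] gauge_pos[of x] by simp

text \<open>
  The infimum defining the gauge is attained, since the partial sums are continuous.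
\<close>

lemma unit_in_body:
  assumes "M x \<le> 1"
  shows "x \<in> K"
  unfolding joint_sublevel_def
proof (intro CollectI allI impI)
  fix J assume J: "finite J" "J \<subseteq> I"
  have "((\<lambda>t. x /\<^sub>R t) \<longlongrightarrow> x /\<^sub>R 1) (at_right 1)" by (intro tendsto_intros) auto
  then have "((\<lambda>t. x /\<^sub>R t) \<longlongrightarrow> x) (at_right 1)" by simp
  from isCont_tendsto_compose[OF sum_continuous[OF J(2)] this]
  have "((\<lambda>t. \<Sum>i\<in>J. g i (x /\<^sub>R t)) \<longlongrightarrow> (\<Sum>i\<in>J. g i x)) (at_right 1)" .
  moreover have "\<forall>\<^sub>F t in at_right 1. (\<Sum>i\<in>J. g i (x /\<^sub>R t)) \<le> 1"
    unfolding eventually_at_right_field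
    using gauge_less assms J by (intro exI[of _ 2]) (force simp: joint_sublevel_def)
  ultimately show "(\<Sum>i\<in>J. g i x) \<le> 1"
    by (intro tendsto_upperbound) auto
qed

text \<open>
  If the finite sum were smaller than \<open>1\<close>, it would remain so slightly further out along the ray
  through \<open>x\<close>, and the gauge of \<open>x\<close> would be smaller than \<open>1\<close>.
\<close>

lemma sum_eq_1_on_unit_sphere:
  assumes x: "M x = 1" and V: "open V" "x \<in> V" "finite J" "J \<subseteq> I" "\<forall>i\<in>I - J. \<forall>y\<in>V. g i y = 0"
  shows "(\<Sum>i\<in>J. g i x) = 1"
proof (rule ccontr)
  assume "(\<Sum>i\<in>J. g i x) \<noteq> 1"
  moreover have "(\<Sum>i\<in>J. g i x) \<le> 1" using unit_in_body[of x] x V(3,4) by (simp add: joint_sublevel_def)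
  ultimately have lt: "(\<Sum>i\<in>J. g i x) < 1" by simp
  have lim: "((\<lambda>t. t *\<^sub>R x) \<longlongrightarrow> 1 *\<^sub>R x) (at_right (1::real))" by (intro tendsto_intros)
  then have lim: "((\<lambda>t. t *\<^sub>R x) \<longlongrightarrow> x) (at_right (1::real))" by simp
  have "\<forall>\<^sub>F t in at_right 1. (\<Sum>i\<in>J. g i (t *\<^sub>R x)) < 1"
    using isCont_tendsto_compose[OF sum_continuous[OF V(4)] lim] lt by (rule order_tendstoD(2))
  moreover have "\<forall>\<^sub>F t in at_right (1::real). t *\<^sub>R x \<in> V" using lim V(1,2) by (rule topological_tendstoD)
  moreover have "\<forall>\<^sub>F t in at_right (1::real). 1 < t" by (simp add: eventually_at_right_less)
  ultimately have "\<forall>\<^sub>F t in at_right (1::real). False"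
  proof eventually_elim
    case (elim t)
    have "t *\<^sub>R x \<in> K" by (rule body_local[OF V(3,4)]) (use elim V(5) in auto)
    then have "M (t *\<^sub>R x) \<le> 1" by (intro gauge_le) auto
    then show False using elim x by (simp add: gauge_scale)
  qed
  then show False by simp
qed

text \<open>
  Near a given point \<open>M\<close> satisfies \<open>H (y, M y) = 1\<close>, where \<open>H (y, t)\<close> is a finite sum of terms
  \<open>g i (y / t)\<close>.  Along a ray this sum is convex and vanishes at the origin, so it grows at least
  linearly: its derivative in \<open>t\<close> at \<open>t = M y\<close> is at most \<open>- 1 / M y\<close>, and the implicit function
  theorem applies.
\<close>

lemma gauge_smooth:
  assumes C: "\<And>i. i \<in> I \<Longrightarrow> equi_C (Suc n) (UNIV \<times> {0<..}) {\<lambda>p. g i (fst p /\<^sub>R snd p)}"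
  shows "equi_C (Suc n) (- {0}) {M}"
proof (rule equi_C_local)
  fix x assume "x \<in> - {0 :: 'a}"
  then have x: "x \<noteq> 0" by simp
  obtain L where L: "\<forall>x y. \<bar>M x - M y\<bar> \<le> L * norm (x - y)"
    using gauge_lipschitz unfolding is_lipschitz_def by blast
  have contM: "continuous_on UNIV M" by (rule is_lipschitz_continuous[OF gauge_lipschitz])
  have "x /\<^sub>R M x \<in> K" by (intro unit_in_body) (simp add: gauge_normalize[OF x])
  from locally_finite[OF this] obtain V J where V: "open V" "x /\<^sub>R M x \<in> V" "finite J" "J \<subseteq> I"
      "\<forall>i\<in>I - J. \<forall>y\<in>V. g i y = 0"
    by blast
  define U where "U = (- {0}) \<inter> (\<lambda>x. x /\<^sub>R M x) -` V"
  have "continuous_on (- {0}) (\<lambda>x. x /\<^sub>R M x)"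
    using gauge_pos gauge_nonneg by (intro continuous_intros continuous_on_subset[OF contM]) (simp, fastforce)
  then have U: "open U" unfolding U_def by (rule continuous_open_preimage) (use V in auto)
  define H where "H = (\<lambda>p. \<Sum>i\<in>J. g i (fst p /\<^sub>R snd p))"
  have HC: "equi_C (Suc n) (UNIV \<times> {0<..}) {H}" unfolding H_def
    by (rule equi_C_single_sum) (use C V in \<open>auto intro: open_Times\<close>)
  have H1: "H (y, M y) = 1" if "y \<in> U" for y
    using that sum_eq_1_on_unit_sphere[OF gauge_normalize V(1) _ V(3-5), of y] by (simp add: H_def U_def)
  have "equi_C (Suc n) U {M}"
  proof (rule equi_C_implicit[OF U _ HC H1])
    show "(y, M y) \<in> UNIV \<times> {0<..}" if "y \<in> U" for y using that gauge_pos by (simp add: U_def)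
    show "\<exists>K d. d > 0 \<and> (\<forall>z. norm (z - y) < d \<longrightarrow> \<bar>M z - M y\<bar> \<le> K * norm (z - y))" for y
      using L by (intro exI[of _ L] exI[of _ 1]) auto
    show "frechet_derivative H (at (y, M y)) (0, 1) \<noteq> 0" if y: "y \<in> U" for y
    proof
      assume D0: "frechet_derivative H (at (y, M y)) (0, 1) = 0"
      have y0: "y \<noteq> 0" using y by (simp add: U_def)
      define m where "m = M y"
      have m: "m > 0" using gauge_pos[OF y0] by (simp add: m_def)
      define D where "D = frechet_derivative H (at (y, m))"
      have HD: "(H has_derivative D) (at (y, m))" unfolding D_def
        by (rule equi_C_SucD(1)[OF HC]) (use m in auto)
      have pd: "((\<lambda>t. (y, t)) has_derivative (\<lambda>h. (0, h))) (at m)" by (auto intro!: derivative_eq_intros)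
      have "((\<lambda>t. H (y, t)) has_derivative (\<lambda>h. D (0, h))) (at m)"
        by (rule has_derivative_compose[OF pd HD])
      moreover have "D (0, h) = 0" for h
      proof -
        have "(0, h) = h *\<^sub>R (0 :: 'a, 1 :: real)" by simp
        then show ?thesis using D0 linear_scale[OF has_derivative_linear[OF HD], of h "(0, 1)"] by (simp add: D_def m_def)
      qed
      ultimately have "((\<lambda>t. H (y, t)) has_derivative (\<lambda>h. 0)) (at m)" by simp
      moreover have "1 / (2 * m) > 0" using m by simp
      ultimately obtain d where d: "d > 0"
          "\<forall>t. norm (t - m) < d \<longrightarrow> norm (H (y, t) - H (y, m) - 0) \<le> (1 / (2 * m)) * norm (t - m)"
        unfolding has_derivative_at_alt by blast
      \<comment> \<open>A point slightly below \<open>m\<close>, where \<open>H\<close> exceeds \<open>1\<close> by more than a vanishing derivative allows.\<close>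
      define t where "t = m - min (d / 2) (m / 2)"
      have t: "0 < t" "t < m" "norm (t - m) < d" using d(1) m by (auto simp: t_def min_def)
      have "H (y, m) \<le> (t / m) * H (y, t)"
      proof -
        have eq: "y /\<^sub>R m = (t / m) *\<^sub>R (y /\<^sub>R t)" using t by (simp add: divide_inverse)
        show ?thesis unfolding H_def fst_conv snd_conv eq
          by (rule sum_scale_le[OF V(3,4)]) (use t m in auto)
      qed
      then have "m \<le> t * H (y, t)" using H1[OF y] m by (simp add: m_def[symmetric] field_simps)
      moreover have "H (y, t) - 1 \<le> (m - t) / (2 * m)"
        using d(2)[rule_format, OF t(3)] H1[OF y] t by (simp add: m_def[symmetric] abs_le_iff)
      then have "t * H (y, t) \<le> t * (1 + (m - t) / (2 * m))" using t by (intro mult_left_mono) auto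
      ultimately have "m - t \<le> t * ((m - t) / (2 * m))" by (simp add: algebra_simps)
      also have "\<dots> \<le> m * ((m - t) / (2 * m))" using t m by (intro mult_right_mono) auto
      also have "\<dots> = (m - t) / 2" using m by simp
      finally show False using t by simp
    qed
  qed
  then show "\<exists>V T. open V \<and> x \<in> V \<and> equi_C (Suc n) V T \<and> (\<forall>f\<in>{M}. \<exists>g\<in>T. \<forall>y\<in>V. f y = g y)"
    using U V(2) x by (intro exI[of _ U] exI[of _ "{M}"]) (auto simp: U_def)
qed

text \<open>
  Only a neighbourhood of \<open>x\<close> is controlled by a finite sum, and the points \<open>xs r\<close> need not lie in
  it.  But the hypothesis implies that \<open>M\<close> tends to \<open>1\<close> at every point dividing the segment from \<open>x\<close>
  to \<open>xs r\<close> in a fixed ratio; dividing points close enough to \<open>x\<close> lie in the neighbourhood.  There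
  the finite sum tends to \<open>1\<close>, while the partial sums at both end points are at most \<open>1\<close>.
\<close>

lemma gauge_gap:
  assumes x: "M x = 1" and xs: "\<And>r. M (xs r) = 1" and lim: "(\<lambda>r. M (xs r + x)) \<longlonglongrightarrow> 2"
  shows "\<exists>s. 0 < s \<and> s \<le> 1 / 2 \<and> (\<forall>i\<in>I. (\<lambda>r. gap s (g i) x (xs r)) \<longlonglongrightarrow> 0)"
proof -
  have xK: "x \<in> K" "\<And>r. xs r \<in> K" using unit_in_body x xs by auto
  obtain V J where V: "open V" "x \<in> V" "finite J" "J \<subseteq> I" "\<forall>i\<in>I - J. \<forall>y\<in>V. g i y = 0"
    using locally_finite[OF xK(1)] by blast
  obtain d where d: "d > 0" "ball x d \<subseteq> V" using V open_contains_ball by blast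
  obtain R where R: "\<forall>x\<in>K. norm x \<le> R" using bounded by blast
  have R0: "R \<ge> 0" using R xK(1) norm_ge_zero order_trans by blast
  define q where "q = 2 * R + 1"
  have q: "q > 0" using R0 by (simp add: q_def)
  define s where "s = min (1 / 2) (d / (2 * q))"
  have "s \<le> d / (2 * q)" unfolding s_def by (rule min.cobounded2)
  from mult_right_mono[OF this, of q] have "s * q \<le> d / 2" using q by simp
  moreover have "s \<le> 1 / 2" unfolding s_def by (rule min.cobounded1)
  moreover have "0 < s" using d(1) q by (simp add: s_def)
  ultimately have s: "0 < s" "s \<le> 1 / 2" "s * (2 * R + 1) \<le> d / 2" by (simp_all add: q_def)
  define y where "y = (\<lambda>r. (1 - s) *\<^sub>R x + s *\<^sub>R xs r)"
  have yx: "norm (y r - x) \<le> d / 2" for r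
  proof -
    have "y r - x = s *\<^sub>R (xs r - x)" by (simp add: y_def algebra_simps)
    then have "norm (y r - x) = s * norm (xs r - x)" using s by simp
    also have "\<dots> \<le> s * (2 * R + 1)"
      using norm_triangle_ineq4[of "xs r" x] R xK s by (intro mult_left_mono) (smt (verit), simp)
    finally show ?thesis using s(3) by simp
  qed
  have yK: "y r \<in> K" for r unfolding y_def using xK s by (intro convexD[OF convex_body]) auto
  have My1: "M (y r) \<le> 1" for r using gauge_le[of 1 "y r"] yK by simp
  have My: "(\<lambda>r. M (y r)) \<longlonglongrightarrow> 1"
  proof (rule tendsto_sandwich)
    \<comment> \<open>The midpoint of \<open>x\<close> and \<open>xs r\<close> is the combination of \<open>y r\<close> and \<open>xs r\<close> with weights \<open>c\<close> and \<open>1 - c\<close>.\<close>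
    define c where "c = 1 / (2 * (1 - s))"
    have c: "0 < c" "c \<le> 1" "c * (1 - s) = 1 / 2" using s by (auto simp: c_def field_simps)
    have "M (xs r + x) / 2 \<le> c * M (y r) + (1 - c)" for r
    proof -
      have "(1 / 2) *\<^sub>R (xs r + x) = c *\<^sub>R y r + (1 - c) *\<^sub>R xs r"
      proof -
        have "c *\<^sub>R y r + (1 - c) *\<^sub>R xs r = (c * (1 - s)) *\<^sub>R x + (1 - c * (1 - s)) *\<^sub>R xs r"
          by (simp add: y_def algebra_simps)
        then show ?thesis unfolding c(3) by (simp add: algebra_simps)
      qed
      then have "M ((1 / 2) *\<^sub>R (xs r + x)) \<le> M (c *\<^sub>R y r) + M ((1 - c) *\<^sub>R xs r)" using gauge_triangle by simp
      then show ?thesis using c xs by (simp add: gauge_scale)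
    qed
    then show "\<forall>\<^sub>F r in sequentially. (M (xs r + x) / 2 - (1 - c)) / c \<le> M (y r)"
      using c(1) by (simp add: divide_le_eq algebra_simps)
    have "(\<lambda>r. (M (xs r + x) / 2 - (1 - c)) / c) \<longlonglongrightarrow> (2 / 2 - (1 - c)) / c"
      using c by (intro tendsto_intros lim) auto
    then show "(\<lambda>r. (M (xs r + x) / 2 - (1 - c)) / c) \<longlonglongrightarrow> 1" using c by simp
    show "\<forall>\<^sub>F r in sequentially. M (y r) \<le> 1" using My1 by simp
  qed (rule tendsto_const)
  define z where "z = (\<lambda>r. y r /\<^sub>R M (y r))"
  obtain L where L: "\<forall>x y. \<bar>(\<Sum>i\<in>J. g i x) - (\<Sum>i\<in>J. g i y)\<bar> \<le> L * norm (x - y)"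
    using sum_lipschitz[OF V(4)] unfolding is_lipschitz_def by blast
  have zy: "(\<lambda>r. norm (z r - y r)) \<longlonglongrightarrow> 0"
  proof (rule tendsto_0_le[where f = "\<lambda>r. inverse (M (y r)) - 1" and K = R])
    have "(\<lambda>r. inverse (M (y r)) - 1) \<longlonglongrightarrow> inverse 1 - 1" by (intro tendsto_intros My) auto
    then show "(\<lambda>r. inverse (M (y r)) - 1) \<longlonglongrightarrow> 0" by simp
    have "norm (norm (z r - y r)) \<le> norm (inverse (M (y r)) - 1) * R" for r
    proof -
      have "z r - y r = (inverse (M (y r)) - 1) *\<^sub>R y r" by (simp add: z_def algebra_simps)
      then have "norm (z r - y r) = norm (inverse (M (y r)) - 1) * norm (y r)" by simp
      also have "\<dots> \<le> norm (inverse (M (y r)) - 1) * R" using R yK by (intro mult_left_mono) auto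
      finally show ?thesis by simp
    qed
    then show "\<forall>\<^sub>F r in sequentially. norm (norm (z r - y r)) \<le> norm (inverse (M (y r)) - 1) * R" by simp
  qed
  have Gz: "\<forall>\<^sub>F r in sequentially. (\<Sum>i\<in>J. g i (z r)) = 1"
  proof -
    have "\<forall>\<^sub>F r in sequentially. 0 < M (y r)" by (rule order_tendstoD(1)[OF My]) simp
    moreover have "\<forall>\<^sub>F r in sequentially. norm (z r - y r) < d / 2" by (rule order_tendstoD(2)[OF zy]) (use d in simp)
    ultimately show ?thesis
    proof eventually_elim
      case (elim r)
      have "norm (z r - x) \<le> norm (z r - y r) + norm (y r - x)" using norm_triangle_ineq[of "z r - y r" "y r - x"] by simp
      then have "z r \<in> V" using d(2) elim(2) yx[of r] by (auto simp: dist_norm norm_minus_commute subset_iff)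
      moreover have "M (z r) = 1" unfolding z_def using elim(1) by (simp add: gauge_scale)
      ultimately show ?case by (intro sum_eq_1_on_unit_sphere[OF _ V(1) _ V(3-5)])
    qed
  qed
  have Gy: "(\<lambda>r. 1 - (\<Sum>i\<in>J. g i (y r))) \<longlonglongrightarrow> 0"
  proof (rule Lim_null_comparison)
    show "\<forall>\<^sub>F r in sequentially. norm (1 - (\<Sum>i\<in>J. g i (y r))) \<le> L * norm (z r - y r)"
      using Gz by eventually_elim (use L in \<open>metis real_norm_def\<close>)
    show "(\<lambda>r. L * norm (z r - y r)) \<longlonglongrightarrow> 0" using tendsto_mult_left[OF zy, of L] by simp
  qed
  have "(\<lambda>r. gap s (g i) x (xs r)) \<longlonglongrightarrow> 0" if i: "i \<in> I" for i
  proof (rule tendsto_sandwich[OF _ _ tendsto_const Gy])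
    have gn: "0 \<le> gap s (g j) x (xs r)" if "j \<in> I" for j r
      using s by (intro gap_nonneg convex that) auto
    then show "\<forall>\<^sub>F r in sequentially. 0 \<le> gap s (g i) x (xs r)" using i by simp
    have "gap s (g i) x (xs r) \<le> 1 - (\<Sum>i\<in>J. g i (y r))" for r
    proof -
      let ?J = "insert i J"
      have J: "finite ?J" "?J \<subseteq> I" using V i by auto
      have "gap s (g i) x (xs r) \<le> (\<Sum>j\<in>?J. gap s (g j) x (xs r))"
        using J gn by (intro member_le_sum) auto
      also have "\<dots> = (1 - s) * (\<Sum>j\<in>?J. g j x) + s * (\<Sum>j\<in>?J. g j (xs r)) - (\<Sum>j\<in>?J. g j (y r))"
        by (simp only: gap_def y_def sum_subtractf sum.distrib sum_distrib_left)
      also have "\<dots> \<le> (1 - s) * 1 + s * 1 - (\<Sum>j\<in>J. g j (y r))"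
      proof (intro diff_mono add_mono mult_left_mono)
        show "(\<Sum>j\<in>?J. g j x) \<le> 1" "(\<Sum>j\<in>?J. g j (xs r)) \<le> 1" using xK J by (auto simp: joint_sublevel_def simp del: sum.insert)
        show "(\<Sum>j\<in>J. g j (y r)) \<le> (\<Sum>j\<in>?J. g j (y r))" using J nonneg by (intro sum_mono2) auto
      qed (use s in auto)
      finally show ?thesis by simp
    qed
    then show "\<forall>\<^sub>F r in sequentially. gap s (g i) x (xs r) \<le> 1 - (\<Sum>i\<in>J. g i (y r))" by simp
  qed
  then show ?thesis using s by blast
qed

end

lemma gauge_comparison:
  assumes "locally_finite_gauge I g" "locally_finite_gauge I g'" and a: "0 < a"
    and le: "\<And>i x. i \<in> I \<Longrightarrow> g' i x \<le> g i (a *\<^sub>R x)"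
  shows "minkowski_gauge (joint_sublevel I g') x \<le> a * minkowski_gauge (joint_sublevel I g) x"
proof -
  interpret A: locally_finite_gauge I g by fact
  interpret B: locally_finite_gauge I g' by fact
  show ?thesis
  proof (rule field_le_epsilon)
    fix e :: real assume e: "e > 0"
    define t where "t = A.M x + e / a"
    have t: "A.M x < t" "0 < t" using e a A.gauge_nonneg[of x] by (auto simp: t_def add_nonneg_pos)
    have eq: "a *\<^sub>R (x /\<^sub>R (a * t)) = x /\<^sub>R t" using a by simp
    have *: "a *\<^sub>R (x /\<^sub>R (a * t)) \<in> A.K" unfolding eq by (rule A.gauge_less[OF t(1)])
    have "x /\<^sub>R (a * t) \<in> B.K" unfolding joint_sublevel_def
    proof (intro CollectI allI impI)
      fix J assume J: "finite J" "J \<subseteq> I"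
      have "(\<Sum>i\<in>J. g' i (x /\<^sub>R (a * t))) \<le> (\<Sum>i\<in>J. g i (a *\<^sub>R (x /\<^sub>R (a * t))))"
        using J le by (intro sum_mono) blast
      also have "\<dots> \<le> 1" using * J unfolding joint_sublevel_def by blast
      finally show "(\<Sum>i\<in>J. g' i (x /\<^sub>R (a * t))) \<le> 1" .
    qed
    then have "B.M x \<le> a * t" using a t by (intro B.gauge_le) auto
    then show "B.M x \<le> a * A.M x + e" using a by (simp add: t_def distrib_left)
  qed
qed

section \<open>Level norms\<close>

lemma convex_on_ramp:
  assumes f: "convex_on UNIV f" and c: "0 \<le> c"
  shows "convex_on UNIV (\<lambda>x. c * ramp (f x - d))"
proof -
  have "convex_on UNIV (\<lambda>x. ramp (f x - d))"
  proof (rule convex_onI)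
    fix t :: real and x y assume t: "0 < t" "t < 1"
    have "f ((1 - t) *\<^sub>R x + t *\<^sub>R y) - d \<le> (1 - t) *\<^sub>R (f x - d) + t *\<^sub>R (f y - d)"
      using convex_onD[OF f, of t x y] t by (simp add: algebra_simps)
    then have "ramp (f ((1 - t) *\<^sub>R x + t *\<^sub>R y) - d) \<le> ramp ((1 - t) *\<^sub>R (f x - d) + t *\<^sub>R (f y - d))"
      by (rule ramp_mono)
    also have "\<dots> \<le> (1 - t) * ramp (f x - d) + t * ramp (f y - d)"
      using convex_onD[OF ramp_convex, of t "f x - d" "f y - d"] t by simp
    finally show "ramp (f ((1 - t) *\<^sub>R x + t *\<^sub>R y) - d) \<le> (1 - t) * ramp (f x - d) + t * ramp (f y - d)" .
  qed simp
  then show ?thesis using c by (rule convex_on_cmul[rotated])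
qed

lemma convex_on_finite_sum:
  "(\<And>i. i \<in> I \<Longrightarrow> convex_on UNIV (f i)) \<Longrightarrow> convex_on UNIV (\<lambda>x. \<Sum>i\<in>I. f i x)"
  by (induction I rule: infinite_finite_induct) (auto intro: convex_on_add simp: convex_on_const)

text \<open>
  Where \<open>p\<close> is small relative to \<open>t\<close> the function vanishes identically, so differentiability of \<open>p\<close>
  off its kernel is enough.  The second variable \<open>t\<close> is the one in which the gauge is defined
  implicitly; homogeneity of \<open>p\<close> separates it from the first.
\<close>

lemma equi_C_ramp_seminorm:
  fixes p :: "'a::real_normed_vector \<Rightarrow> real"
  assumes p: "seminorm p" "\<And>x. p x \<le> C * norm x" and C: "equi_C n {x. p x \<noteq> 0} {p}"
    and a: "0 \<le> a" and d: "0 < d"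
  shows "equi_C n (UNIV \<times> {0<..}) {\<lambda>z. ramp (a * p (fst z /\<^sub>R snd z) - d)}"
proof (rule equi_C_local)
  have cont: "continuous_on S (\<lambda>z. p (fst z))" for S :: "('a \<times> real) set"
    by (rule continuous_on_compose2[OF is_lipschitz_continuous[OF is_lipschitz_seminorm[OF p], of UNIV]]) (auto intro: continuous_intros)
  have quot: "p (fst z /\<^sub>R snd z) = p (fst z) * inverse (snd z)" if "0 < snd z" for z
    using that by (simp add: seminorm_scale[OF p(1)])
  fix z :: "'a \<times> real" assume z: "z \<in> UNIV \<times> {0<..}"
  show "\<exists>V T. open V \<and> z \<in> V \<and> equi_C n V T \<and>
      (\<forall>f\<in>{\<lambda>z. ramp (a * p (fst z /\<^sub>R snd z) - d)}. \<exists>g\<in>T. \<forall>y\<in>V. f y = g y)"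
  proof (cases "p (fst z) = 0")
    case True
    define V where "V = {z :: 'a \<times> real. 0 < snd z} \<inter> {z. a * p (fst z) < d * snd z}"
    have V: "open V" unfolding V_def
      by (intro open_Int open_Collect_less continuous_intros cont)
    have "ramp (a * p (fst y /\<^sub>R snd y) - d) = 0" if "y \<in> V" for y
    proof (rule ramp_eq_0)
      have y: "0 < snd y" "a * p (fst y) < d * snd y" using that by (auto simp: V_def)
      have "a * p (fst y /\<^sub>R snd y) = (a * p (fst y)) / snd y" using quot[OF y(1)] by (simp add: divide_inverse)
      also have "\<dots> < d" using y by (simp add: divide_less_eq)
      finally show "a * p (fst y /\<^sub>R snd y) - d \<le> 0" by simp
    qed
    moreover have "z \<in> V" using True z d by (auto simp: V_def)
    ultimately show ?thesis using V equi_C_single_const[OF V, of n 0]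
      by (intro exI[of _ V] exI[of _ "{\<lambda>_. 0}"]) auto
  next
    case False
    define V where "V = {z :: 'a \<times> real. 0 < snd z} \<inter> {z. p (fst z) \<noteq> 0}"
    have V: "open V" unfolding V_def
      by (intro open_Int open_Collect_less open_Collect_neq continuous_intros cont)
    have 1: "equi_C n V {\<lambda>z. p (fst z)}"
      by (rule equi_C_single_linear[OF bounded_linear_fst V _ C]) (auto simp: V_def)
    have 2: "equi_C n V {\<lambda>z. inverse (snd z)}"
      by (rule equi_C_single_linear[OF bounded_linear_snd V _ equi_C_inverse]) (auto simp: V_def)
    have "equi_C n V {\<lambda>z. a * (p (fst z) * inverse (snd z)) + (- d)}"
      by (intro equi_C_single_add equi_C_single_mult equi_C_single_const V 1 2)
    from equi_C_single_compose[OF open_UNIV V equi_C_ramp this UNIV_I]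
    have "equi_C n V {\<lambda>z. ramp (a * (p (fst z) * inverse (snd z)) + (- d))}" .
    moreover have "z \<in> V" using False z by (auto simp: V_def)
    ultimately show ?thesis using V quot
      by (intro exI[of _ V] exI[of _ "{\<lambda>z. ramp (a * (p (fst z) * inverse (snd z)) + (- d))}"]) (auto simp: V_def)
  qed
qed

text \<open>
  The weight makes the second summand of the score below at most \<open>1 / 4\<close> on the set where
  \<open>q x \<le> 2 * \<rho>\<close>: a set of \<open>m\<close> indices has \<open>2 ^ m\<close> subsets \<open>B\<close>, and \<open>\<sigma> B x\<close> is at
  most \<open>(1 + D * m) * (2 * \<rho>)\<close>.
\<close>

definition tail_weight :: "real \<Rightarrow> real \<Rightarrow> nat \<Rightarrow> real" where
  "tail_weight D \<rho> m = 1 / (8 * \<rho> * 2 ^ m * (1 + D * m))"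

text \<open>
  In the application \<open>\<pi> \<gamma>\<close> is a norm of the coordinate \<open>\<gamma>\<close> and \<open>\<sigma> B\<close> a norm of what is left after
  the coordinates from \<open>B\<close> are removed.  Every index in \<open>A\<close> costs \<open>1\<close>, so where
  \<open>q x \<le> 2 * \<rho>\<close> an index with \<open>\<pi> \<gamma> x \<le> 1\<close> lowers the score, whatever its effect on the second
  summand.
\<close>

definition score :: "('i \<Rightarrow> 'a \<Rightarrow> real) \<Rightarrow> ('i set \<Rightarrow> 'a \<Rightarrow> real) \<Rightarrow> real \<Rightarrow> real \<Rightarrow> 'i set \<Rightarrow> 'a \<Rightarrow> real" where
  "score \<pi> \<sigma> D \<rho> A x = (\<Sum>\<gamma>\<in>A. ramp (\<pi> \<gamma> x - 1) - 1) +
     tail_weight D \<rho> (card A) * (\<Sum>B\<in>Pow A. ramp (\<sigma> B x - 1))"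

text \<open>
  The index \<open>None\<close> bounds the unit ball of the gauge; a finite set \<open>A\<close> contributes as soon as its
  score exceeds the level \<open>n\<close>.  The factor \<open>1 / ramp (1 / 2)\<close> is chosen so that a contribution reaches
  the value \<open>1\<close> when its threshold is exceeded by \<open>1 / 2\<close>.
\<close>

definition component ::
    "('i \<Rightarrow> 'a \<Rightarrow> real) \<Rightarrow> ('i set \<Rightarrow> 'a \<Rightarrow> real) \<Rightarrow> ('a \<Rightarrow> real) \<Rightarrow> real \<Rightarrow> nat \<Rightarrow> real \<Rightarrow> 'i set option \<Rightarrow> 'a \<Rightarrow> real" where
  "component \<pi> \<sigma> q D n \<rho> i x = (case i of
      None \<Rightarrow> (1 / ramp (1 / 2)) * ramp ((1 / \<rho>) * q x - 1 / 2)
    | Some A \<Rightarrow> (1 / ramp (1 / 2)) * ramp (score \<pi> \<sigma> D \<rho> A x - n))"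

definition component_index :: "'i set \<Rightarrow> 'i set option set" where
  "component_index \<Lambda> = insert None (Some ` {A. finite A \<and> A \<subseteq> \<Lambda>})"

definition level_norm ::
    "'i set \<Rightarrow> ('i \<Rightarrow> 'a::real_normed_vector \<Rightarrow> real) \<Rightarrow> ('i set \<Rightarrow> 'a \<Rightarrow> real) \<Rightarrow> ('a \<Rightarrow> real) \<Rightarrow> real \<Rightarrow> nat \<Rightarrow> real \<Rightarrow> 'a \<Rightarrow> real" where
  "level_norm \<Lambda> \<pi> \<sigma> q D n \<rho> = minkowski_gauge (joint_sublevel (component_index \<Lambda>) (component \<pi> \<sigma> q D n \<rho>))"

text \<open>
  Abstractly, a vector has coordinates, measured by \<open>\<pi> \<gamma>\<close>, and residuals, measured by \<open>\<sigma> B\<close>; the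
  norm \<open>q\<close> of the space controls the residuals.
\<close>

locale coordinate_system =
  fixes \<Lambda> :: "'i set" and \<pi> :: "'i \<Rightarrow> 'a::real_normed_vector \<Rightarrow> real"
    and \<sigma> :: "'i set \<Rightarrow> 'a \<Rightarrow> real" and q :: "'a \<Rightarrow> real" and C c D :: real
  assumes pi_seminorm: "\<gamma> \<in> \<Lambda> \<Longrightarrow> seminorm (\<pi> \<gamma>)"
    and pi_le: "\<gamma> \<in> \<Lambda> \<Longrightarrow> \<pi> \<gamma> x \<le> C * norm x"
    and sigma_seminorm: "finite B \<Longrightarrow> B \<subseteq> \<Lambda> \<Longrightarrow> seminorm (\<sigma> B)"
    and sigma_le: "finite B \<Longrightarrow> B \<subseteq> \<Lambda> \<Longrightarrow> \<sigma> B x \<le> (1 + D * card B) * q x"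
    and q_seminorm: "seminorm q"
    and q_le: "q x \<le> C * norm x"
    and q_ge: "c * norm x \<le> q x"
    and constants: "0 < C" "0 < c" "0 \<le> D"
    and c0: "0 < \<delta> \<Longrightarrow> finite {\<gamma>\<in>\<Lambda>. \<delta> \<le> \<pi> \<gamma> x}"
begin

lemma sigma_norm_le: "finite B \<Longrightarrow> B \<subseteq> \<Lambda> \<Longrightarrow> \<sigma> B x \<le> ((1 + D * card B) * C) * norm x"
  using sigma_le[of B x] mult_left_mono[OF q_le[of x], of "1 + D * card B"] constants(3)
  by (simp add: mult.assoc)

lemma tail_bounds:
  assumes A: "finite A" "A \<subseteq> \<Lambda>" and \<rho>: "0 < \<rho>"
  shows "0 \<le> tail_weight D \<rho> (card A) * (\<Sum>B\<in>Pow A. ramp (\<sigma> B x - 1))"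
    and "q x \<le> 2 * \<rho> \<Longrightarrow> tail_weight D \<rho> (card A) * (\<Sum>B\<in>Pow A. ramp (\<sigma> B x - 1)) \<le> 1 / 4"
proof -
  define m where "m = card A"
  define E where "E = 1 + D * m"
  have E: "0 < E" using constants(3) by (simp add: E_def add_pos_nonneg)
  have w: "tail_weight D \<rho> m = 1 / (8 * \<rho> * 2 ^ m * E)" by (simp add: tail_weight_def E_def)
  show "0 \<le> tail_weight D \<rho> (card A) * (\<Sum>B\<in>Pow A. ramp (\<sigma> B x - 1))"
    unfolding m_def[symmetric] w using \<rho> E by (intro mult_nonneg_nonneg sum_nonneg ramp_nonneg) auto
  assume q: "q x \<le> 2 * \<rho>"
  have "ramp (\<sigma> B x - 1) \<le> E * (2 * \<rho>)" if "B \<in> Pow A" for B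
  proof -
    have B: "finite B" "B \<subseteq> \<Lambda>" "card B \<le> m"
      using that A by (auto simp: m_def intro: finite_subset card_mono)
    have "\<sigma> B x \<le> (1 + D * card B) * q x" by (rule sigma_le[OF B(1,2)])
    also have "\<dots> \<le> E * (2 * \<rho>)"
      using q B(3) constants(3) seminorm_nonneg[OF q_seminorm, of x] E unfolding E_def
      by (intro mult_mono add_mono mult_left_mono) auto
    finally have "\<sigma> B x \<le> E * (2 * \<rho>)" .
    moreover have "ramp (\<sigma> B x - 1) \<le> \<sigma> B x"
      using ramp_le[of "\<sigma> B x - 1"] ramp_eq_0[of "\<sigma> B x - 1"] seminorm_nonneg[OF sigma_seminorm[OF B(1,2)], of x]
      by (cases "\<sigma> B x \<ge> 1") auto
    ultimately show ?thesis by simp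
  qed
  then have "(\<Sum>B\<in>Pow A. ramp (\<sigma> B x - 1)) \<le> 2 ^ m * (E * (2 * \<rho>))"
    using sum_bounded_above[of "Pow A" "\<lambda>B. ramp (\<sigma> B x - 1)" "E * (2 * \<rho>)"] A(1) by (simp add: card_Pow m_def)
  then have "tail_weight D \<rho> m * (\<Sum>B\<in>Pow A. ramp (\<sigma> B x - 1)) \<le> tail_weight D \<rho> m * (2 ^ m * (E * (2 * \<rho>)))"
    unfolding w using \<rho> E by (intro mult_left_mono) auto
  also have "\<dots> = 1 / 4" unfolding w using \<rho> E by (simp add: field_simps)
  finally show "tail_weight D \<rho> (card A) * (\<Sum>B\<in>Pow A. ramp (\<sigma> B x - 1)) \<le> 1 / 4" by (simp add: m_def)
qed

lemma tail_weight_pos: "0 < \<rho> \<Longrightarrow> 0 < tail_weight D \<rho> m"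
  using constants(3) by (simp add: tail_weight_def add_pos_nonneg)

lemma score_convex:
  assumes A: "finite A" "A \<subseteq> \<Lambda>" and \<rho>: "0 < \<rho>"
  shows "convex_on UNIV (score \<pi> \<sigma> D \<rho> A)"
proof -
  have "convex_on UNIV (\<lambda>x. ramp (\<pi> \<gamma> x - 1) - 1)" if "\<gamma> \<in> A" for \<gamma>
  proof -
    have "\<gamma> \<in> \<Lambda>" using that A by auto
    then have "convex_on UNIV (\<lambda>x. 1 * ramp (\<pi> \<gamma> x - 1))"
      by (intro convex_on_ramp seminorm_convex pi_seminorm) auto
    moreover have "convex_on UNIV (\<lambda>x::'a. - 1 :: real)" by (simp add: convex_on_const)
    ultimately have "convex_on UNIV (\<lambda>x. 1 * ramp (\<pi> \<gamma> x - 1) + - 1)" by (rule convex_on_add)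
    then show ?thesis by simp
  qed
  moreover have "convex_on UNIV (\<lambda>x. ramp (\<sigma> B x - 1))" if "B \<in> Pow A" for B
    using convex_on_ramp[OF seminorm_convex[OF sigma_seminorm], of B 1 1] that A finite_subset by auto
  ultimately show ?thesis unfolding score_def[abs_def]
    using tail_weight_pos[OF \<rho>] by (intro convex_on_add convex_on_finite_sum convex_on_cmul) (auto intro: less_imp_le)
qed

lemma score_lipschitz:
  assumes A: "finite A" "A \<subseteq> \<Lambda>"
  shows "is_lipschitz (score \<pi> \<sigma> D \<rho> A)"
proof -
  have "is_lipschitz (\<lambda>x. ramp (\<pi> \<gamma> x - 1) + (- 1))" if "\<gamma> \<in> A" for \<gamma>
    using is_lipschitz_seminorm[OF pi_seminorm pi_le, of \<gamma>] that A
    by (intro is_lipschitz_add is_lipschitz_const is_lipschitz_ramp) auto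
  moreover have "is_lipschitz (\<lambda>x. ramp (\<sigma> B x - 1))" if "B \<in> Pow A" for B
  proof -
    have "finite B" "B \<subseteq> \<Lambda>" using that A finite_subset by auto
    then show ?thesis by (intro is_lipschitz_ramp is_lipschitz_seminorm[OF sigma_seminorm sigma_norm_le])
  qed
  ultimately show ?thesis unfolding score_def[abs_def]
    by (intro is_lipschitz_add is_lipschitz_cmult is_lipschitz_sum) auto
qed

lemma score_at_zero_le:
  assumes "finite A" "A \<subseteq> \<Lambda>"
  shows "score \<pi> \<sigma> D \<rho> A 0 \<le> 0"
proof -
  have "ramp (\<pi> \<gamma> 0 - 1) = 0" if "\<gamma> \<in> A" for \<gamma>
    using seminorm_0[OF pi_seminorm, of \<gamma>] that assms by (intro ramp_eq_0) auto
  moreover have "ramp (\<sigma> B 0 - 1) = 0" if "B \<in> Pow A" for B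
  proof -
    have "finite B" "B \<subseteq> \<Lambda>" using that assms finite_subset by auto
    then show ?thesis using seminorm_0[OF sigma_seminorm, of B] by (intro ramp_eq_0) auto
  qed
  ultimately show ?thesis by (simp add: score_def)
qed

lemma ramp_half: "0 < ramp (1 / 2)"
  by (rule ramp_pos) simp

lemma normalized_ramp_le_1:
  assumes "(1 / ramp (1 / 2)) * ramp (t - d) \<le> 1"
  shows "t \<le> d + 1 / 2"
proof (rule ccontr)
  assume "\<not> ?thesis"
  then have "ramp (1 / 2) < ramp (t - d)" by (intro ramp_strict_mono) auto
  then show False using assms ramp_half by (simp add: divide_simps)
qed

lemma in_level_set:
  assumes x: "x \<in> joint_sublevel (component_index \<Lambda>) (component \<pi> \<sigma> q D n \<rho>)" and \<rho>: "0 < \<rho>"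
  shows "q x \<le> \<rho>" and "\<And>A. finite A \<Longrightarrow> A \<subseteq> \<Lambda> \<Longrightarrow> score \<pi> \<sigma> D \<rho> A x \<le> n + 1 / 2"
proof -
  have "(\<Sum>i\<in>{None}. component \<pi> \<sigma> q D n \<rho> i x) \<le> 1" using x
    unfolding joint_sublevel_def component_index_def by blast
  then have "(1 / ramp (1 / 2)) * ramp ((1 / \<rho>) * q x - 1 / 2) \<le> 1" by (simp add: component_def)
  from normalized_ramp_le_1[OF this] show "q x \<le> \<rho>" using \<rho> by (simp add: divide_simps)
  fix A assume A: "finite A" "A \<subseteq> \<Lambda>"
  have "finite {Some A}" "{Some A} \<subseteq> component_index \<Lambda>" using A by (auto simp: component_index_def)
  then have "(\<Sum>i\<in>{Some A}. component \<pi> \<sigma> q D n \<rho> i x) \<le> 1" using x unfolding joint_sublevel_def by blast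
  then have "(1 / ramp (1 / 2)) * ramp (score \<pi> \<sigma> D \<rho> A x - n) \<le> 1" by (simp add: component_def)
  from normalized_ramp_le_1[OF this] show "score \<pi> \<sigma> D \<rho> A x \<le> n + 1 / 2" .
qed

text \<open>
  Local finiteness is the point.  Let \<open>G\<close> be the finite set of indices with \<open>\<pi> \<gamma> x \<ge> 1 / 2\<close>.  Near
  \<open>x\<close>, an index outside \<open>G\<close> contributes \<open>- 1\<close> to the score of \<open>A\<close>.  If there is one, then the score of
  \<open>A\<close> is at most that of \<open>A \<inter> G\<close> minus \<open>1\<close> plus \<open>1 / 4\<close>; the score of \<open>A \<inter> G\<close> is at most
  \<open>n + 1 / 2\<close> at \<open>x\<close>, so less than \<open>n + 5 / 8\<close> nearby, and the score of \<open>A\<close> stays below \<open>n\<close>.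
\<close>

lemma gauge: 
  assumes \<rho>: "0 < \<rho>"
  shows "locally_finite_gauge (component_index \<Lambda>) (component \<pi> \<sigma> q D n \<rho>)"
proof
  let ?g = "component \<pi> \<sigma> q D n \<rho>" and ?I = "component_index \<Lambda>"
  have r: "0 \<le> 1 / ramp (1 / 2)" using ramp_half by simp
  have qlip: "is_lipschitz (\<lambda>x. (1 / \<rho>) * q x)"
    by (intro is_lipschitz_cmult is_lipschitz_seminorm[OF q_seminorm q_le])
  fix i assume i: "i \<in> ?I"
  then have ci: "i = None \<or> (\<exists>A. i = Some A \<and> finite A \<and> A \<subseteq> \<Lambda>)" by (auto simp: component_index_def)
  show "convex_on UNIV (?g i)"
  proof (cases i)
    case None
    have "convex_on UNIV (\<lambda>x. (1 / \<rho>) * q x)"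
      using \<rho> by (intro convex_on_cmul seminorm_convex q_seminorm) auto
    from convex_on_ramp[OF this r] show ?thesis unfolding component_def[abs_def] None by simp
  next
    case (Some A)
    then have A: "finite A" "A \<subseteq> \<Lambda>" using ci by auto
    from convex_on_ramp[OF score_convex[OF A \<rho>] r] show ?thesis unfolding component_def[abs_def] Some by simp
  qed
  show "?g i (- x) = ?g i x" for x
  proof (cases i)
    case None
    then show ?thesis by (simp add: component_def seminorm_minus[OF q_seminorm])
  next
    case (Some A)
    then have A: "finite A" "A \<subseteq> \<Lambda>" using ci by auto
    have "\<pi> \<gamma> (- x) = \<pi> \<gamma> x" if "\<gamma> \<in> A" for \<gamma> using A that by (intro seminorm_minus pi_seminorm) auto
    moreover have "\<sigma> B (- x) = \<sigma> B x" if "B \<in> Pow A" for B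
      using A that finite_subset by (intro seminorm_minus sigma_seminorm) auto
    ultimately have "score \<pi> \<sigma> D \<rho> A (- x) = score \<pi> \<sigma> D \<rho> A x" by (simp add: score_def)
    then show ?thesis by (simp add: component_def Some)
  qed
  show "0 \<le> ?g i x" for x using r by (auto simp: component_def ramp_nonneg split: option.split)
  show "?g i 0 = 0"
  proof (cases i)
    case None
    then show ?thesis by (simp add: component_def seminorm_0[OF q_seminorm] ramp_eq_0)
  next
    case (Some A)
    then have "score \<pi> \<sigma> D \<rho> A 0 - n \<le> 0" using ci score_at_zero_le[of A \<rho>] by auto
    then show ?thesis by (simp add: component_def Some ramp_eq_0)
  qed
  show "is_lipschitz (?g i)"
  proof (cases i)
    case None
    show ?thesis unfolding None component_def[abs_def] option.case
      by (intro is_lipschitz_cmult is_lipschitz_ramp[OF qlip])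
  next
    case (Some A)
    then have A: "finite A" "A \<subseteq> \<Lambda>" using ci by auto
    show ?thesis unfolding Some component_def[abs_def] option.case
      by (intro is_lipschitz_cmult is_lipschitz_ramp[OF score_lipschitz[OF A]])
  qed
next
  let ?g = "component \<pi> \<sigma> q D n \<rho>" and ?I = "component_index \<Lambda>"
  have "norm x \<le> \<rho> / c" if "x \<in> joint_sublevel ?I ?g" for x
    using in_level_set(1)[OF that \<rho>] q_ge[of x] constants(2) by (simp add: field_simps)
  then show "\<exists>R. \<forall>x\<in>joint_sublevel ?I ?g. norm x \<le> R" by blast
  fix x assume x: "x \<in> joint_sublevel ?I ?g"
  define G where "G = {\<gamma>\<in>\<Lambda>. 1 / 2 \<le> \<pi> \<gamma> x}"
  have G: "finite G" "G \<subseteq> \<Lambda>" using c0[of "1 / 2" x] by (auto simp: G_def)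
  define V where "V = ball x (1 / (2 * C)) \<inter> {y. q y < 2 * \<rho>} \<inter> (\<Inter>A\<in>Pow G. {y. score \<pi> \<sigma> D \<rho> A y < n + 5 / 8})"
  have "open V" unfolding V_def
    using G finite_subset
    by (intro open_Int open_ball open_INT ballI open_Collect_less continuous_intros
        is_lipschitz_continuous is_lipschitz_seminorm[OF q_seminorm q_le] score_lipschitz) auto
  moreover have "x \<in> V"
  proof -
    have "score \<pi> \<sigma> D \<rho> A x < n + 5 / 8" if "A \<in> Pow G" for A
      using in_level_set(2)[OF x \<rho>, of A] that G finite_subset by fastforce
    then show ?thesis using in_level_set(1)[OF x \<rho>] \<rho> constants(1) by (auto simp: V_def)
  qed
  moreover have "?g i y = 0" if i: "i \<in> ?I - insert None (Some ` Pow G)" and y: "y \<in> V" for i y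
  proof -
    obtain A where A: "i = Some A" "finite A" "A \<subseteq> \<Lambda>" "\<not> A \<subseteq> G"
    proof (cases i)
      case None
      then show ?thesis using i by simp
    next
      case (Some A)
      then have "Some A \<in> ?I" "Some A \<notin> Some ` Pow G" using i by auto
      then have "finite A" "A \<subseteq> \<Lambda>" "\<not> A \<subseteq> G" unfolding component_index_def by blast+
      then show ?thesis using that Some by blast
    qed
    have yV: "norm (y - x) < 1 / (2 * C)" "q y \<le> 2 * \<rho>"
    proof -
      have "y \<in> ball x (1 / (2 * C))" "q y < 2 * \<rho>"
        using IntD1[OF y[unfolded V_def]] by (simp_all only: Int_iff mem_Collect_eq)
      then show "norm (y - x) < 1 / (2 * C)" "q y \<le> 2 * \<rho>" by (simp_all add: dist_norm norm_minus_commute)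
    qed
    have small: "ramp (\<pi> \<gamma> y - 1) = 0" if "\<gamma> \<in> A - G" for \<gamma>
    proof (rule ramp_eq_0)
      have g: "\<gamma> \<in> \<Lambda>" "\<pi> \<gamma> x < 1 / 2" using that A by (auto simp: G_def)
      have "\<pi> \<gamma> y - \<pi> \<gamma> x \<le> C * norm (y - x)"
        using seminorm_diff_le[OF pi_seminorm[OF g(1)], of y x] pi_le[OF g(1), of "y - x"] by linarith
      also have "\<dots> < 1 / 2" using yV(1) constants(1) by (simp add: field_simps)
      finally show "\<pi> \<gamma> y - 1 \<le> 0" using g(2) by linarith
    qed
    obtain \<gamma> where \<gamma>: "\<gamma> \<in> A - G" using A by blast
    have "(\<Sum>\<gamma>\<in>A. ramp (\<pi> \<gamma> y - 1) - 1) = (\<Sum>\<gamma>\<in>A \<inter> G. ramp (\<pi> \<gamma> y - 1) - 1) + (\<Sum>\<gamma>\<in>A - G. ramp (\<pi> \<gamma> y - 1) - 1)"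
      using sum.Int_Diff[OF A(2), of _ G] by blast
    also have "(\<Sum>\<gamma>\<in>A - G. ramp (\<pi> \<gamma> y - 1) - 1) = - real (card (A - G))" using small by simp
    also have "\<dots> \<le> - 1" using \<gamma> A(2) by (simp add: Suc_le_eq card_gt_0_iff) blast
    finally have s1: "(\<Sum>\<gamma>\<in>A. ramp (\<pi> \<gamma> y - 1) - 1) \<le> (\<Sum>\<gamma>\<in>A \<inter> G. ramp (\<pi> \<gamma> y - 1) - 1) - 1" by simp
    have AG: "finite (A \<inter> G)" "A \<inter> G \<subseteq> \<Lambda>" using A by auto
    have "score \<pi> \<sigma> D \<rho> (A \<inter> G) y < n + 5 / 8"
      using INT_E[OF IntD2[OF y[unfolded V_def]], of "A \<inter> G"] by simp
    then have "(\<Sum>\<gamma>\<in>A \<inter> G. ramp (\<pi> \<gamma> y - 1) - 1) < n + 5 / 8"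
      using tail_bounds(1)[OF AG \<rho>, of y] by (simp add: score_def)
    then have "score \<pi> \<sigma> D \<rho> A y - n \<le> 0"
      using s1 tail_bounds(2)[OF A(2,3) \<rho> yV(2)] by (simp add: score_def)
    then show ?thesis by (simp add: component_def A(1) ramp_eq_0)
  qed
  moreover have "finite (insert None (Some ` Pow G))" "insert None (Some ` Pow G) \<subseteq> ?I"
  proof -
    have "Pow G \<subseteq> {A. finite A \<and> A \<subseteq> \<Lambda>}" using G finite_subset by blast
    from insert_mono[OF image_mono[OF this]] show "insert None (Some ` Pow G) \<subseteq> ?I"
      unfolding component_index_def .
  qed (use G in simp)
  ultimately show "\<exists>V J. open V \<and> x \<in> V \<and> finite J \<and> J \<subseteq> ?I \<and> (\<forall>i\<in>?I - J. \<forall>y\<in>V. ?g i y = 0)"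
    by (intro exI[of _ V] exI[of _ "insert None (Some ` Pow G)"]) blast
qed

lemma level_norm_equivalent: "0 < \<rho> \<Longrightarrow> equivalent_norm_on UNIV (level_norm \<Lambda> \<pi> \<sigma> q D n \<rho>)"
  unfolding level_norm_def by (rule locally_finite_gauge.gauge_equivalent_norm[OF gauge])

lemma level_norm_smooth:
  assumes \<rho>: "0 < \<rho>"
    and pi: "\<And>\<gamma>. \<gamma> \<in> \<Lambda> \<Longrightarrow> equi_C (Suc N) {x. \<pi> \<gamma> x \<noteq> 0} {\<pi> \<gamma>}"
    and sig: "\<And>B. finite B \<Longrightarrow> B \<subseteq> \<Lambda> \<Longrightarrow> equi_C (Suc N) {x. \<sigma> B x \<noteq> 0} {\<sigma> B}"
    and q: "equi_C (Suc N) {x. q x \<noteq> 0} {q}"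
  shows "equi_C (Suc N) (- {0}) {level_norm \<Lambda> \<pi> \<sigma> q D n \<rho>}"
  unfolding level_norm_def
proof (rule locally_finite_gauge.gauge_smooth[OF gauge[OF \<rho>]])
  fix i :: "'i set option" assume i: "i \<in> component_index \<Lambda>"
  let ?U = "UNIV \<times> {0<..} :: ('a \<times> real) set"
  have U: "open ?U" by (intro open_Times) auto
  show "equi_C (Suc N) ?U {\<lambda>z. component \<pi> \<sigma> q D n \<rho> i (fst z /\<^sub>R snd z)}"
  proof (cases i)
    case None
    have "equi_C (Suc N) ?U {\<lambda>z. (1 / ramp (1 / 2)) * ramp ((1 / \<rho>) * q (fst z /\<^sub>R snd z) - 1 / 2)}"
      by (intro equi_C_single_mult[OF U equi_C_single_const[OF U] equi_C_ramp_seminorm[OF q_seminorm q_le q]])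
         (use \<rho> in auto)
    then show ?thesis by (simp add: component_def None)
  next
    case (Some A)
    then have A: "finite A" "A \<subseteq> \<Lambda>" using i by (auto simp: component_index_def)
    have 1: "equi_C (Suc N) ?U {\<lambda>z. ramp (\<pi> \<gamma> (fst z /\<^sub>R snd z) - 1) + (- 1)}" if "\<gamma> \<in> A" for \<gamma>
    proof -
      have g: "\<gamma> \<in> \<Lambda>" using that A by auto
      show ?thesis
        using equi_C_single_add[OF U equi_C_ramp_seminorm[OF pi_seminorm[OF g] pi_le[OF g] pi[OF g], of 1 1] equi_C_single_const[OF U, of _ "- 1"]]
        by simp
    qed
    have 2: "equi_C (Suc N) ?U {\<lambda>z. ramp (\<sigma> B (fst z /\<^sub>R snd z) - 1)}" if "B \<in> Pow A" for B
    proof -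
      have B: "finite B" "B \<subseteq> \<Lambda>" using that A finite_subset by auto
      show ?thesis
        using equi_C_ramp_seminorm[OF sigma_seminorm[OF B] sigma_norm_le[OF B] sig[OF B], of 1 1] by simp
    qed
    have "equi_C (Suc N) ?U {\<lambda>z. (\<Sum>\<gamma>\<in>A. ramp (\<pi> \<gamma> (fst z /\<^sub>R snd z) - 1) + (- 1)) +
        tail_weight D \<rho> (card A) * (\<Sum>B\<in>Pow A. ramp (\<sigma> B (fst z /\<^sub>R snd z) - 1))}"
      by (intro equi_C_single_add equi_C_single_mult equi_C_single_const equi_C_single_sum U 1 2)
    then have sc: "equi_C (Suc N) ?U {\<lambda>z. score \<pi> \<sigma> D \<rho> A (fst z /\<^sub>R snd z)}" by (simp add: score_def)
    from equi_C_single_compose[OF open_UNIV U equi_C_ramp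
        equi_C_single_add[OF U sc equi_C_single_const[OF U, of _ "- real n"]] UNIV_I]
    have "equi_C (Suc N) ?U {\<lambda>z. ramp (score \<pi> \<sigma> D \<rho> A (fst z /\<^sub>R snd z) + (- real n))}" .
    from equi_C_single_mult[OF U equi_C_single_const[OF U, of _ "1 / ramp (1 / 2)"] this]
    show ?thesis by (simp add: component_def Some)
  qed
qed

end

text \<open>
  All components are increasing functions of the seminorms, hence changing the seminorms by a factor
  does not change the gauge by more than that factor.
\<close>

lemma level_norm_comparison:
  assumes "coordinate_system \<Lambda> \<pi> \<sigma> q C c D" "coordinate_system \<Lambda> \<pi>' \<sigma> q C' c D"
    and \<rho>: "0 < \<rho>" and a: "1 \<le> a" and le: "\<And>\<gamma> x. \<gamma> \<in> \<Lambda> \<Longrightarrow> \<pi>' \<gamma> x \<le> a * \<pi> \<gamma> x"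
  shows "level_norm \<Lambda> \<pi>' \<sigma> q D n \<rho> x \<le> a * level_norm \<Lambda> \<pi> \<sigma> q D n \<rho> x"
proof -
  interpret A: coordinate_system \<Lambda> \<pi> \<sigma> q C c D by fact
  interpret B: coordinate_system \<Lambda> \<pi>' \<sigma> q C' c D by fact
  have scale: "p y \<le> p (a *\<^sub>R y)" if "seminorm p" for p :: "'b \<Rightarrow> real" and y
    using that a mult_right_mono[of 1 a "p y"] seminorm_nonneg[OF that, of y] by (simp add: seminorm_scale)
  show ?thesis unfolding level_norm_def
  proof (rule gauge_comparison[OF A.gauge[OF \<rho>] B.gauge[OF \<rho>]])
    fix i :: "'a set option" and x assume i: "i \<in> component_index \<Lambda>"
    have r: "0 \<le> 1 / ramp (1 / 2)" using A.ramp_half by simp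
    show "component \<pi>' \<sigma> q D n \<rho> i x \<le> component \<pi> \<sigma> q D n \<rho> i (a *\<^sub>R x)"
    proof (cases i)
      case None
      have "(1 / \<rho>) * q x \<le> (1 / \<rho>) * q (a *\<^sub>R x)" using scale[OF A.q_seminorm] \<rho> by (intro mult_left_mono) auto
      then show ?thesis unfolding component_def None option.case
        by (intro mult_left_mono[OF ramp_mono r]) simp
    next
      case (Some A)
      then have A: "finite A" "A \<subseteq> \<Lambda>" using i by (auto simp: component_index_def)
      have "score \<pi>' \<sigma> D \<rho> A x \<le> score \<pi> \<sigma> D \<rho> A (a *\<^sub>R x)" unfolding score_def
      proof (intro add_mono sum_mono mult_left_mono diff_mono ramp_mono)
        show "\<pi>' \<gamma> x \<le> \<pi> \<gamma> (a *\<^sub>R x)" if "\<gamma> \<in> A" for \<gamma>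
          using le[of \<gamma> x] that A a by (auto simp: seminorm_scale[OF A.pi_seminorm] subset_iff)
        show "\<sigma> B x \<le> \<sigma> B (a *\<^sub>R x)" if "B \<in> Pow A" for B
          using that A finite_subset by (intro scale A.sigma_seminorm) auto
      qed (use A.tail_weight_pos[OF \<rho>] in \<open>auto intro: less_imp_le\<close>)
      then show ?thesis unfolding component_def Some option.case
        by (intro mult_left_mono[OF ramp_mono r]) simp
    qed
  qed (use a in auto)
qed

section \<open>Rotundity of level norms\<close>

context coordinate_system
begin

text \<open>
  Some set \<open>A\<close> has score above \<open>n\<close>, as the components sum up to \<open>1\<close> at \<open>x\<close> and the one with index
  \<open>None\<close> vanishes.  Adding the indices of \<open>B\<close>, each worth at least \<open>1\<close>, increases the score.  The
  component of \<open>A \<union> B\<close> is then positive at \<open>x\<close>, and vanishing of its gap passes to the score and to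
  each of its summands: to the coordinates in \<open>B\<close> and to \<open>\<sigma> B\<close>.
\<close>

lemma unit_transfer:
  fixes n :: nat and \<rho> :: real
  defines "N \<equiv> level_norm \<Lambda> \<pi> \<sigma> q D n \<rho>"
  assumes \<rho>: "0 < \<rho>" and x: "N x = 1" and xs: "\<And>r. N (xs r) = 1" and lim: "(\<lambda>r. N (xs r + x)) \<longlonglongrightarrow> 2"
    and B: "finite B" "B \<subseteq> \<Lambda>" "\<And>\<gamma>. \<gamma> \<in> B \<Longrightarrow> 2 \<le> ramp (\<pi> \<gamma> x - 1)"
    and q: "q x \<le> \<rho> / 2"
  shows "\<And>\<gamma>. \<gamma> \<in> B \<Longrightarrow> (\<lambda>r. \<pi> \<gamma> (xs r)) \<longlonglongrightarrow> \<pi> \<gamma> x"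
    and "\<And>\<gamma>. \<gamma> \<in> B \<Longrightarrow> (\<lambda>r. \<pi> \<gamma> (xs r + x)) \<longlonglongrightarrow> 2 * \<pi> \<gamma> x"
    and "\<And>e. 0 < e \<Longrightarrow> \<forall>\<^sub>F r in sequentially. \<sigma> B (xs r) < max (\<sigma> B x) 1 + e"
proof -
  let ?g = "component \<pi> \<sigma> q D n \<rho>" and ?I = "component_index \<Lambda>"
  interpret G: locally_finite_gauge ?I ?g by (rule gauge[OF \<rho>])
  have N: "N = minkowski_gauge (joint_sublevel ?I ?g)" by (simp add: N_def level_norm_def)
  obtain s where s: "0 < s" "s \<le> 1 / 2" and g: "\<And>i. i \<in> ?I \<Longrightarrow> (\<lambda>r. gap s (?g i) x (xs r)) \<longlonglongrightarrow> 0"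
    using G.gauge_gap[OF x[unfolded N] xs[unfolded N] lim[unfolded N]] by blast
  have s1: "s < 1" using s by simp
  have xK: "x \<in> joint_sublevel ?I ?g" using G.unit_in_body x N by simp
  have "\<exists>A. finite A \<and> A \<subseteq> \<Lambda> \<and> n < score \<pi> \<sigma> D \<rho> A x"
  proof (rule ccontr)
    assume "\<not> ?thesis"
    then have le: "score \<pi> \<sigma> D \<rho> A x \<le> n" if "finite A" "A \<subseteq> \<Lambda>" for A using that by (meson not_le)
    obtain V J where V: "open V" "x \<in> V" "finite J" "J \<subseteq> ?I" "\<forall>i\<in>?I - J. \<forall>y\<in>V. ?g i y = 0"
      using G.locally_finite[OF xK] by blast
    have "?g i x = 0" if "i \<in> J" for i
    proof (cases i)
      case None
      have "(1 / \<rho>) * q x - 1 / 2 \<le> 0" using q \<rho> by (simp add: divide_simps)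
      then show ?thesis by (simp add: component_def None ramp_eq_0)
    next
      case (Some A)
      then have "finite A" "A \<subseteq> \<Lambda>" using that V(4) by (auto simp: component_index_def)
      then show ?thesis using le by (simp add: component_def Some ramp_eq_0)
    qed
    then show False using G.sum_eq_1_on_unit_sphere[OF x[unfolded N] V] by simp
  qed
  then obtain A where A: "finite A" "A \<subseteq> \<Lambda>" "n < score \<pi> \<sigma> D \<rho> A x" by blast
  define A' where "A' = A \<union> B"
  have A': "finite A'" "A' \<subseteq> \<Lambda>" "B \<subseteq> A'" using A B by (auto simp: A'_def)
  have sc: "n < score \<pi> \<sigma> D \<rho> A' x"
  proof (cases "B \<subseteq> A")
    case True
    then show ?thesis using A(3) by (simp add: A'_def Un_absorb2)
  next
    case False
    then have ne: "B - A \<noteq> {}" by blast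
    have "A' = A \<union> (B - A)" by (auto simp: A'_def)
    then have "(\<Sum>\<gamma>\<in>A'. ramp (\<pi> \<gamma> x - 1) - 1) = (\<Sum>\<gamma>\<in>A. ramp (\<pi> \<gamma> x - 1) - 1) + (\<Sum>\<gamma>\<in>B - A. ramp (\<pi> \<gamma> x - 1) - 1)"
      using A B by (simp only:) (rule sum.union_disjoint, auto)
    moreover have "1 \<le> real (card (B - A))" using ne B(1) by (simp add: Suc_le_eq card_gt_0_iff)
    moreover have "real (card (B - A)) * 1 \<le> (\<Sum>\<gamma>\<in>B - A. ramp (\<pi> \<gamma> x - 1) - 1)"
      by (rule sum_bounded_below) (use B(3) in force)
    moreover have "q x \<le> 2 * \<rho>" using q \<rho> by simp
    ultimately show ?thesis using A(3) tail_bounds(2)[OF A(1,2) \<rho>, of x] tail_bounds(1)[OF A'(1,2) \<rho>, of x]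
      by (simp add: score_def)
  qed
  define w where "w = tail_weight D \<rho> (card A')"
  have w: "0 < w" unfolding w_def by (rule tail_weight_pos[OF \<rho>])
  let ?a = "\<lambda>\<gamma> x. ramp (\<pi> \<gamma> x - 1) - 1" and ?b = "\<lambda>B x. ramp (\<sigma> B x - 1)"
  have "Some A' \<in> ?I" using A' by (auto simp: component_index_def)
  from g[OF this] have "(\<lambda>r. gap s (\<lambda>x. (1 / ramp (1 / 2)) * ramp (score \<pi> \<sigma> D \<rho> A' x - n)) x (xs r)) \<longlonglongrightarrow> 0"
    by (simp add: component_def[abs_def])
  from gap_ramp_compose(3)[OF s(1) s1 score_convex[OF A'(1,2) \<rho>] _ this sc]
  have gs: "(\<lambda>r. gap s (score \<pi> \<sigma> D \<rho> A') x (xs r)) \<longlonglongrightarrow> 0" using ramp_half by simp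
  have split: "gap s (score \<pi> \<sigma> D \<rho> A') x y = (\<Sum>\<gamma>\<in>A'. gap s (?a \<gamma>) x y) + w * (\<Sum>B\<in>Pow A'. gap s (?b B) x y)" for y
  proof -
    have "gap s (score \<pi> \<sigma> D \<rho> A') x y = gap s (\<lambda>x. \<Sum>\<gamma>\<in>A'. ?a \<gamma> x) x y + w * gap s (\<lambda>x. \<Sum>B\<in>Pow A'. ?b B x) x y"
      by (simp add: gap_def score_def w_def algebra_simps)
    then show ?thesis by (simp only: gap_sum)
  qed
  have gap_a: "gap s (?a \<gamma>) x y = gap s (\<lambda>x. 1 * ramp (\<pi> \<gamma> x - 1)) x y" for \<gamma> y by (simp add: gap_def algebra_simps)
  have na: "0 \<le> gap s (?a \<gamma>) x y" if "\<gamma> \<in> A'" for \<gamma> y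
    unfolding gap_a using that A' s by (intro gap_nonneg convex_on_ramp seminorm_convex pi_seminorm) auto
  have nb: "0 \<le> gap s (?b B) x y" if "B \<in> Pow A'" for B y
  proof -
    have "finite B" "B \<subseteq> \<Lambda>" using that A' finite_subset by auto
    then have "convex_on UNIV (\<lambda>x. 1 * ramp (\<sigma> B x - 1))" by (intro convex_on_ramp seminorm_convex sigma_seminorm) auto
    then show ?thesis using s by (intro gap_nonneg) auto
  qed
  have ga: "(\<lambda>r. gap s (\<lambda>x. 1 * ramp (\<pi> \<gamma> x - 1)) x (xs r)) \<longlonglongrightarrow> 0" if "\<gamma> \<in> A'" for \<gamma>
  proof (rule tendsto_sandwich[OF _ _ tendsto_const gs])
    have "gap s (?a \<gamma>) x y \<le> gap s (score \<pi> \<sigma> D \<rho> A') x y" for y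
    proof -
      have "gap s (?a \<gamma>) x y \<le> (\<Sum>\<gamma>\<in>A'. gap s (?a \<gamma>) x y)" using that na A'(1) by (intro member_le_sum) auto
      moreover have "0 \<le> w * (\<Sum>B\<in>Pow A'. gap s (?b B) x y)" using w nb by (intro mult_nonneg_nonneg sum_nonneg) auto
      ultimately show ?thesis unfolding split by linarith
    qed
    then show "\<forall>\<^sub>F r in sequentially. gap s (\<lambda>x. 1 * ramp (\<pi> \<gamma> x - 1)) x (xs r) \<le> gap s (score \<pi> \<sigma> D \<rho> A') x (xs r)"
      unfolding gap_a by simp
    show "\<forall>\<^sub>F r in sequentially. 0 \<le> gap s (\<lambda>x. 1 * ramp (\<pi> \<gamma> x - 1)) x (xs r)"
      using na[OF that] unfolding gap_a by simp
  qed
  have gb: "(\<lambda>r. gap s (?b B) x (xs r)) \<longlonglongrightarrow> 0"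
  proof (rule tendsto_sandwich)
    have BP: "B \<in> Pow A'" using A' by simp
    show "\<forall>\<^sub>F r in sequentially. 0 \<le> gap s (?b B) x (xs r)" using nb[OF BP] by simp
    have "gap s (?b B) x y \<le> gap s (score \<pi> \<sigma> D \<rho> A') x y / w" for y
    proof -
      have "gap s (?b B) x y \<le> (\<Sum>B\<in>Pow A'. gap s (?b B) x y)" using BP nb A'(1) by (intro member_le_sum) auto
      then have "w * gap s (?b B) x y \<le> w * (\<Sum>B\<in>Pow A'. gap s (?b B) x y)" using w by (intro mult_left_mono) auto
      moreover have "0 \<le> (\<Sum>\<gamma>\<in>A'. gap s (?a \<gamma>) x y)" using na by (intro sum_nonneg) auto
      ultimately have "w * gap s (?b B) x y \<le> gap s (score \<pi> \<sigma> D \<rho> A') x y" unfolding split by linarith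
      then show ?thesis using w by (simp add: pos_le_divide_eq mult.commute)
    qed
    then show "\<forall>\<^sub>F r in sequentially. gap s (?b B) x (xs r) \<le> gap s (score \<pi> \<sigma> D \<rho> A') x (xs r) / w" by simp
    show "(\<lambda>r. gap s (score \<pi> \<sigma> D \<rho> A') x (xs r) / w) \<longlonglongrightarrow> 0" using tendsto_divide[OF gs tendsto_const[of w]] w by simp
  qed (rule tendsto_const)
  have "(\<lambda>r. gap s (\<lambda>x. 1 * ramp (\<sigma> B x - 1)) x (xs r)) \<longlonglongrightarrow> 0" using gb by simp
  from gap_ramp_compose(1)[OF s(1) s1 seminorm_convex[OF sigma_seminorm[OF B(1,2)]] _ this]
  show "\<forall>\<^sub>F r in sequentially. \<sigma> B (xs r) < max (\<sigma> B x) 1 + e" if "0 < e" for e using that by simp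
  fix \<gamma> assume \<gamma>: "\<gamma> \<in> B"
  then have gL: "\<gamma> \<in> \<Lambda>" "\<gamma> \<in> A'" using B A' by auto
  note sn = pi_seminorm[OF gL(1)]
  have "1 < \<pi> \<gamma> x"
    using B(3)[OF \<gamma>] ramp_eq_0[of "\<pi> \<gamma> x - 1"] by (cases "1 < \<pi> \<gamma> x") auto
  note cmp = gap_ramp_compose(2,3)[OF s(1) s1 seminorm_convex[OF sn] zero_less_one ga[OF gL(2)] this]
  show p1: "(\<lambda>r. \<pi> \<gamma> (xs r)) \<longlonglongrightarrow> \<pi> \<gamma> x" by (rule cmp(1))
  have "(\<lambda>r. (1 - s) * \<pi> \<gamma> x + s * \<pi> \<gamma> (xs r) - gap s (\<pi> \<gamma>) x (xs r)) \<longlonglongrightarrow> (1 - s) * \<pi> \<gamma> x + s * \<pi> \<gamma> x - 0"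
    by (intro tendsto_intros cmp)
  then have y: "(\<lambda>r. \<pi> \<gamma> ((1 - s) *\<^sub>R x + s *\<^sub>R xs r)) \<longlonglongrightarrow> \<pi> \<gamma> x" by (simp add: gap_def algebra_simps)
  show "(\<lambda>r. \<pi> \<gamma> (xs r + x)) \<longlonglongrightarrow> 2 * \<pi> \<gamma> x"
  proof (rule tendsto_sandwich)
    have "(\<pi> \<gamma> ((1 - s) *\<^sub>R x + s *\<^sub>R xs r) - (1 - 2 * s) * \<pi> \<gamma> x) / s \<le> \<pi> \<gamma> (xs r + x)" for r
    proof -
      have "(1 - s) *\<^sub>R x = s *\<^sub>R x + (1 - 2 * s) *\<^sub>R x" by (simp flip: scaleR_left_distrib)
      then have "(1 - s) *\<^sub>R x + s *\<^sub>R xs r = s *\<^sub>R (xs r + x) + (1 - 2 * s) *\<^sub>R x"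
        by (simp add: scaleR_right_distrib)
      also have "\<pi> \<gamma> \<dots> \<le> \<pi> \<gamma> (s *\<^sub>R (xs r + x)) + \<pi> \<gamma> ((1 - 2 * s) *\<^sub>R x)" by (rule seminorm_triangle[OF sn])
      also have "\<dots> = s * \<pi> \<gamma> (xs r + x) + (1 - 2 * s) * \<pi> \<gamma> x" using s by (simp add: seminorm_scale[OF sn])
      finally show ?thesis using s by (simp add: pos_divide_le_eq algebra_simps)
    qed
    then show "\<forall>\<^sub>F r in sequentially. (\<pi> \<gamma> ((1 - s) *\<^sub>R x + s *\<^sub>R xs r) - (1 - 2 * s) * \<pi> \<gamma> x) / s \<le> \<pi> \<gamma> (xs r + x)" by simp
    have "(\<lambda>r. (\<pi> \<gamma> ((1 - s) *\<^sub>R x + s *\<^sub>R xs r) - (1 - 2 * s) * \<pi> \<gamma> x) / s) \<longlonglongrightarrow> (\<pi> \<gamma> x - (1 - 2 * s) * \<pi> \<gamma> x) / s"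
      using s by (intro tendsto_intros y) auto
    moreover have "(\<pi> \<gamma> x - (1 - 2 * s) * \<pi> \<gamma> x) / s = 2 * \<pi> \<gamma> x" using s by (simp add: field_simps)
    ultimately show "(\<lambda>r. (\<pi> \<gamma> ((1 - s) *\<^sub>R x + s *\<^sub>R xs r) - (1 - 2 * s) * \<pi> \<gamma> x) / s) \<longlonglongrightarrow> 2 * \<pi> \<gamma> x" by simp
    show "\<forall>\<^sub>F r in sequentially. \<pi> \<gamma> (xs r + x) \<le> \<pi> \<gamma> (xs r) + \<pi> \<gamma> x" using seminorm_triangle[OF sn] by simp
    show "(\<lambda>r. \<pi> \<gamma> (xs r) + \<pi> \<gamma> x) \<longlonglongrightarrow> 2 * \<pi> \<gamma> x" using tendsto_add[OF p1 tendsto_const[of "\<pi> \<gamma> x"]] by simp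
  qed
qed

text \<open>
  The homogeneous version: both \<open>x\<close> and \<open>xs r\<close> are scaled to the unit sphere of the gauge.
\<close>

lemma transfer:
  fixes n :: nat and \<rho> :: real
  defines "N \<equiv> level_norm \<Lambda> \<pi> \<sigma> q D n \<rho>"
  assumes \<rho>: "0 < \<rho>" and m: "N x = m" "0 < m"
    and xs: "(\<lambda>r. N (xs r)) \<longlonglongrightarrow> m" and lim: "(\<lambda>r. N (xs r + x)) \<longlonglongrightarrow> 2 * m"
    and B: "finite B" "B \<subseteq> \<Lambda>" "\<And>\<gamma>. \<gamma> \<in> B \<Longrightarrow> 2 \<le> ramp (\<pi> \<gamma> x / m - 1)"
    and q: "q x \<le> m * \<rho> / 2"
  shows "\<And>\<gamma>. \<gamma> \<in> B \<Longrightarrow> (\<lambda>r. \<pi> \<gamma> (xs r)) \<longlonglongrightarrow> \<pi> \<gamma> x"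
    and "\<And>\<gamma>. \<gamma> \<in> B \<Longrightarrow> (\<lambda>r. \<pi> \<gamma> (xs r + x)) \<longlonglongrightarrow> 2 * \<pi> \<gamma> x"
    and "\<And>e. 0 < e \<Longrightarrow> \<forall>\<^sub>F r in sequentially. \<sigma> B (xs r) < max (\<sigma> B x) m + e"
proof -
  have Ns: "seminorm N" unfolding N_def by (rule equivalent_norm_on_UNIV_D(1)[OF level_norm_equivalent[OF \<rho>]])
  define z where "z = x /\<^sub>R m"
  define zs where "zs = (\<lambda>r. if N (xs r) = 0 then z else xs r /\<^sub>R N (xs r))"
  have Nz: "N z = 1" using m by (simp add: z_def seminorm_scale[OF Ns])
  have Nzs: "N (zs r) = 1" for r
    using seminorm_nonneg[OF Ns, of "xs r"] by (auto simp: zs_def Nz seminorm_scale[OF Ns])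
  have pos: "\<forall>\<^sub>F r in sequentially. 0 < N (xs r)" by (rule order_tendstoD(1)[OF xs m(2)])
  have zs_eq: "zs r = xs r /\<^sub>R N (xs r)" if "0 < N (xs r)" for r using that by (simp add: zs_def)
  have inv: "(\<lambda>r. \<bar>inverse (N (xs r)) - inverse m\<bar>) \<longlonglongrightarrow> 0"
    using tendsto_rabs[OF tendsto_diff[OF tendsto_inverse[OF xs] tendsto_const[of "inverse m"]]] m(2) by simp
  \<comment> \<open>Normalising the two summands separately or their sum makes no difference in the limit.\<close>
  have sum_lim: "(\<lambda>r. p (zs r + z)) \<longlonglongrightarrow> l" if p: "seminorm p" "(\<lambda>r. p (xs r)) \<longlonglongrightarrow> k" "(\<lambda>r. p (xs r + x)) \<longlonglongrightarrow> l * m" for p k l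
  proof -
    have lm: "l * m * inverse m = l" using m(2) by simp
    have 1: "(\<lambda>r. p (xs r + x) * inverse m) \<longlonglongrightarrow> l"
      using tendsto_mult_right[OF p(3), of "inverse m"] unfolding lm .
    have "(\<lambda>r. p (zs r + z) - p (xs r + x) * inverse m) \<longlonglongrightarrow> 0"
    proof (rule Lim_null_comparison)
      show "\<forall>\<^sub>F r in sequentially. norm (p (zs r + z) - p (xs r + x) * inverse m) \<le> \<bar>inverse (N (xs r)) - inverse m\<bar> * p (xs r)"
        using pos
      proof eventually_elim
        case (elim r)
        have "zs r + z - inverse m *\<^sub>R (xs r + x) = (inverse (N (xs r)) - inverse m) *\<^sub>R xs r"
          by (simp add: zs_eq[OF elim] z_def algebra_simps)
        then have "\<bar>p (zs r + z) - p (inverse m *\<^sub>R (xs r + x))\<bar> \<le> p ((inverse (N (xs r)) - inverse m) *\<^sub>R xs r)"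
          using seminorm_diff_le[OF p(1), of "zs r + z" "inverse m *\<^sub>R (xs r + x)"] by simp
        then show ?case using m(2) by (simp add: seminorm_scale[OF p(1)] mult.commute)
      qed
      show "(\<lambda>r. \<bar>inverse (N (xs r)) - inverse m\<bar> * p (xs r)) \<longlonglongrightarrow> 0"
        using tendsto_mult[OF inv p(2)] by simp
    qed
    from tendsto_add[OF this 1] show ?thesis by simp
  qed
  have limz: "(\<lambda>r. N (zs r + z)) \<longlonglongrightarrow> 2" by (rule sum_lim[OF Ns xs lim])
  have Bz: "2 \<le> ramp (\<pi> \<gamma> z - 1)" if "\<gamma> \<in> B" for \<gamma>
    using B(2) B(3)[OF that] that m(2) by (auto simp: z_def seminorm_scale[OF pi_seminorm] divide_inverse mult.commute subset_iff)
  have qz: "q z \<le> \<rho> / 2" using q m(2) by (simp add: z_def seminorm_scale[OF q_seminorm] field_simps)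
  note T0 = unit_transfer[OF \<rho> Nz[unfolded N_def] Nzs[unfolded N_def] limz[unfolded N_def] B(1,2) _ qz]
  have T: "(\<lambda>r. \<pi> \<gamma> (zs r)) \<longlonglongrightarrow> \<pi> \<gamma> z" "(\<lambda>r. \<pi> \<gamma> (zs r + z)) \<longlonglongrightarrow> 2 * \<pi> \<gamma> z" if "\<gamma> \<in> B" for \<gamma>
    using T0(1,2)[OF Bz that] by auto
  show p1: "(\<lambda>r. \<pi> \<gamma> (xs r)) \<longlonglongrightarrow> \<pi> \<gamma> x" if g: "\<gamma> \<in> B" for \<gamma>
  proof -
    have sn: "seminorm (\<pi> \<gamma>)" using g B(2) pi_seminorm by auto
    have "(\<lambda>r. N (xs r) * \<pi> \<gamma> (zs r)) \<longlonglongrightarrow> m * \<pi> \<gamma> z" by (intro tendsto_mult xs T(1) g)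
    moreover have "m * \<pi> \<gamma> z = \<pi> \<gamma> x" using m(2) by (simp add: z_def seminorm_scale[OF sn])
    moreover have "\<forall>\<^sub>F r in sequentially. N (xs r) * \<pi> \<gamma> (zs r) = \<pi> \<gamma> (xs r)"
      using pos by eventually_elim (simp add: zs_eq seminorm_scale[OF sn])
    ultimately show ?thesis using tendsto_cong by force
  qed
  show "(\<lambda>r. \<pi> \<gamma> (xs r + x)) \<longlonglongrightarrow> 2 * \<pi> \<gamma> x" if g: "\<gamma> \<in> B" for \<gamma>
  proof -
    have sn: "seminorm (\<pi> \<gamma>)" using g B(2) pi_seminorm by auto
    have "(\<lambda>r. \<pi> \<gamma> (xs r + x) - m * \<pi> \<gamma> (zs r + z)) \<longlonglongrightarrow> 0"
    proof (rule Lim_null_comparison)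
      show "\<forall>\<^sub>F r in sequentially. norm (\<pi> \<gamma> (xs r + x) - m * \<pi> \<gamma> (zs r + z)) \<le> m * (\<bar>inverse (N (xs r)) - inverse m\<bar> * \<pi> \<gamma> (xs r))"
        using pos
      proof eventually_elim
        case (elim r)
        have "xs r + x - m *\<^sub>R (zs r + z) = (- m * (inverse (N (xs r)) - inverse m)) *\<^sub>R xs r"
          using m(2) by (simp add: zs_eq[OF elim] z_def algebra_simps)
        then have "\<bar>\<pi> \<gamma> (xs r + x) - \<pi> \<gamma> (m *\<^sub>R (zs r + z))\<bar> \<le> \<pi> \<gamma> ((- m * (inverse (N (xs r)) - inverse m)) *\<^sub>R xs r)"
          using seminorm_diff_le[OF sn, of "xs r + x" "m *\<^sub>R (zs r + z)"] by simp
        also have "\<dots> = m * (\<bar>inverse (N (xs r)) - inverse m\<bar> * \<pi> \<gamma> (xs r))"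
          using m(2) unfolding seminorm_scale[OF sn] abs_mult by simp
        finally show ?case using m(2) by (simp add: seminorm_scale[OF sn])
      qed
      show "(\<lambda>r. m * (\<bar>inverse (N (xs r)) - inverse m\<bar> * \<pi> \<gamma> (xs r))) \<longlonglongrightarrow> 0"
        using tendsto_mult_left[OF tendsto_mult[OF inv p1[OF g]], of m] by simp
    qed
    from tendsto_add[OF this tendsto_mult_left[OF T(2)[OF g], of m]]
    have "(\<lambda>r. \<pi> \<gamma> (xs r + x)) \<longlonglongrightarrow> m * (2 * \<pi> \<gamma> z)" by simp
    moreover have "m * (2 * \<pi> \<gamma> z) = 2 * \<pi> \<gamma> x" using m(2) by (simp add: z_def seminorm_scale[OF sn] field_simps)
    ultimately show ?thesis by simp
  qed
  show "\<forall>\<^sub>F r in sequentially. \<sigma> B (xs r) < max (\<sigma> B x) m + e" if e: "0 < e" for e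
  proof -
    have sn: "seminorm (\<sigma> B)" by (rule sigma_seminorm[OF B(1,2)])
    define t where "t = max (\<sigma> B z) 1 + e / (2 * m)"
    have mz: "m * \<sigma> B z = \<sigma> B x" using m(2) by (simp add: z_def seminorm_scale[OF sn])
    have "m * t = max (m * \<sigma> B z) m + e / 2" using m(2) by (simp add: t_def distrib_left max_mult_distrib_left)
    then have mt: "m * t < max (\<sigma> B x) m + e" using mz e by simp
    have e2: "0 < e / (2 * m)" using e m(2) by simp
    have ev: "\<forall>\<^sub>F r in sequentially. \<sigma> B (zs r) < max (\<sigma> B z) 1 + e / (2 * m)"
      by (rule T0(3)[OF _ e2]) (rule Bz)
    have "(\<lambda>r. N (xs r) * t) \<longlonglongrightarrow> m * t" by (intro tendsto_intros xs)
    from order_tendstoD(2)[OF this mt] pos ev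
    show ?thesis
    proof eventually_elim
      case (elim r)
      have "\<sigma> B (xs r) = N (xs r) * \<sigma> B (zs r)" using elim(2) by (simp add: zs_eq seminorm_scale[OF sn])
      also have "\<dots> \<le> N (xs r) * t" using elim by (intro mult_left_mono) (auto simp: t_def)
      finally show ?case using elim(1) by simp
    qed
  qed
qed

text \<open>
  If no score at \<open>x / m0\<close> exceeds the level \<open>n\<close>, the gauge of \<open>x\<close> is at most \<open>m0\<close> for all large radii.
  From below it is bounded independently of the radius by means of the score of a single index.
  Hence the radius can be chosen after the level such that \<open>q\<close> does not interfere at \<open>x\<close> divided by its gauge.
\<close>

lemma good_parameters:
  assumes \<gamma>0: "\<gamma>0 \<in> \<Lambda>" "0 < \<pi> \<gamma>0 x" and m0: "0 < m0"
  shows "\<exists>n \<rho>0. \<forall>\<rho>\<ge>\<rho>0. 0 < \<rho> \<longrightarrow> 0 < level_norm \<Lambda> \<pi> \<sigma> q D n \<rho> x \<and> level_norm \<Lambda> \<pi> \<sigma> q D n \<rho> x \<le> m0 \<and>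
     q x \<le> level_norm \<Lambda> \<pi> \<sigma> q D n \<rho> x * \<rho> / 2"
proof -
  define y where "y = x /\<^sub>R m0"
  define G where "G = {\<gamma>\<in>\<Lambda>. 1 \<le> \<pi> \<gamma> y}"
  have G: "finite G" "G \<subseteq> \<Lambda>" using c0[of 1 y] by (auto simp: G_def)
  define S where "S = (\<Sum>\<gamma>\<in>G. ramp (\<pi> \<gamma> y - 1))"
  obtain n :: nat where n: "S + 1 / 4 \<le> n" using real_arch_simple by blast
  have score_le: "score \<pi> \<sigma> D \<rho> A y \<le> n" if A: "finite A" "A \<subseteq> \<Lambda>" and \<rho>: "0 < \<rho>" "q y \<le> 2 * \<rho>" for A \<rho>
  proof -
    have "(\<Sum>\<gamma>\<in>A. ramp (\<pi> \<gamma> y - 1) - 1) \<le> (\<Sum>\<gamma>\<in>A. ramp (\<pi> \<gamma> y - 1))" by (intro sum_mono) simp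
    also have "\<dots> = (\<Sum>\<gamma>\<in>A \<inter> G. ramp (\<pi> \<gamma> y - 1))"
      using A by (intro sum.mono_neutral_right) (auto simp: G_def intro!: ramp_eq_0)
    also have "\<dots> \<le> S" unfolding S_def using G by (intro sum_mono2) (auto intro: ramp_nonneg)
    finally show ?thesis using tail_bounds(2)[OF A \<rho>] n by (simp add: score_def)
  qed
  \<comment> \<open>A lower bound of the gauge: at \<open>x / l\<close> the index \<open>\<gamma>0\<close> alone has a score of at least \<open>n + 1\<close>.\<close>
  define l where "l = \<pi> \<gamma>0 x / (n + 4)"
  have l: "0 < l" using \<gamma>0(2) by (simp add: l_def)
  define \<rho>0 where "\<rho>0 = max (2 * q x / l) (2 * q x / m0)"
  have "0 < level_norm \<Lambda> \<pi> \<sigma> q D n \<rho> x \<and> level_norm \<Lambda> \<pi> \<sigma> q D n \<rho> x \<le> m0 \<and>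
     q x \<le> level_norm \<Lambda> \<pi> \<sigma> q D n \<rho> x * \<rho> / 2" if \<rho>: "\<rho>0 \<le> \<rho>" "0 < \<rho>" for \<rho>
  proof -
    let ?N = "level_norm \<Lambda> \<pi> \<sigma> q D n \<rho> x" and ?g = "component \<pi> \<sigma> q D n \<rho>" and ?I = "component_index \<Lambda>"
    interpret G: locally_finite_gauge ?I ?g by (rule gauge[OF \<rho>(2)])
    have qx: "q x \<le> l * \<rho> / 2" "q x \<le> m0 * \<rho> / 2"
      using \<rho>(1) l m0 by (auto simp: \<rho>0_def field_simps)
    have qy: "q y \<le> \<rho> / 2" using qx(2) m0 by (simp add: y_def seminorm_scale[OF q_seminorm] field_simps)
    have "?g i y = 0" if "i \<in> ?I" for i
    proof (cases i)
      case None
      have "(1 / \<rho>) * q y - 1 / 2 \<le> 0" using qy \<rho>(2) by (simp add: field_simps)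
      then show ?thesis by (simp add: component_def None ramp_eq_0)
    next
      case (Some A)
      then have "finite A" "A \<subseteq> \<Lambda>" using that by (auto simp: component_index_def)
      then have "score \<pi> \<sigma> D \<rho> A y \<le> n" using \<rho>(2) qy by (intro score_le) auto
      then show ?thesis by (simp add: component_def Some ramp_eq_0)
    qed
    then have "y \<in> joint_sublevel ?I ?g" by (simp add: joint_sublevel_def subset_iff)
    then have 1: "?N \<le> m0" unfolding level_norm_def y_def by (rule G.gauge_le[OF m0])
    have 2: "l \<le> ?N"
    proof (rule ccontr)
      assume "\<not> ?thesis"
      then have "x /\<^sub>R l \<in> joint_sublevel ?I ?g" unfolding level_norm_def by (intro G.gauge_less) simp
      from in_level_set(2)[OF this \<rho>(2), of "{\<gamma>0}"] \<gamma>0(1)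
      have "score \<pi> \<sigma> D \<rho> {\<gamma>0} (x /\<^sub>R l) \<le> n + 1 / 2" by simp
      then have "ramp (\<pi> \<gamma>0 (x /\<^sub>R l) - 1) - 1 \<le> n + 1 / 2"
        using tail_bounds(1)[of "{\<gamma>0}" \<rho> "x /\<^sub>R l"] \<gamma>0(1) \<rho>(2) by (simp add: score_def)
      moreover have "\<pi> \<gamma>0 (x /\<^sub>R l) = n + 4"
        using l \<gamma>0 by (simp add: seminorm_scale[OF pi_seminorm[OF \<gamma>0(1)]] l_def field_simps)
      ultimately show False using ramp_ge[of "\<pi> \<gamma>0 (x /\<^sub>R l) - 1"] by simp
    qed
    have "l * \<rho> \<le> ?N * \<rho>" using 2 \<rho>(2) by (intro mult_right_mono) auto
    then show ?thesis using 1 2 l qx(1) by simp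
  qed
  then show ?thesis by blast
qed

end

section \<open>Weighted square sums of norms\<close>

lemma equi_C_1_limit:
  fixes f :: "nat \<Rightarrow> 'a::real_normed_vector \<Rightarrow> real"
  assumes U: "open U" and C: "\<And>n. equi_C 1 U {f n}"
    and lim: "\<And>x. x \<in> U \<Longrightarrow> (\<lambda>n. f n x) \<longlonglongrightarrow> F x"
    and D: "\<And>x. x \<in> U \<Longrightarrow> \<exists>r>0. ball x r \<subseteq> U \<and> (\<exists>b. b \<longlonglongrightarrow> 0 \<and>
      (\<forall>n. \<forall>y\<in>ball x r. \<forall>h. \<bar>frechet_derivative (f n) (at y) h - D y h\<bar> \<le> b n * norm h))"
  shows "equi_C 1 U {F}"
proof -
  have C': "equi_C (Suc 0) U {f n}" for n using C[of n] by simp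
  have small: "\<exists>r>0. ball x r \<subseteq> U \<and> (\<forall>e>0. \<forall>\<^sub>F n in sequentially. \<forall>y\<in>ball x r. \<forall>h. \<bar>frechet_derivative (f n) (at y) h - D y h\<bar> \<le> e * norm h)"
    if x: "x \<in> U" for x
  proof -
    obtain r b where r: "r > 0" "ball x r \<subseteq> U" "b \<longlonglongrightarrow> 0"
        "\<forall>n. \<forall>y\<in>ball x r. \<forall>h. \<bar>frechet_derivative (f n) (at y) h - D y h\<bar> \<le> b n * norm h"
      using D[OF x] by blast
    have "\<forall>\<^sub>F n in sequentially. \<forall>y\<in>ball x r. \<forall>h. \<bar>frechet_derivative (f n) (at y) h - D y h\<bar> \<le> e * norm h"
      if "e > 0" for e
      using order_tendstoD(2)[OF r(3) that]
    proof eventually_elim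
      case (elim n)
      show ?case
      proof (intro ballI allI)
        fix y and h :: 'a assume "y \<in> ball x r"
        then have "\<bar>frechet_derivative (f n) (at y) h - D y h\<bar> \<le> b n * norm h" using r(4) by blast
        also have "\<dots> \<le> e * norm h" using elim by (intro mult_right_mono) auto
        finally show "\<bar>frechet_derivative (f n) (at y) h - D y h\<bar> \<le> e * norm h" .
      qed
    qed
    then show ?thesis using r(1,2) by blast
  qed
  have der: "(F has_derivative D x) (at x)" if x: "x \<in> U" for x
  proof -
    obtain r where r: "r > 0" "ball x r \<subseteq> U"
        "\<And>e. e > 0 \<Longrightarrow> \<forall>\<^sub>F n in sequentially. \<forall>y\<in>ball x r. \<forall>h. \<bar>frechet_derivative (f n) (at y) h - D y h\<bar> \<le> e * norm h"
      using small[OF x] by blast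
    have "\<exists>g. \<forall>y\<in>ball x r. (\<lambda>n. f n y) \<longlonglongrightarrow> g y \<and> (g has_derivative D y) (at y within ball x r)"
    proof (rule has_derivative_sequence)
      show "(f n has_derivative frechet_derivative (f n) (at y)) (at y within ball x r)" if "y \<in> ball x r" for n y
        using equi_C_SucD(1)[OF C'[of n], of "f n" y] subsetD[OF r(2) that] by (simp add: has_derivative_at_withinI)
      show "\<forall>\<^sub>F n in sequentially. \<forall>y\<in>ball x r. \<forall>h. norm (frechet_derivative (f n) (at y) h - D y h) \<le> e * norm h"
        if "e > 0" for e using r(3)[OF that] by simp
      show "(\<lambda>n. f n x) \<longlonglongrightarrow> F x" by (rule lim[OF x])
    qed (use r in auto)
    then obtain g where g: "\<And>y. y \<in> ball x r \<Longrightarrow> (\<lambda>n. f n y) \<longlonglongrightarrow> g y" "(g has_derivative D x) (at x within ball x r)"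
      using r(1) by (metis centre_in_ball)
    have "g y = F y" if "y \<in> ball x r" for y
      using LIMSEQ_unique[OF g(1)[OF that] lim] that r(2) by blast
    moreover have "(g has_derivative D x) (at x)" using g(2) r(1) by (simp add: at_within_open[of x "ball x r"])
    ultimately show ?thesis using r(1) by (intro has_derivative_transform_within_open[of g "D x" x UNIV "ball x r" F]) auto
  qed
  have "equi_cont U {\<lambda>x. D x h |h. norm h \<le> 1}"
    unfolding equi_cont_def
  proof (intro ballI conjI allI impI)
    fix x assume x: "x \<in> U"
    obtain B where B: "\<And>h. norm (D x h) \<le> norm h * B"
      using bounded_linear.bounded[OF has_derivative_bounded_linear[OF der[OF x]]] by blast
    have "\<bar>D x h\<bar> \<le> \<bar>B\<bar>" if "norm h \<le> 1" for h
    proof -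
      have "norm h * B \<le> norm h * \<bar>B\<bar>" by (intro mult_left_mono) auto
      also have "\<dots> \<le> 1 * \<bar>B\<bar>" using that by (intro mult_right_mono) auto
      finally show ?thesis using B[of h] by simp
    qed
    then show "\<exists>B. \<forall>f\<in>{\<lambda>x. D x h |h. norm h \<le> 1}. \<bar>f x\<bar> \<le> B" by blast
    fix e :: real assume "e > 0"
    then have e: "e / 4 > 0" by simp
    obtain r where r: "r > 0" "ball x r \<subseteq> U"
        "\<And>e. e > 0 \<Longrightarrow> \<forall>\<^sub>F n in sequentially. \<forall>y\<in>ball x r. \<forall>h. \<bar>frechet_derivative (f n) (at y) h - D y h\<bar> \<le> e * norm h"
      using small[OF x] by blast
    obtain n where n: "\<forall>y\<in>ball x r. \<forall>h. \<bar>frechet_derivative (f n) (at y) h - D y h\<bar> \<le> e / 4 * norm h"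
      using eventually_happens[OF r(3)[OF e]] by auto
    have "equi_cont U (derivatives {f n})" using equi_C_SucD(4)[OF C'[of n]] by simp
    then obtain d where d: "d > 0" "\<forall>k\<in>derivatives {f n}. \<forall>y. norm (y - x) < d \<longrightarrow> \<bar>k y - k x\<bar> < e / 4"
      using x e unfolding equi_cont_def by meson
    have "\<bar>D y h - D x h\<bar> < e" if h: "norm h \<le> 1" and y: "norm (y - x) < min d r" for h y
    proof -
      have "(\<lambda>x. frechet_derivative (f n) (at x) h) \<in> derivatives {f n}" by (rule derivativesI) (use h in auto)
      from d(2)[rule_format, OF this, of y] y
      have 1: "\<bar>frechet_derivative (f n) (at y) h - frechet_derivative (f n) (at x) h\<bar> < e / 4" by simp
      have yb: "y \<in> ball x r" "x \<in> ball x r" using y r(1) by (auto simp: dist_norm norm_minus_commute)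
      have 2: "e / 4 * norm h \<le> e / 4" using mult_left_mono[OF h, of "e / 4"] e by simp
      have "\<bar>frechet_derivative (f n) (at y) h - D y h\<bar> \<le> e / 4 * norm h"
        "\<bar>frechet_derivative (f n) (at x) h - D x h\<bar> \<le> e / 4 * norm h" using n yb by blast+
      then show ?thesis using 1 2 e by linarith
    qed
    then show "\<exists>d>0. \<forall>f\<in>{\<lambda>x. D x h |h. norm h \<le> 1}. \<forall>y. norm (y - x) < d \<longrightarrow> \<bar>f y - f x\<bar> < e"
      using d(1) r(1) by (intro exI[of _ "min d r"]) auto
  qed
  then have "equi_C (Suc 0) U {F}"
    by (intro equi_C_singleI[OF U der, where T = "{\<lambda>x. D x h |h. norm h \<le> 1}"]) auto
  then show ?thesis by simp
qed

definition l2_norm :: "(nat \<Rightarrow> real) \<Rightarrow> (nat \<Rightarrow> 'a \<Rightarrow> real) \<Rightarrow> nat \<Rightarrow> 'a \<Rightarrow> real" where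
  "l2_norm w M i x = sqrt (\<Sum>j<i. w j * (M j x)\<^sup>2)"

definition l2_total :: "(nat \<Rightarrow> real) \<Rightarrow> (nat \<Rightarrow> 'a \<Rightarrow> real) \<Rightarrow> 'a \<Rightarrow> real" where
  "l2_total w M x = sqrt (\<Sum>j. w j * (M j x)\<^sup>2)"

lemma l2_norm_eq_L2_set:
  assumes "\<And>j. 0 < w j"
  shows "l2_norm w M i x = L2_set (\<lambda>j. sqrt (w j) * M j x) {..<i}"
  using assms by (simp add: l2_norm_def L2_set_def power_mult_distrib less_imp_le)

lemma l2_norm_seminorm:
  assumes w: "\<And>j. 0 < w j" and M: "\<And>j. seminorm (M j)"
  shows "seminorm (l2_norm w M i)"
  unfolding seminorm_def
proof (intro conjI allI)
  fix x y a
  have "l2_norm w M i (x + y) \<le> L2_set (\<lambda>j. sqrt (w j) * M j x + sqrt (w j) * M j y) {..<i}"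
    unfolding l2_norm_eq_L2_set[where w = w, OF w]
    using seminorm_triangle[OF M] seminorm_nonneg[OF M] w
    by (intro L2_set_mono) (auto simp: less_imp_le intro: mult_left_mono simp flip: distrib_left)
  also have "\<dots> \<le> l2_norm w M i x + l2_norm w M i y"
    unfolding l2_norm_eq_L2_set[where w = w, OF w] by (rule L2_set_triangle_ineq)
  finally show "l2_norm w M i (x + y) \<le> l2_norm w M i x + l2_norm w M i y" .
  have "(\<Sum>j<i. w j * (M j (a *\<^sub>R x))\<^sup>2) = a\<^sup>2 * (\<Sum>j<i. w j * (M j x)\<^sup>2)"
    by (simp add: seminorm_scale[OF M] power_mult_distrib sum_distrib_left mult_ac)
  then show "l2_norm w M i (a *\<^sub>R x) = \<bar>a\<bar> * l2_norm w M i x"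
    by (simp add: l2_norm_def real_sqrt_mult)
qed

lemma l2_norm_compare:
  assumes w: "\<And>j. 0 < w j" and "\<And>j. 0 \<le> M j x" and a: "0 \<le> a" and "\<And>j. j < i \<Longrightarrow> M j x \<le> a * M' j x"
  shows "l2_norm w M i x \<le> a * l2_norm w M' i x"
proof -
  have "l2_norm w M i x \<le> L2_set (\<lambda>j. a * (sqrt (w j) * M' j x)) {..<i}"
    unfolding l2_norm_eq_L2_set[where w = w, OF w]
    using assms by (intro L2_set_mono) (auto simp: mult.left_commute less_imp_le intro: mult_left_mono)
  then show ?thesis unfolding l2_norm_eq_L2_set[where w = w, OF w] by (simp add: L2_set_right_distrib[OF a])
qed

lemma l2_norm_smooth:
  assumes w: "\<And>j. 0 < w j" and i: "0 < i" and pos: "\<And>x. x \<noteq> 0 \<Longrightarrow> 0 < M 0 x"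
    and C: "\<And>j. equi_C n (- {0}) {M j :: 'a::real_normed_vector \<Rightarrow> real}"
  shows "equi_C n (- {0}) {l2_norm w M i}"
proof -
  have sq: "equi_C n (- {0}) {\<lambda>x. \<Sum>j<i. w j * (M j x * M j x)}"
    by (intro equi_C_single_sum equi_C_single_mult equi_C_single_const C) auto
  have "equi_C n (- {0}) {\<lambda>x. sqrt (\<Sum>j<i. w j * (M j x * M j x))}"
  proof (rule equi_C_single_compose[OF _ _ equi_C_sqrt sq])
    fix x :: 'a assume "x \<in> - {0}"
    then have "0 < w 0 * (M 0 x * M 0 x)" using w pos by simp
    also have "\<dots> \<le> (\<Sum>j<i. w j * (M j x * M j x))"
      using i w by (intro member_le_sum[of 0 _ "\<lambda>j. w j * (M j x * M j x)"]) (auto simp: less_imp_le)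
    finally show "(\<Sum>j<i. w j * (M j x * M j x)) \<in> {0<..}" by simp
  qed auto
  then show ?thesis by (simp add: l2_norm_def[abs_def] power2_eq_square)
qed

text \<open>
  The difference quotients of a seminorm in direction \<open>h\<close> are bounded by its value at \<open>h\<close>.
\<close>

lemma seminorm_derivative_le:
  fixes p :: "'a::real_normed_vector \<Rightarrow> real"
  assumes p: "seminorm p" and D: "(p has_derivative D) (at x)"
  shows "\<bar>D h\<bar> \<le> p h"
proof -
  have c: "((\<lambda>t. x + t *\<^sub>R h) has_derivative (\<lambda>t. t *\<^sub>R h)) (at 0)"
    by (auto intro!: derivative_eq_intros)
  have "((\<lambda>t. p (x + t *\<^sub>R h)) has_derivative (\<lambda>t. D (t *\<^sub>R h))) (at 0)"
    by (rule has_derivative_compose[OF c]) (use D in simp)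
  moreover have "D (t *\<^sub>R h) = D h * t" for t
    using linear_scale[OF has_derivative_linear[OF D], of t h] by simp
  ultimately have "((\<lambda>t. p (x + t *\<^sub>R h)) has_real_derivative D h) (at 0)"
    by (simp add: has_field_derivative_def)
  then have lim: "(\<lambda>t. (p (x + t *\<^sub>R h) - p x) / t) \<midarrow>0\<rightarrow> D h" by (simp add: DERIV_def)
  have "\<forall>\<^sub>F t in at 0. \<bar>(p (x + t *\<^sub>R h) - p x) / t\<bar> \<le> p h"
    unfolding eventually_at
  proof (intro exI[of _ 1] conjI ballI impI)
    fix t :: real assume "t \<noteq> 0 \<and> dist t 0 < 1"
    then show "\<bar>(p (x + t *\<^sub>R h) - p x) / t\<bar> \<le> p h"
      using seminorm_diff_le[OF p, of "x + t *\<^sub>R h" x] by (simp add: seminorm_scale[OF p] divide_le_eq mult.commute)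
  qed simp
  from tendsto_upperbound[OF tendsto_rabs[OF lim] this] show ?thesis by simp
qed

text \<open>
  The norm \<open>M 0\<close> makes the total an equivalent norm, and the geometric bound makes the series of
  squares converge uniformly on bounded sets.
\<close>

locale norm_sequence =
  fixes w :: "nat \<Rightarrow> real" and M :: "nat \<Rightarrow> 'a::real_normed_vector \<Rightarrow> real"
  assumes w_pos: "0 < w j" and M_seminorm: "seminorm (M j)"
    and M_bound: "sqrt (w j) * M j x \<le> (1 / 2) ^ j * norm x"
    and M_lower: "\<exists>c>0. \<forall>x. c * norm x \<le> M 0 x"
begin

abbreviation "summand j x \<equiv> w j * (M j x)\<^sup>2"

lemma M_nonneg: "0 \<le> M j x"
  by (rule seminorm_nonneg[OF M_seminorm])

lemma term_nonneg: "0 \<le> summand j x"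
  using w_pos[of j] by simp

lemma product_bound: "w j * (M j x * M j h) \<le> (1 / 2) ^ j * (norm x * norm h)"
proof -
  have "w j * (M j x * M j h) = (sqrt (w j) * M j x) * (sqrt (w j) * M j h)"
    using w_pos[of j] by (simp add: mult_ac)
  also have "\<dots> \<le> ((1 / 2) ^ j * norm x) * ((1 / 2) ^ j * norm h)"
    using M_nonneg w_pos[of j] by (intro mult_mono M_bound) (auto simp: less_imp_le)
  also have "\<dots> = (1 / 2) ^ j * ((1 / 2) ^ j * (norm x * norm h))" by simp
  also have "\<dots> \<le> (1 / 2) ^ j * (1 * (norm x * norm h))"
    by (intro mult_left_mono mult_right_mono power_le_one) auto
  finally show ?thesis by simp
qed

lemma term_le: "summand j x \<le> (1 / 2) ^ j * (norm x)\<^sup>2"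
  using product_bound[of j x x] by (simp add: power2_eq_square)

lemma geometric_summable: "summable (\<lambda>j. (1 / 2) ^ j * (c::real))"
  by (intro summable_mult2 summable_geometric) simp

lemma term_summable: "summable (\<lambda>j. summand j x)"
  by (rule summable_comparison_test[OF _ geometric_summable[of "(norm x)\<^sup>2"]])
     (use term_le term_nonneg in auto)

lemma geometric_tail: "(\<Sum>j. (1 / 2) ^ (j + n) * (c::real)) = 2 * (1 / 2) ^ n * c"
proof -
  have "(\<lambda>j. (1 / 2) ^ j * ((1 / 2) ^ n * c)) sums (2 * ((1 / 2) ^ n * c))"
    using sums_mult2[OF geometric_sums[of "1 / 2 :: real"], of "(1 / 2) ^ n * c"] by simp
  then show ?thesis by (simp add: sums_iff power_add mult.assoc)
qed

abbreviation "N \<equiv> l2_total w M"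

lemma partial_le: "(\<Sum>j<i. summand j x) \<le> (\<Sum>j. summand j x)"
  by (rule sum_le_suminf[OF term_summable]) (auto simp: term_nonneg)

lemma tail_le: "(\<Sum>j. summand j x) - (\<Sum>j<i. summand j x) \<le> 2 * (1 / 2) ^ i * (norm x)\<^sup>2"
proof -
  have "(\<Sum>j. summand j x) - (\<Sum>j<i. summand j x) = (\<Sum>j. summand (j + i) x)"
    using suminf_minus_initial_segment[OF term_summable[of x], of i] by simp
  also have "\<dots> \<le> (\<Sum>j. (1 / 2) ^ (j + i) * (norm x)\<^sup>2)"
    using term_le by (intro suminf_le summable_ignore_initial_segment term_summable geometric_summable)
  finally show ?thesis by (simp add: geometric_tail)
qed

lemma N_sq: "(N x)\<^sup>2 = (\<Sum>j. summand j x)"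
  unfolding l2_total_def by (rule real_sqrt_pow2) (rule suminf_nonneg[OF term_summable term_nonneg])

lemma N_nonneg: "0 \<le> N x"
  unfolding l2_total_def by (simp add: suminf_nonneg[OF term_summable term_nonneg])

lemma partial_tendsto: "(\<lambda>i. l2_norm w M i x) \<longlonglongrightarrow> N x"
  unfolding l2_norm_def l2_total_def by (intro tendsto_real_sqrt summable_LIMSEQ term_summable)

lemma partial_le_N: "l2_norm w M i x \<le> N x"
  unfolding l2_norm_def l2_total_def by (rule real_sqrt_le_mono[OF partial_le])

lemma N_diff_le: "N x - l2_norm w M i x \<le> sqrt (2 * (1 / 2) ^ i) * norm x"
proof -
  define a b where "a = (\<Sum>j<i. summand j x)" and "b = (\<Sum>j. summand j x)"
  have ab: "0 \<le> a" "a \<le> b" using partial_le[where i = i and x = x] by (auto simp: a_def b_def intro: sum_nonneg term_nonneg)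
  have "b = a + (b - a)" by simp
  then have "sqrt b \<le> sqrt a + sqrt (b - a)" using sqrt_add_le_add_sqrt[of a "b - a"] ab by simp
  moreover have "sqrt (b - a) \<le> sqrt (2 * (1 / 2) ^ i * (norm x)\<^sup>2)"
    using tail_le[where x = x and i = i] unfolding a_def b_def by (rule real_sqrt_le_mono)
  ultimately show ?thesis by (simp add: l2_norm_def l2_total_def a_def b_def real_sqrt_mult)
qed

lemma N_seminorm: "seminorm N"
proof -
  note ls = l2_norm_seminorm[of w M, OF w_pos M_seminorm]
  have "N (x + y) \<le> N x + N y" for x y
    by (rule LIMSEQ_le[OF partial_tendsto tendsto_add[OF partial_tendsto partial_tendsto]])
       (use seminorm_triangle[OF ls] in blast)
  moreover have "N (a *\<^sub>R x) = \<bar>a\<bar> * N x" for a x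
  proof -
    have "(\<lambda>i. l2_norm w M i (a *\<^sub>R x)) \<longlonglongrightarrow> \<bar>a\<bar> * N x"
      using tendsto_mult_left[OF partial_tendsto[of x], of "\<bar>a\<bar>"] by (simp add: seminorm_scale[OF ls])
    then show ?thesis by (rule LIMSEQ_unique[OF partial_tendsto])
  qed
  ultimately show ?thesis by (simp add: seminorm_def)
qed

lemma N_upper: "N x \<le> 2 * norm x"
proof -
  have "N x \<le> sqrt 2 * norm x" using N_diff_le[where x = x and i = 0] by (simp add: l2_norm_def)
  also have "\<dots> \<le> 2 * norm x" using real_sqrt_le_mono[of 2 4] by (intro mult_right_mono) auto
  finally show ?thesis .
qed

lemma N_lower: "\<exists>c>0. \<forall>x. c * norm x \<le> N x"
proof -
  obtain c where c: "c > 0" "\<forall>x. c * norm x \<le> M 0 x" using M_lower by blast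
  have "(sqrt (w 0) * c) * norm x \<le> N x" for x
  proof -
    have "(sqrt (w 0) * c) * norm x \<le> sqrt (w 0) * M 0 x"
      using c(2) w_pos[of 0] by (simp add: mult.assoc mult_left_mono)
    also have "\<dots> = l2_norm w M 1 x" using w_pos[of 0] M_nonneg[of 0 x] by (simp add: l2_norm_def real_sqrt_mult)
    also have "\<dots> \<le> N x" by (rule partial_le_N)
    finally show ?thesis .
  qed
  then show ?thesis using c(1) w_pos[of 0] by (intro exI[of _ "sqrt (w 0) * c"]) auto
qed

lemma N_equivalent: "equivalent_norm_on UNIV N"
  by (rule equivalent_norm_onI[OF N_seminorm N_lower]) (use N_upper in \<open>auto intro: exI[of _ 2]\<close>)

text \<open>
  The derivative of the square of \<open>M j\<close> at \<open>y\<close> in direction \<open>h\<close> is bounded by \<open>2 * M j y * M j h\<close>.  With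
  the weights this is summable, uniformly for \<open>y\<close> near a given point and \<open>h\<close> in the unit ball.
\<close>

lemma N_smooth:
  assumes C: "\<And>j. equi_C 1 (- {0}) {M j}"
  shows "equi_C 1 (- {0}) {N}"
proof -
  define f where "f = (\<lambda>n x. \<Sum>j<n. w j * (M j x * M j x))"
  define d where "d = (\<lambda>j x h. w j * (M j x * frechet_derivative (M j) (at x) h + frechet_derivative (M j) (at x) h * M j x))"
  have dM: "(M j has_derivative frechet_derivative (M j) (at x)) (at x)" if "x \<noteq> 0" for j x
    using C[of j] that by (intro equi_C_SucD(1)[of 0 "- {0}"]) auto
  have dbound: "\<bar>d j x h\<bar> \<le> (1 / 2) ^ j * (2 * norm x * norm h)" if "x \<noteq> 0" for j x h
  proof -
    have "\<bar>d j x h\<bar> = 2 * (w j * (M j x * \<bar>frechet_derivative (M j) (at x) h\<bar>))"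
      using w_pos[of j] M_nonneg[of j x] by (simp add: d_def abs_mult mult_ac)
    also have "\<dots> \<le> 2 * (w j * (M j x * M j h))"
      using w_pos[of j] M_nonneg[of j x] seminorm_derivative_le[OF M_seminorm dM[OF that]]
      by (intro mult_left_mono) (auto simp: less_imp_le)
    also have "\<dots> \<le> 2 * ((1 / 2) ^ j * (norm x * norm h))" by (intro mult_left_mono product_bound) auto
    finally show ?thesis by simp
  qed
  have fd: "frechet_derivative (f n) (at x) = (\<lambda>h. \<Sum>j<n. d j x h)" if "x \<noteq> 0" for n x
  proof -
    have "(f n has_derivative (\<lambda>h. \<Sum>j<n. d j x h)) (at x)" unfolding f_def d_def
      by (intro has_derivative_sum has_derivative_mult_right has_derivative_mult dM that)
    then show ?thesis using frechet_derivative_at by metis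
  qed
  have fC: "equi_C 1 (- {0}) {f n}" for n unfolding f_def
    by (intro equi_C_single_sum equi_C_single_mult equi_C_single_const C) auto
  have "equi_C 1 (- {0}) {\<lambda>x. (N x)\<^sup>2}"
  proof (rule equi_C_1_limit[OF _ fC, where D = "\<lambda>x h. \<Sum>j. d j x h"])
    show "(\<lambda>n. f n x) \<longlonglongrightarrow> (N x)\<^sup>2" for x
      using summable_LIMSEQ[OF term_summable[of x]] unfolding N_sq f_def by (simp add: power2_eq_square)
    fix x :: 'a assume "x \<in> - {0}"
    then have x: "x \<noteq> 0" by simp
    define b where "b = (\<lambda>n. 2 * (1 / 2) ^ n * (4 * norm x) :: real)"
    have "b \<longlonglongrightarrow> 2 * 0 * (4 * norm x)" unfolding b_def by (intro tendsto_intros LIMSEQ_realpow_zero) auto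
    then have b0: "b \<longlonglongrightarrow> 0" by simp
    have "\<bar>frechet_derivative (f n) (at y) h - (\<Sum>j. d j y h)\<bar> \<le> b n * norm h" if y: "y \<in> ball x (norm x)" for n y h
    proof -
      have y': "y \<noteq> 0" "norm y \<le> 2 * norm x" using y norm_triangle_ineq2[of y x] by (auto simp: dist_norm norm_minus_commute)
      have sa: "summable (\<lambda>j. \<bar>d j y h\<bar>)"
        by (rule summable_comparison_test[OF _ geometric_summable[of "2 * norm y * norm h"]]) (use dbound[OF y'(1)] in auto)
      then have s: "summable (\<lambda>j. d j y h)" by (rule summable_rabs_cancel)
      have "(\<Sum>j. d j y h) - (\<Sum>j<n. d j y h) = (\<Sum>j. d (j + n) y h)"
        using suminf_minus_initial_segment[OF s, of n] by simp
      then have "\<bar>frechet_derivative (f n) (at y) h - (\<Sum>j. d j y h)\<bar> = \<bar>\<Sum>j. d (j + n) y h\<bar>"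
        unfolding fd[OF y'(1)] by (simp add: abs_minus_commute)
      also have "\<dots> \<le> (\<Sum>j. \<bar>d (j + n) y h\<bar>)"
        by (rule summable_rabs) (rule summable_ignore_initial_segment[OF sa])
      also have "\<dots> \<le> (\<Sum>j. (1 / 2) ^ (j + n) * (2 * norm y * norm h))"
        using dbound[OF y'(1)]
        by (intro suminf_le summable_ignore_initial_segment[OF sa] summable_ignore_initial_segment geometric_summable) auto
      also have "\<dots> = 2 * (1 / 2) ^ n * (2 * norm y * norm h)" by (rule geometric_tail)
      also have "\<dots> \<le> 2 * (1 / 2) ^ n * (4 * norm x * norm h)"
        using y'(2) by (intro mult_left_mono mult_right_mono) auto
      finally show ?thesis by (simp add: b_def mult.assoc)
    qed
    moreover have "ball x (norm x) \<subseteq> - {0}" by (auto simp: dist_norm)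
    ultimately show "\<exists>r>0. ball x r \<subseteq> - {0} \<and> (\<exists>b. b \<longlonglongrightarrow> 0 \<and>
      (\<forall>n. \<forall>y\<in>ball x r. \<forall>h. \<bar>frechet_derivative (f n) (at y) h - (\<Sum>j. d j y h)\<bar> \<le> b n * norm h))"
      using x b0 by (intro exI[of _ "norm x"]) auto
  qed auto
  note sq = this
  have "equi_C 1 (- {0}) {\<lambda>x. sqrt ((N x)\<^sup>2)}"
  proof (rule equi_C_single_compose[OF _ _ equi_C_sqrt sq])
    fix x :: 'a assume "x \<in> - {0}"
    then have "0 < N x" using equivalent_norm_on_UNIV_D(2)[OF N_equivalent] by simp
    then show "(N x)\<^sup>2 \<in> {0<..}" by simp
  qed auto
  then show ?thesis using N_nonneg by simp
qed

text \<open>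
  The expression in the LUR condition is the weighted sum of the corresponding expressions for the
  norms \<open>M j\<close>, all of which are nonnegative.
\<close>

lemma gap_transfer:
  assumes lim: "(\<lambda>r. 2 * (N (xs r))\<^sup>2 + 2 * (N x)\<^sup>2 - (N (xs r + x))\<^sup>2) \<longlonglongrightarrow> 0"
  shows "(\<lambda>r. M j (xs r)) \<longlonglongrightarrow> M j x" and "(\<lambda>r. M j (xs r + x)) \<longlonglongrightarrow> 2 * M j x"
proof -
  define G where "G = (\<lambda>j r. 2 * (M j (xs r))\<^sup>2 + 2 * (M j x)\<^sup>2 - (M j (xs r + x))\<^sup>2)"
  have G1: "(M j (xs r) - M j x)\<^sup>2 \<le> G j r" for j r
  proof -
    have "(M j (xs r + x))\<^sup>2 \<le> (M j (xs r) + M j x)\<^sup>2"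
      by (intro power_mono seminorm_triangle[OF M_seminorm] M_nonneg)
    then show ?thesis by (simp add: G_def power2_eq_square algebra_simps)
  qed
  then have G0: "0 \<le> G j r" for j r using order_trans[OF zero_le_power2] by blast
  have "(\<lambda>j. 2 * summand j (xs r) + 2 * summand j x - summand j (xs r + x)) sums
      (2 * (N (xs r))\<^sup>2 + 2 * (N x)\<^sup>2 - (N (xs r + x))\<^sup>2)" for r
    unfolding N_sq by (intro sums_diff sums_add sums_mult summable_sums term_summable)
  then have sums: "(\<lambda>j. w j * G j r) sums (2 * (N (xs r))\<^sup>2 + 2 * (N x)\<^sup>2 - (N (xs r + x))\<^sup>2)" for r
    by (simp add: G_def algebra_simps)
  have le: "w j * G j r \<le> 2 * (N (xs r))\<^sup>2 + 2 * (N x)\<^sup>2 - (N (xs r + x))\<^sup>2" for r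
  proof -
    have "(\<Sum>k\<in>{j}. w k * G k r) \<le> (\<Sum>k. w k * G k r)"
      using sums[of r] w_pos G0 by (intro sum_le_suminf) (auto simp: sums_iff less_imp_le)
    then show ?thesis using sums[of r] by (simp add: sums_iff)
  qed
  have "(\<lambda>r. w j * G j r) \<longlonglongrightarrow> 0"
    by (rule tendsto_sandwich[OF _ _ tendsto_const lim]) (use le w_pos G0 in \<open>auto simp: less_imp_le\<close>)
  from tendsto_mult_left[OF this, of "inverse (w j)"] have G: "G j \<longlonglongrightarrow> 0"
    using w_pos[of j] by (simp add: mult.assoc[symmetric])
  have "(\<lambda>r. (M j (xs r) - M j x)\<^sup>2) \<longlonglongrightarrow> 0"
    by (rule tendsto_sandwich[OF _ _ tendsto_const G]) (use G1 in auto)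
  from tendsto_real_sqrt[OF this] have "(\<lambda>r. \<bar>M j (xs r) - M j x\<bar>) \<longlonglongrightarrow> 0" by simp
  then have "(\<lambda>r. M j (xs r) - M j x) \<longlonglongrightarrow> 0" by (rule tendsto_rabs_zero_cancel)
  then show 1: "(\<lambda>r. M j (xs r)) \<longlonglongrightarrow> M j x" by (rule LIM_zero_cancel)
  have "(\<lambda>r. 2 * (M j (xs r))\<^sup>2 + 2 * (M j x)\<^sup>2 - G j r) \<longlonglongrightarrow> 2 * (M j x)\<^sup>2 + 2 * (M j x)\<^sup>2 - 0"
    by (intro tendsto_intros 1 G)
  then have "(\<lambda>r. (M j (xs r + x))\<^sup>2) \<longlonglongrightarrow> (2 * M j x)\<^sup>2" by (simp add: G_def power_mult_distrib)
  from tendsto_real_sqrt[OF this] have "(\<lambda>r. \<bar>M j (xs r + x)\<bar>) \<longlonglongrightarrow> \<bar>2 * M j x\<bar>"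
    by (simp only: real_sqrt_abs)
  then show "(\<lambda>r. M j (xs r + x)) \<longlonglongrightarrow> 2 * M j x" using M_nonneg by simp
qed

text \<open>
  Two errors tend to \<open>0\<close>: the truncation of the series and the factor \<open>a i\<close> by which the norms are
  changed.
\<close>

lemma N_limit:
  assumes a: "a \<longlonglongrightarrow> 1" "\<And>i. 1 \<le> a i" and M': "\<And>i j. seminorm (M' i j)"
    and le: "\<And>i j x. M' i j x \<le> a i * M j x" "\<And>i j x. M j x \<le> a i * M' i j x"
    and B: "bounded B"
  shows "uniform_limit B (\<lambda>i. l2_norm w (M' i) (Suc i)) N sequentially"
proof -
  have est: "\<bar>l2_norm w (M' i) (Suc i) x - N x\<bar> \<le> (2 * (a i - 1) + sqrt (2 * (1 / 2) ^ Suc i)) * norm x" for i x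
  proof -
    define u v where "u = l2_norm w (M' i) (Suc i) x" and "v = l2_norm w M (Suc i) x"
    have u: "u \<le> a i * v" unfolding u_def v_def
      using a(2)[of i] le seminorm_nonneg[OF M'] by (intro l2_norm_compare w_pos) auto
    have v: "v \<le> a i * u" unfolding u_def v_def
      using a(2)[of i] le M_nonneg by (intro l2_norm_compare w_pos) auto
    have vN: "v \<le> N x" "N x - v \<le> sqrt (2 * (1 / 2) ^ Suc i) * norm x"
      unfolding v_def by (rule partial_le_N, rule N_diff_le)
    have a1: "0 \<le> a i - 1" using a(2) by simp
    have N2: "(a i - 1) * N x \<le> (a i - 1) * (2 * norm x)" using a1 N_upper by (intro mult_left_mono)
    have s: "0 \<le> sqrt (2 * (1 / 2) ^ Suc i) * norm x" by (intro mult_nonneg_nonneg) auto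
    have "(a i - 1) * v \<le> (a i - 1) * N x" using a1 vN by (intro mult_left_mono)
    then have up: "u - N x \<le> (a i - 1) * N x" using u vN(1) by (simp add: algebra_simps)
    have lo: "v - u \<le> (a i - 1) * N x"
    proof (cases "u \<le> v")
      case True
      have "v - u \<le> (a i - 1) * u" using v by (simp add: algebra_simps)
      also have "\<dots> \<le> (a i - 1) * N x" using a1 True vN(1) by (intro mult_left_mono) auto
      finally show ?thesis .
    next
      case False
      then have "v - u \<le> 0" by simp
      also have "0 \<le> (a i - 1) * N x" using a1 N_nonneg by simp
      finally show ?thesis .
    qed
    have "\<bar>u - N x\<bar> \<le> (a i - 1) * (2 * norm x) + sqrt (2 * (1 / 2) ^ Suc i) * norm x"
      using up lo vN N2 s by linarith
    then show ?thesis by (simp add: u_def algebra_simps)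
  qed
  obtain R where R: "\<forall>x\<in>B. norm x \<le> R" using B unfolding bounded_iff by blast
  have "(\<lambda>i. 2 * (a i - 1) + sqrt (2 * (1 / 2) ^ Suc i)) \<longlonglongrightarrow> 2 * (1 - 1) + sqrt (2 * 0)"
    by (intro tendsto_intros a LIMSEQ_Suc[OF LIMSEQ_realpow_zero]) auto
  then have z: "(\<lambda>i. (2 * (a i - 1) + sqrt (2 * (1 / 2) ^ Suc i)) * \<bar>R\<bar>) \<longlonglongrightarrow> 0"
    using tendsto_mult_right[of _ 0 sequentially "\<bar>R\<bar>"] by force
  show ?thesis
  proof (rule uniform_limitI)
    fix e :: real assume "0 < e"
    from order_tendstoD(2)[OF z this]
    show "\<forall>\<^sub>F i in sequentially. \<forall>x\<in>B. dist (l2_norm w (M' i) (Suc i) x) (N x) < e"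
    proof eventually_elim
      case (elim i)
      show ?case
      proof
        fix x assume "x \<in> B"
        then have "norm x \<le> \<bar>R\<bar>" using R by force
        moreover have "0 \<le> 2 * (a i - 1) + sqrt (2 * (1 / 2) ^ Suc i)" using a(2)[of i] by simp
        ultimately have "(2 * (a i - 1) + sqrt (2 * (1 / 2) ^ Suc i)) * norm x \<le> (2 * (a i - 1) + sqrt (2 * (1 / 2) ^ Suc i)) * \<bar>R\<bar>"
          by (intro mult_left_mono)
        then show "dist (l2_norm w (M' i) (Suc i) x) (N x) < e" using est[of i x] elim by (simp add: dist_norm)
      qed
    qed
  qed
qed

end

section \<open>Orthogonal decompositions from projectional resolutions\<close>

text \<open>
  The properties of the differences of a projectional resolution of identity on which the renorming
  is based, free of the ordering of the index set.
\<close>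

locale orthogonal_decomposition =
  fixes \<Lambda> :: "'i set" and Q :: "'i \<Rightarrow> 'a::real_normed_vector \<Rightarrow> 'a"
  assumes Q_linear: "\<gamma> \<in> \<Lambda> \<Longrightarrow> linear (Q \<gamma>)"
    and Q_norm: "\<gamma> \<in> \<Lambda> \<Longrightarrow> norm (Q \<gamma> x) \<le> 2 * norm x"
    and Q_idem: "\<gamma> \<in> \<Lambda> \<Longrightarrow> Q \<gamma> (Q \<gamma> x) = Q \<gamma> x"
    and Q_orth: "\<gamma> \<in> \<Lambda> \<Longrightarrow> \<delta> \<in> \<Lambda> \<Longrightarrow> \<gamma> \<noteq> \<delta> \<Longrightarrow> Q \<gamma> (Q \<delta> x) = 0"
    and approximation: "0 < e \<Longrightarrow> \<exists>A. finite A \<and> A \<subseteq> \<Lambda> \<and> norm (x - (\<Sum>\<gamma>\<in>A. Q \<gamma> x)) < e"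

lemma ord_zero_le: "ord_zero \<le> (\<alpha> :: 'i::wellorder)"
  unfolding ord_zero_def by (rule Least_le) simp

lemma ord_succ_le: "\<alpha> < \<beta> \<Longrightarrow> ord_succ \<alpha> \<le> \<beta>"
  unfolding ord_succ_def by (rule Least_le)

lemma less_ord_succ: "\<alpha> < \<beta> \<Longrightarrow> \<alpha> < ord_succ \<alpha>"
  unfolding ord_succ_def by (rule LeastI)

text \<open>
  A dense subset of a nonzero normed space is infinite, since finite sets are closed.  This excludes
  the degenerate situation that the ordinal \<open>\<mu>\<close> is finite and \<open>\<omega>\<close> lies beyond it.
\<close>

lemma infinite_below_density_ordinal:
  fixes \<mu> :: "'i::wellorder" and y :: "'a::real_normed_vector"
  assumes \<mu>: "is_density_ordinal TYPE('a) \<mu>" and y: "y \<noteq> 0"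
  shows "infinite {..<\<mu>}"
proof -
  let ?P = "\<lambda>D :: 'a set. dense_subset_of D UNIV \<and> (\<forall>E. dense_subset_of E (UNIV :: 'a set) \<longrightarrow> |D| \<le>o |E| )"
  define R where "R = {|E| |E. dense_subset_of E (UNIV :: 'a set)}"
  have "dense_subset_of (UNIV :: 'a set) UNIV" by (simp add: dense_subset_of_def)
  then have "R \<noteq> {}" by (auto simp: R_def)
  moreover have "\<forall>r\<in>R. Card_order r" by (auto simp: R_def card_of_Card_order)
  ultimately obtain r where "r \<in> R" "\<forall>r'\<in>R. r \<le>o r'" using exists_minim_Card_order by blast
  then have "\<exists>D. ?P D" by (auto simp: R_def)
  from someI_ex[OF this] have D: "?P (SOME D. ?P D)" .
  define D where "D = (SOME D. ?P D)"
  have dense: "UNIV \<subseteq> closure D" using D by (simp add: D_def dense_subset_of_def)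
  have iso: "|{..<\<mu>}| =o |D|" using \<mu> by (simp add: is_density_ordinal_def dens_def D_def)
  have "inj (\<lambda>n. real n *\<^sub>R y)" using y by (intro injI) simp
  then have "infinite (UNIV :: 'a set)" using finite_imageD infinite_UNIV_nat finite_subset by (metis top_greatest)
  then have "infinite D" using dense finite_imp_closed[of D] by (metis closure_closed finite_subset)
  then show ?thesis using card_of_ordIso_finite[OF iso] by simp
qed

text \<open>
  Orthogonality of the differences is computed from \<open>P \<alpha> P \<beta> = P (min \<alpha> \<beta>)\<close>.  The approximation of
  \<open>P \<alpha> x\<close> by finite sums of the \<open>Q \<gamma> x\<close> with coefficients \<open>1\<close> goes by transfinite induction: by density
  of the union of ranges, \<open>P \<alpha> x\<close> is close to \<open>P (ord_succ \<beta>) x = P \<beta> x + Q \<beta> x\<close> for some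
  \<open>\<beta> < \<alpha>\<close>.
\<close>

lemma PRI_orthogonal_decomposition:
  fixes P :: "'i::wellorder \<Rightarrow> 'a::real_normed_vector \<Rightarrow> 'a" and y :: 'a
  assumes PRI: "PRI \<mu> P" and y: "y \<noteq> 0"
  shows "orthogonal_decomposition (PRI_index \<mu>) (PRI_diff P)"
proof -
  define \<omega> where "\<omega> = (ord_omega :: 'i)"
  have inf: "infinite {..<\<mu>}"
    by (rule infinite_below_density_ordinal[OF _ y]) (use PRI in \<open>simp add: PRI_def\<close>)
  have \<omega>\<mu>: "\<omega> \<le> \<mu>" unfolding \<omega>_def ord_omega_def by (rule Least_le) (rule inf)
  have inf\<omega>: "infinite {..<\<omega>}" unfolding \<omega>_def ord_omega_def by (rule LeastI) (rule inf)
  have zero_less: "ord_zero < \<omega>"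
  proof (rule ccontr)
    assume "\<not> ?thesis"
    then have "\<not> x < \<omega>" for x using ord_zero_le[of x] by order
    then have "{..<\<omega>} = {}" by auto
    then show False using inf\<omega> by simp
  qed
  have bl: "bounded_linear (P \<alpha>)" and on: "onorm (P \<alpha>) = 1" if "\<omega> \<le> \<alpha>" "\<alpha> \<le> \<mu>" for \<alpha>
    using PRI that by (auto simp: PRI_def \<omega>_def)
  have lin: "linear (P \<alpha>)" if "\<omega> \<le> \<alpha>" "\<alpha> \<le> \<mu>" for \<alpha> using bounded_linear.linear[OF bl[OF that]] .
  have norm_le: "norm (P \<alpha> x) \<le> norm x" if "\<omega> \<le> \<alpha>" "\<alpha> \<le> \<mu>" for \<alpha> x
    using onorm[OF bl[OF that], of x] on[OF that] by simp
  have comp1: "P \<alpha> (P \<beta> x) = P \<alpha> x" and comp2: "P \<beta> (P \<alpha> x) = P \<alpha> x" if "\<omega> \<le> \<alpha>" "\<alpha> \<le> \<beta>" "\<beta> \<le> \<mu>" for \<alpha> \<beta> x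
  proof -
    have "P \<alpha> \<circ> P \<beta> = P \<alpha> \<and> P \<beta> \<circ> P \<alpha> = P \<alpha>" using PRI that by (auto simp: PRI_def \<omega>_def)
    then show "P \<alpha> (P \<beta> x) = P \<alpha> x" "P \<beta> (P \<alpha> x) = P \<alpha> x" by (metis comp_apply)+
  qed
  have Pmu: "P \<mu> = id" using PRI by (simp add: PRI_def)
  have dense: "range (P \<alpha>) \<subseteq> closure (\<Union>\<beta>\<in>{\<omega>..<\<alpha>}. range (P (ord_succ \<beta>)))" if "\<omega> < \<alpha>" "\<alpha> \<le> \<mu>" for \<alpha>
    using PRI that by (auto simp: PRI_def \<omega>_def dense_subset_of_def)
  define Q where "Q = PRI_diff P"
  have Q0: "Q ord_zero = P \<omega>" by (simp add: Q_def PRI_diff_def \<omega>_def)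
  have Q1: "Q \<gamma> = (\<lambda>x. P (ord_succ \<gamma>) x - P \<gamma> x)" if "\<omega> \<le> \<gamma>" for \<gamma>
    using that zero_less by (auto simp: Q_def PRI_diff_def)
  have s: "\<gamma> \<le> ord_succ \<gamma>" "ord_succ \<gamma> \<le> \<mu>" "\<omega> \<le> ord_succ \<gamma>" "\<gamma> \<le> \<mu>" if "\<omega> \<le> \<gamma>" "\<gamma> < \<mu>" for \<gamma>
    using less_ord_succ[OF that(2)] ord_succ_le[OF that(2)] that by auto
  have idx: "\<gamma> \<in> PRI_index \<mu> \<longleftrightarrow> \<gamma> = ord_zero \<or> (\<omega> \<le> \<gamma> \<and> \<gamma> < \<mu>)" for \<gamma>
    by (auto simp: PRI_index_def \<omega>_def)
  have approx: "\<exists>A. finite A \<and> A \<subseteq> insert ord_zero {\<omega>..<\<alpha>} \<and> norm (P \<alpha> x - (\<Sum>\<gamma>\<in>A. Q \<gamma> x)) < e"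
    if "\<omega> \<le> \<alpha>" "\<alpha> \<le> \<mu>" "0 < e" for \<alpha> x and e :: real
    using that
  proof (induction \<alpha> arbitrary: e rule: less_induct)
    case (less \<alpha>)
    show ?case
    proof (cases "\<alpha> = \<omega>")
      case True
      then show ?thesis using less.prems by (intro exI[of _ "{ord_zero}"]) (simp add: Q0)
    next
      case False
      then have \<alpha>: "\<omega> < \<alpha>" "\<alpha> \<le> \<mu>" using less.prems by auto
      have e3: "e / 3 > 0" using less.prems by simp
      have "P \<alpha> x \<in> closure (\<Union>\<beta>\<in>{\<omega>..<\<alpha>}. range (P (ord_succ \<beta>)))" using dense[OF \<alpha>] by auto
      then obtain z \<beta> where \<beta>: "\<omega> \<le> \<beta>" "\<beta> < \<alpha>" "dist (P (ord_succ \<beta>) z) (P \<alpha> x) < e / 3"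
        using e3 unfolding closure_approachable by (metis (no_types, lifting) UN_E atLeastLessThan_iff imageE)
      have b\<mu>: "\<beta> < \<mu>" using \<beta> \<alpha> by auto
      note sb = s[OF \<beta>(1) b\<mu>]
      have sba: "ord_succ \<beta> \<le> \<alpha>" by (rule ord_succ_le[OF \<beta>(2)])
      have "P (ord_succ \<beta>) (P \<alpha> x - P (ord_succ \<beta>) z) = P (ord_succ \<beta>) x - P (ord_succ \<beta>) z"
        using linear_diff[OF lin[OF sb(3,2)]] comp1[OF sb(3) sba \<alpha>(2)] comp1[OF sb(3) order_refl sb(2)] by simp
      then have "norm (P (ord_succ \<beta>) x - P (ord_succ \<beta>) z) \<le> norm (P \<alpha> x - P (ord_succ \<beta>) z)"
        using norm_le[OF sb(3,2), of "P \<alpha> x - P (ord_succ \<beta>) z"] by simp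
      then have 1: "norm (P \<alpha> x - P (ord_succ \<beta>) x) < e / 3 + e / 3"
        using \<beta>(3) norm_triangle_ineq4[of "P \<alpha> x - P (ord_succ \<beta>) z" "P (ord_succ \<beta>) x - P (ord_succ \<beta>) z"]
        by (simp add: dist_norm norm_minus_commute)
      obtain A where A: "finite A" "A \<subseteq> insert ord_zero {\<omega>..<\<beta>}" "norm (P \<beta> x - (\<Sum>\<gamma>\<in>A. Q \<gamma> x)) < e / 3"
        using less.IH[OF \<beta>(2) \<beta>(1) sb(4) e3] by blast
      have bA: "\<beta> \<notin> A" using A(2) \<beta>(1) zero_less by auto
      have eq: "P \<alpha> x - (\<Sum>\<gamma>\<in>insert \<beta> A. Q \<gamma> x) = (P \<alpha> x - P (ord_succ \<beta>) x) + (P \<beta> x - (\<Sum>\<gamma>\<in>A. Q \<gamma> x))"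
        using A(1) bA by (simp add: Q1[OF \<beta>(1)])
      have "norm (P \<alpha> x - (\<Sum>\<gamma>\<in>insert \<beta> A. Q \<gamma> x)) < e"
        unfolding eq using norm_triangle_ineq[of "P \<alpha> x - P (ord_succ \<beta>) x" "P \<beta> x - (\<Sum>\<gamma>\<in>A. Q \<gamma> x)"] 1 A(3) by linarith
      moreover have "insert \<beta> A \<subseteq> insert ord_zero {\<omega>..<\<alpha>}"
      proof -
        have "{\<omega>..<\<beta>} \<subseteq> {\<omega>..<\<alpha>}" using \<beta>(2) by auto
        moreover have "\<beta> \<in> {\<omega>..<\<alpha>}" using \<beta>(1,2) by simp
        ultimately show ?thesis using A(2) by blast
      qed
      ultimately show ?thesis using A(1) by blast
    qed
  qed
  show ?thesis unfolding Q_def[symmetric]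
  proof (rule orthogonal_decomposition.intro)
    fix \<gamma> assume g: "\<gamma> \<in> PRI_index \<mu>"
    show "linear (Q \<gamma>)"
    proof (cases "\<gamma> = ord_zero")
      case True
      then show ?thesis using lin \<omega>\<mu> by (simp add: Q0)
    next
      case False
      then have g': "\<omega> \<le> \<gamma>" "\<gamma> < \<mu>" using g idx by auto
      show ?thesis unfolding Q1[OF g'(1)] by (intro linear_compose_sub lin s[OF g'] g')
    qed
    fix x :: 'a
    show "norm (Q \<gamma> x) \<le> 2 * norm x"
    proof (cases "\<gamma> = ord_zero")
      case True
      then show ?thesis using norm_le[OF order_refl \<omega>\<mu>, of x] norm_ge_zero[of x] unfolding True Q0 by linarith
    next
      case False
      then have g': "\<omega> \<le> \<gamma>" "\<gamma> < \<mu>" using g idx by auto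
      show ?thesis unfolding Q1[OF g'(1)]
        using norm_triangle_ineq4[of "P (ord_succ \<gamma>) x" "P \<gamma> x"] norm_le[OF s(3,2)[OF g'], of x] norm_le[OF g'(1) s(4)[OF g'], of x]
        by linarith
    qed
    show "Q \<gamma> (Q \<gamma> x) = Q \<gamma> x"
    proof (cases "\<gamma> = ord_zero")
      case True
      then show ?thesis using comp1[of \<omega> \<omega> x] \<omega>\<mu> by (simp add: Q0)
    next
      case False
      then have g': "\<omega> \<le> \<gamma>" "\<gamma> < \<mu>" using g idx by auto
      note sg = s[OF g']
      show ?thesis unfolding Q1[OF g'(1)]
        using linear_diff[OF lin[OF sg(3,2)]] linear_diff[OF lin[OF g'(1) sg(4)]]
          comp1[OF sg(3) order_refl sg(2)] comp2[OF g'(1) sg(1,2)] comp1[OF g'(1) sg(1,2)] comp1[OF g'(1) order_refl sg(4)]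
        by simp
    qed
    fix \<delta> assume d: "\<delta> \<in> PRI_index \<mu>" and ne: "\<gamma> \<noteq> \<delta>"
    show "Q \<gamma> (Q \<delta> x) = 0"
    proof -
      consider "\<gamma> = ord_zero" "\<omega> \<le> \<delta>" "\<delta> < \<mu>" | "\<delta> = ord_zero" "\<omega> \<le> \<gamma>" "\<gamma> < \<mu>"
        | "\<omega> \<le> \<gamma>" "\<gamma> < \<delta>" "\<delta> < \<mu>" | "\<omega> \<le> \<delta>" "\<delta> < \<gamma>" "\<gamma> < \<mu>"
        using g d ne idx by (metis neqE)
      then show ?thesis
      proof cases
        case 1
        note sd = s[OF 1(2,3)]
        show ?thesis unfolding 1(1) Q0 Q1[OF 1(2)]
          using linear_diff[OF lin[OF order_refl \<omega>\<mu>]] comp1[OF order_refl sd(3,2)] comp1[OF order_refl 1(2) sd(4)] by simp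
      next
        case 2
        note sg = s[OF 2(2,3)]
        show ?thesis unfolding 2(1) Q0 Q1[OF 2(2)]
          using comp2[OF order_refl sg(3,2)] comp2[OF order_refl 2(2) sg(4)] by simp
      next
        case 3
        have g': "\<gamma> < \<mu>" and d': "\<omega> \<le> \<delta>" using 3 by auto
        note sg = s[OF 3(1) g'] and sd = s[OF d' 3(3)]
        have le: "ord_succ \<gamma> \<le> \<delta>" "\<gamma> \<le> \<delta>" "ord_succ \<gamma> \<le> ord_succ \<delta>" "\<gamma> \<le> ord_succ \<delta>"
          using ord_succ_le[OF 3(2)] 3(2) sd(1) by auto
        show ?thesis unfolding Q1[OF 3(1)] Q1[OF d']
          using linear_diff[OF lin[OF sg(3,2)]] linear_diff[OF lin[OF 3(1) sg(4)]]
            comp1[OF sg(3) le(3) sd(2)] comp1[OF sg(3) le(1) sd(4)] comp1[OF 3(1) le(4) sd(2)] comp1[OF 3(1) le(2) sd(4)]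
          by simp
      next
        case 4
        have d': "\<delta> < \<mu>" and g': "\<omega> \<le> \<gamma>" using 4 by auto
        note sg = s[OF g' 4(3)] and sd = s[OF 4(1) d']
        have le: "ord_succ \<delta> \<le> \<gamma>" "\<delta> \<le> \<gamma>" "ord_succ \<delta> \<le> ord_succ \<gamma>" "\<delta> \<le> ord_succ \<gamma>"
          using ord_succ_le[OF 4(2)] 4(2) sg(1) by auto
        show ?thesis unfolding Q1[OF 4(1)] Q1[OF g']
          using linear_diff[OF lin[OF sg(3,2)]] linear_diff[OF lin[OF g' sg(4)]]
            comp2[OF sd(3) le(3) sg(2)] comp2[OF sd(3) le(1) sg(4)] comp2[OF 4(1) le(4) sg(2)] comp2[OF 4(1) le(2) sg(4)]
          by simp
      qed
    qed
  next
    fix x :: 'a and e :: real assume e: "0 < e"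
    have "insert ord_zero {\<omega>..<\<mu>} = PRI_index \<mu>" by (auto simp: PRI_index_def \<omega>_def)
    then show "\<exists>A. finite A \<and> A \<subseteq> PRI_index \<mu> \<and> norm (x - (\<Sum>\<gamma>\<in>A. Q \<gamma> x)) < e"
      using approx[OF \<omega>\<mu> order_refl e, of x] Pmu by simp
  qed
qed

section \<open>The renorming theorem\<close>

lemma norm_onD:
  assumes "norm_on Y p" "x \<in> Y"
  shows "p x = 0 \<longleftrightarrow> x = 0" "p (a *\<^sub>R x) = \<bar>a\<bar> * p x" "y \<in> Y \<Longrightarrow> p (x + y) \<le> p x + p y"
  using assms by (simp_all add: norm_on_def)

lemma homogeneous_estimate:
  assumes Y: "subspace Y" and p: "norm_on Y p" and s: "norm_on Y s"
    and est: "\<And>v. v \<in> Y \<Longrightarrow> norm v \<le> 1 \<Longrightarrow> \<bar>s v - p v\<bar> \<le> d" and v: "v \<in> Y"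
  shows "\<bar>s v - p v\<bar> \<le> d * norm v"
proof (cases "v = 0")
  case True
  then show ?thesis using norm_onD(1)[OF p v] norm_onD(1)[OF s v] by simp
next
  case False
  define u where "u = v /\<^sub>R norm v"
  have u: "u \<in> Y" "norm u = 1" using v False Y by (simp_all add: u_def subspace_scale)
  have vu: "v = norm v *\<^sub>R u" using False by (simp add: u_def)
  have "t v = norm v * t u" if "norm_on Y t" for t
  proof -
    have "t (norm v *\<^sub>R u) = \<bar>norm v\<bar> * t u" by (rule norm_onD(2)[OF that u(1)])
    then show ?thesis using arg_cong[OF vu, of t] by simp
  qed
  from this[OF s] this[OF p] have "\<bar>s v - p v\<bar> = norm v * \<bar>s u - p u\<bar>" by (simp add: abs_mult flip: right_diff_distrib)
  also have "\<dots> \<le> norm v * d" using est[OF u(1)] u(2) by (intro mult_left_mono) auto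
  finally show ?thesis by (simp add: mult.commute)
qed

text \<open>
  Uniform approximation on the unit ball of an equivalent norm is, by homogeneity, approximation up
  to a factor.
\<close>

lemma smooth_norm_within_factor:
  assumes Y: "subspace Y" and p: "equivalent_norm_on Y p" and lim: "limit_of_smooth_norms_on Y k p"
    and e: "0 < e" "e \<le> 1 / 2"
  shows "\<exists>s. smooth_norm_on Y k s \<and> (\<forall>v\<in>Y. s v \<le> (1 + 2 * e) * p v \<and> p v \<le> (1 + 2 * e) * s v)"
proof -
  obtain c where c: "c > 0" "\<forall>v\<in>Y. c * norm v \<le> p v" and pn: "norm_on Y p"
    using p unfolding equivalent_norm_on_def by blast
  obtain q where q: "\<And>j. smooth_norm_on Y k (q j)" "\<And>B. B \<subseteq> Y \<Longrightarrow> bounded B \<Longrightarrow> uniform_limit B q p sequentially"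
    using lim unfolding limit_of_smooth_norms_on_def by blast
  have "bounded (Y \<inter> cball 0 1)" by (intro bounded_Int) auto
  then have "uniform_limit (Y \<inter> cball 0 1) q p sequentially" by (intro q(2)) auto
  moreover have "0 < c * e" using c e by simp
  ultimately have "\<forall>\<^sub>F j in sequentially. \<forall>v\<in>Y \<inter> cball 0 1. dist (q j v) (p v) < c * e"
    by (rule uniform_limitD)
  then obtain j where j: "\<forall>v\<in>Y \<inter> cball 0 1. dist (q j v) (p v) < c * e"
    using eventually_happens by force
  have sn: "norm_on Y (q j)" using q(1)[of j] by (simp add: smooth_norm_on_def)
  have "q j v \<le> (1 + 2 * e) * p v \<and> p v \<le> (1 + 2 * e) * q j v" if v: "v \<in> Y" for v
  proof -
    have "\<bar>q j v - p v\<bar> \<le> (c * e) * norm v"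
      by (rule homogeneous_estimate[OF Y pn sn _ v]) (use j in \<open>force simp: dist_norm\<close>)
    also have "\<dots> = e * (c * norm v)" by simp
    also have "\<dots> \<le> e * p v" using c v e by (intro mult_left_mono) auto
    finally have d: "\<bar>q j v - p v\<bar> \<le> e * p v" .
    have p0: "0 \<le> p v" using pn v by (simp add: norm_on_def)
    have "p v \<le> (1 + 2 * e) * ((1 - e) * p v)"
    proof -
      have "0 \<le> e * (1 - 2 * e) * p v" using e p0 by (intro mult_nonneg_nonneg) auto
      then show ?thesis by (simp add: algebra_simps)
    qed
    also have "\<dots> \<le> (1 + 2 * e) * q j v"
      using d e by (intro mult_left_mono) (auto simp: algebra_simps abs_le_iff)
    finally have le: "p v \<le> (1 + 2 * e) * q j v" .
    have "q j v \<le> p v + e * p v" using d by linarith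
    moreover have "0 \<le> e * p v" using e p0 by simp
    moreover have "(1 + 2 * e) * p v = p v + 2 * (e * p v)" by (simp add: algebra_simps)
    ultimately have "q j v \<le> (1 + 2 * e) * p v" by linarith
    with le show ?thesis by blast
  qed
  then show ?thesis using q(1) by blast
qed

lemma norm_on_range_seminorm:
  assumes "linear L" "norm_on (range L) p" "0 \<le> (c::real)"
  shows "seminorm (\<lambda>x. c * p (L x))"
proof -
  have tri: "p (L x + L y) \<le> p (L x) + p (L y)" and hom: "p (a *\<^sub>R L x) = \<bar>a\<bar> * p (L x)" for x y a
    using norm_onD(2,3)[OF assms(2)] by auto
  have "c * p (L (x + y)) \<le> c * p (L x) + c * p (L y)" for x y
    using mult_left_mono[OF tri[of x y] assms(3)] by (simp add: linear_add[OF assms(1)] distrib_left)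
  then show ?thesis by (simp add: seminorm_def linear_scale[OF assms(1)] hom)
qed

context orthogonal_decomposition
begin

definition residual :: "'i set \<Rightarrow> 'a \<Rightarrow> 'a" where
  "residual B x = x - (\<Sum>\<gamma>\<in>B. Q \<gamma> x)"

lemma Q_bounded_linear: "\<gamma> \<in> \<Lambda> \<Longrightarrow> bounded_linear (Q \<gamma>)"
  using Q_linear Q_norm
  by (intro bounded_linear.intro bounded_linear_axioms.intro exI[of _ 2]) (auto simp: mult.commute)

lemma residual_bounded_linear: "B \<subseteq> \<Lambda> \<Longrightarrow> bounded_linear (residual B)"
  unfolding residual_def[abs_def]
  by (intro bounded_linear_sub bounded_linear_ident bounded_linear_sum Q_bounded_linear) auto

text \<open>
  If a finite sum over \<open>A\<close> is close to \<open>x\<close>, applying \<open>Q \<gamma>\<close> with \<open>\<gamma> \<notin> A\<close> to the difference leaves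
  \<open>Q \<gamma> x\<close>.
\<close>

lemma coordinates_c0:
  assumes d: "0 < d"
  shows "finite {\<gamma>\<in>\<Lambda>. d \<le> norm (Q \<gamma> x)}"
proof -
  obtain A where A: "finite A" "A \<subseteq> \<Lambda>" "norm (x - (\<Sum>\<delta>\<in>A. Q \<delta> x)) < d / 2" using approximation[of "d / 2"] d by auto
  have "norm (Q \<gamma> x) < d" if g: "\<gamma> \<in> \<Lambda>" "\<gamma> \<notin> A" for \<gamma>
  proof -
    have "Q \<gamma> (\<Sum>\<delta>\<in>A. Q \<delta> x) = 0"
      unfolding linear_sum[OF Q_linear[OF g(1)]] using A(2) g by (intro sum.neutral ballI Q_orth) auto
    then have "Q \<gamma> x = Q \<gamma> (x - (\<Sum>\<delta>\<in>A. Q \<delta> x))" by (simp add: linear_diff[OF Q_linear[OF g(1)]])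
    then show ?thesis using Q_norm[OF g(1), of "x - (\<Sum>\<delta>\<in>A. Q \<delta> x)"] A(3) by simp
  qed
  then have "{\<gamma>\<in>\<Lambda>. d \<le> norm (Q \<gamma> x)} \<subseteq> A" by (auto simp: not_less[symmetric])
  then show ?thesis using A(1) finite_subset by blast
qed

lemma coordinates_nonzero:
  assumes "x \<noteq> 0"
  shows "\<exists>\<gamma>\<in>\<Lambda>. Q \<gamma> x \<noteq> 0"
proof (rule ccontr)
  assume "\<not> ?thesis"
  then have z: "Q \<gamma> x = 0" if "\<gamma> \<in> \<Lambda>" for \<gamma> using that by blast
  obtain A where A: "A \<subseteq> \<Lambda>" "norm (x - (\<Sum>\<delta>\<in>A. Q \<delta> x)) < norm x" using approximation[of "norm x"] assms by auto
  have "(\<Sum>\<delta>\<in>A. Q \<delta> x) = 0" using A(1) z by (intro sum.neutral) auto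
  then show False using A(2) by simp
qed

lemma supported_approximation:
  assumes "0 < e"
  shows "\<exists>B. finite B \<and> B \<subseteq> \<Lambda> \<and> (\<forall>\<gamma>\<in>B. Q \<gamma> x \<noteq> 0) \<and> norm (residual B x) < e"
proof -
  obtain A where A: "finite A" "A \<subseteq> \<Lambda>" "norm (x - (\<Sum>\<delta>\<in>A. Q \<delta> x)) < e" using approximation[OF assms] by blast
  have "(\<Sum>\<delta>\<in>{\<gamma>\<in>A. Q \<gamma> x \<noteq> 0}. Q \<delta> x) = (\<Sum>\<delta>\<in>A. Q \<delta> x)"
    using A(1) by (intro sum.mono_neutral_left) auto
  then show ?thesis using A by (intro exI[of _ "{\<gamma>\<in>A. Q \<gamma> x \<noteq> 0}"]) (auto simp: residual_def)
qed

text \<open>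
  The coordinate seminorms are \<open>\<pi> \<gamma> x = p \<gamma> (Q \<gamma> x) / R \<gamma>\<close>, where \<open>R \<gamma>\<close> makes them uniformly bounded;
  lower bounds may depend on \<open>\<gamma>\<close>, because in the end only finitely many coordinates are used at a
  time.  The norms on the subspaces enter the level norms \<open>M j\<close>, and smooth approximations \<open>s \<gamma> i\<close> of
  them, up to the factor \<open>a i\<close>, enter the approximating norms \<open>M' i j\<close>.
\<close>

lemma renorming:
  fixes k :: enat
  assumes k: "1 \<le> k"
    and coord: "\<And>\<gamma>. \<gamma> \<in> \<Lambda> \<Longrightarrow> \<exists>p. equivalent_norm_on (range (Q \<gamma>)) p \<and> smooth_norm_on (range (Q \<gamma>)) 1 p \<and>
           LUR_on (range (Q \<gamma>)) p \<and> limit_of_smooth_norms_on (range (Q \<gamma>)) k p"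
    and ambient: "\<exists>q. equivalent_norm_on (UNIV :: 'a set) q \<and> smooth_norm_on (UNIV :: 'a set) k q"
  shows "\<exists>p. equivalent_norm_on (UNIV :: 'a set) p \<and> smooth_norm_on (UNIV :: 'a set) 1 p \<and>
           LUR_on (UNIV :: 'a set) p \<and> limit_of_smooth_norms_on (UNIV :: 'a set) k p"
proof -
  have sub: "subspace (range (Q \<gamma>))" if "\<gamma> \<in> \<Lambda>" for \<gamma>
    using linear_subspace_image[OF Q_linear[OF that] subspace_UNIV] .
  obtain p where p: "\<And>\<gamma>. \<gamma> \<in> \<Lambda> \<Longrightarrow> equivalent_norm_on (range (Q \<gamma>)) (p \<gamma>)"
      "\<And>\<gamma>. \<gamma> \<in> \<Lambda> \<Longrightarrow> smooth_norm_on (range (Q \<gamma>)) 1 (p \<gamma>)"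
      "\<And>\<gamma>. \<gamma> \<in> \<Lambda> \<Longrightarrow> LUR_on (range (Q \<gamma>)) (p \<gamma>)"
      "\<And>\<gamma>. \<gamma> \<in> \<Lambda> \<Longrightarrow> limit_of_smooth_norms_on (range (Q \<gamma>)) k (p \<gamma>)"
    using coord by metis
  have pn: "norm_on (range (Q \<gamma>)) (p \<gamma>)" if "\<gamma> \<in> \<Lambda>" for \<gamma> using p(1)[OF that] by (simp add: equivalent_norm_on_def)
  have "\<exists>C>0. \<forall>v\<in>range (Q \<gamma>). p \<gamma> v \<le> C * norm v" if "\<gamma> \<in> \<Lambda>" for \<gamma>
    using p(1)[OF that] unfolding equivalent_norm_on_def by blast
  then obtain R where R: "\<And>\<gamma>. \<gamma> \<in> \<Lambda> \<Longrightarrow> 0 < R \<gamma>" "\<And>\<gamma> x. \<gamma> \<in> \<Lambda> \<Longrightarrow> p \<gamma> (Q \<gamma> x) \<le> R \<gamma> * norm (Q \<gamma> x)"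
    by (metis rangeI)
  define a where "a = (\<lambda>i. 1 + 1 / real (Suc i))"
  have a: "a \<longlonglongrightarrow> 1" "\<And>i. 1 \<le> a i" "\<And>i. a i \<le> 2"
  proof -
    show "a \<longlonglongrightarrow> 1" unfolding a_def using tendsto_add[OF tendsto_const[of 1] LIMSEQ_Suc[OF lim_1_over_n]] by simp
  qed (auto simp: a_def divide_le_eq)
  have "\<exists>s. smooth_norm_on (range (Q \<gamma>)) k s \<and> (\<forall>v\<in>range (Q \<gamma>). s v \<le> a i * p \<gamma> v \<and> p \<gamma> v \<le> a i * s v)"
    if g: "\<gamma> \<in> \<Lambda>" for \<gamma> i
  proof -
    have "1 + 2 * (1 / (2 * real (Suc i))) = a i" unfolding a_def by (simp add: divide_simps del: of_nat_Suc)
    moreover have "0 < 1 / (2 * real (Suc i))" "1 / (2 * real (Suc i)) \<le> 1 / 2" by (auto simp: divide_simps)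
    ultimately show ?thesis
      using smooth_norm_within_factor[OF sub[OF g] p(1)[OF g] p(4)[OF g], of "1 / (2 * real (Suc i))"] by metis
  qed
  then obtain s where s: "\<And>\<gamma> i. \<gamma> \<in> \<Lambda> \<Longrightarrow> smooth_norm_on (range (Q \<gamma>)) k (s \<gamma> i)"
     "\<And>\<gamma> i x. \<gamma> \<in> \<Lambda> \<Longrightarrow> s \<gamma> i (Q \<gamma> x) \<le> a i * p \<gamma> (Q \<gamma> x)"
     "\<And>\<gamma> i x. \<gamma> \<in> \<Lambda> \<Longrightarrow> p \<gamma> (Q \<gamma> x) \<le> a i * s \<gamma> i (Q \<gamma> x)"
    by (metis rangeI)
  have sn: "norm_on (range (Q \<gamma>)) (s \<gamma> i)" if "\<gamma> \<in> \<Lambda>" for \<gamma> i using s(1)[OF that] by (simp add: smooth_norm_on_def)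
  obtain q where q: "equivalent_norm_on (UNIV :: 'a set) q" "smooth_norm_on (UNIV :: 'a set) k q" using ambient by blast
  have qn: "norm_on UNIV q" using q(1) by (simp add: equivalent_norm_on_def)
  then have qs: "seminorm q" by (simp add: norm_on_def seminorm_def)
  obtain c Cq where c: "0 < c" "\<And>x. c * norm x \<le> q x" and Cq: "0 < Cq" "\<And>x. q x \<le> Cq * norm x"
    using q(1) unfolding equivalent_norm_on_def by auto
  define C where "C = max 4 Cq"
  define D where "D = 2 * Cq / c"
  define \<pi> where "\<pi> = (\<lambda>\<gamma> x. (1 / R \<gamma>) * p \<gamma> (Q \<gamma> x))"
  define \<pi>' where "\<pi>' = (\<lambda>i \<gamma> x. (1 / R \<gamma>) * s \<gamma> i (Q \<gamma> x))"
  define \<sigma> where "\<sigma> = (\<lambda>B x. q (residual B x))"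
  have pi_le: "\<pi> \<gamma> x \<le> norm (Q \<gamma> x)" if "\<gamma> \<in> \<Lambda>" for \<gamma> x
    using R(1)[OF that] R(2)[OF that, of x] by (simp add: \<pi>_def divide_le_eq mult.commute)
  have pi'_le: "\<pi>' i \<gamma> x \<le> a i * \<pi> \<gamma> x" "\<pi> \<gamma> x \<le> a i * \<pi>' i \<gamma> x" if "\<gamma> \<in> \<Lambda>" for i \<gamma> x
    using s(2,3)[OF that, where i = i and x = x] R(1)[OF that] by (simp_all add: \<pi>_def \<pi>'_def divide_right_mono)
  have pis: "seminorm (\<pi> \<gamma>)" if "\<gamma> \<in> \<Lambda>" for \<gamma>
    unfolding \<pi>_def using R(1)[OF that] by (intro norm_on_range_seminorm Q_linear pn that) auto
  have pis': "seminorm (\<pi>' i \<gamma>)" if "\<gamma> \<in> \<Lambda>" for \<gamma> i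
    unfolding \<pi>'_def using R(1)[OF that] by (intro norm_on_range_seminorm Q_linear sn that) auto
  have pi2: "\<pi>' i \<gamma> x \<le> 2 * norm (Q \<gamma> x)" if "\<gamma> \<in> \<Lambda>" for i \<gamma> x
  proof -
    have "\<pi>' i \<gamma> x \<le> a i * \<pi> \<gamma> x" by (rule pi'_le(1)[OF that])
    also have "\<dots> \<le> 2 * norm (Q \<gamma> x)"
      using a(3)[of i] pi_le[OF that, of x] seminorm_nonneg[OF pis[OF that], of x] by (intro mult_mono) auto
    finally show ?thesis .
  qed
  have system: "coordinate_system \<Lambda> \<theta> \<sigma> q C c D"
    if \<theta>: "\<And>\<gamma>. \<gamma> \<in> \<Lambda> \<Longrightarrow> seminorm (\<theta> \<gamma>)" "\<And>\<gamma> x. \<gamma> \<in> \<Lambda> \<Longrightarrow> \<theta> \<gamma> x \<le> 2 * norm (Q \<gamma> x)" for \<theta>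
  proof
    show "seminorm (\<theta> \<gamma>)" if "\<gamma> \<in> \<Lambda>" for \<gamma> by (rule \<theta>(1)[OF that])
    show "\<theta> \<gamma> x \<le> C * norm x" if "\<gamma> \<in> \<Lambda>" for \<gamma> x
    proof -
      have "\<theta> \<gamma> x \<le> 4 * norm x" using \<theta>(2)[OF that, of x] Q_norm[OF that, of x] by simp
      also have "\<dots> \<le> C * norm x" by (intro mult_right_mono) (auto simp: C_def)
      finally show ?thesis .
    qed
    show "seminorm (\<sigma> B)" if "finite B" "B \<subseteq> \<Lambda>" for B
      unfolding \<sigma>_def
      by (rule seminorm_linear[OF qs bounded_linear.linear[OF residual_bounded_linear[OF that(2)]]])
    show "\<sigma> B x \<le> (1 + D * real (card B)) * q x" if B: "finite B" "B \<subseteq> \<Lambda>" for B x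
    proof -
      have qQ: "q (Q \<gamma> x) \<le> D * q x" if "\<gamma> \<in> B" for \<gamma>
      proof -
        have "q (Q \<gamma> x) \<le> Cq * norm (Q \<gamma> x)" by (rule Cq(2))
        also have "\<dots> \<le> Cq * (2 * norm x)" using Cq(1) Q_norm that B by (intro mult_left_mono) auto
        also have "\<dots> = D * (c * norm x)" using c(1) by (simp add: D_def)
        also have "\<dots> \<le> D * q x" using c Cq(1) by (intro mult_left_mono c(2)) (auto simp: D_def)
        finally show ?thesis .
      qed
      have "q (\<Sum>\<gamma>\<in>B. Q \<gamma> x) \<le> (\<Sum>\<gamma>\<in>B. q (Q \<gamma> x))"
        by (rule seminorm_sum_le[OF qs])
      also have "\<dots> \<le> real (card B) * (D * q x)" using sum_bounded_above[of B "\<lambda>\<gamma>. q (Q \<gamma> x)" "D * q x"] qQ by simp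
      finally have "q (\<Sum>\<gamma>\<in>B. Q \<gamma> x) \<le> real (card B) * (D * q x)" .
      moreover have "\<sigma> B x \<le> q x + q (\<Sum>\<gamma>\<in>B. Q \<gamma> x)"
        using seminorm_triangle[OF qs, of x "- (\<Sum>\<gamma>\<in>B. Q \<gamma> x)"] by (simp add: \<sigma>_def residual_def seminorm_minus[OF qs])
      ultimately show ?thesis by (simp add: algebra_simps)
    qed
    show "seminorm q" by (rule qs)
    show "q x \<le> C * norm x" for x using Cq(2)[of x] mult_right_mono[of Cq C "norm x"] by (simp add: C_def)
    show "c * norm x \<le> q x" for x by (rule c(2))
    show "0 < C" "0 < c" "0 \<le> D" using c(1) Cq(1) by (auto simp: C_def D_def)
    show "finite {\<gamma>\<in>\<Lambda>. d \<le> \<theta> \<gamma> x}" if "0 < d" for d x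
    proof (rule finite_subset)
      show "{\<gamma>\<in>\<Lambda>. d \<le> \<theta> \<gamma> x} \<subseteq> {\<gamma>\<in>\<Lambda>. d / 2 \<le> norm (Q \<gamma> x)}"
      proof
        fix \<gamma> assume "\<gamma> \<in> {\<gamma>\<in>\<Lambda>. d \<le> \<theta> \<gamma> x}"
        then show "\<gamma> \<in> {\<gamma>\<in>\<Lambda>. d / 2 \<le> norm (Q \<gamma> x)}" using \<theta>(2)[of \<gamma> x] by simp
      qed
      show "finite {\<gamma>\<in>\<Lambda>. d / 2 \<le> norm (Q \<gamma> x)}" using that by (intro coordinates_c0) auto
    qed
  qed
  have sys: "coordinate_system \<Lambda> \<pi> \<sigma> q C c D"
  proof (rule system[OF pis])
    show "\<pi> \<gamma> x \<le> 2 * norm (Q \<gamma> x)" if "\<gamma> \<in> \<Lambda>" for \<gamma> x using pi_le[OF that, of x] norm_ge_zero[of "Q \<gamma> x"] by linarith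
  qed
  have sys': "coordinate_system \<Lambda> (\<pi>' i) \<sigma> q C c D" for i by (rule system[OF pis' pi2])
  interpret S: coordinate_system \<Lambda> \<pi> \<sigma> q C c D by (rule sys)
  have range_smooth: "equi_C n {x. (1 / R \<gamma>) * t (Q \<gamma> x) \<noteq> 0} {\<lambda>x. (1 / R \<gamma>) * t (Q \<gamma> x)}"
    if t: "smooth_norm_on (range (Q \<gamma>)) l t" and n: "enat n \<le> l" and g: "\<gamma> \<in> \<Lambda>" for n t l \<gamma>
  proof -
    have eq: "{x. (1 / R \<gamma>) * t (Q \<gamma> x) \<noteq> 0} = {x. Q \<gamma> x \<noteq> 0}"
      using t R(1)[OF g] by (auto simp: smooth_norm_on_def norm_on_def)
    have "open {x. Q \<gamma> x \<noteq> 0}"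
      using bounded_linear.continuous_on[OF Q_bounded_linear[OF g], of UNIV "\<lambda>x. x"] by (intro open_Collect_neq) auto
    then show ?thesis unfolding eq
      by (intro equi_C_single_mult equi_C_single_const smooth_norm_onD[OF t n Q_bounded_linear[OF g] _ sub[OF g]]) auto
  qed
  have q_smooth: "equi_C n {x. q (L x) \<noteq> 0} {\<lambda>x. q (L x)}" if n: "enat n \<le> k" and L: "bounded_linear L" for n and L :: "'a \<Rightarrow> 'a"
    using smooth_norm_onD[OF q(2) n L] qn by (simp add: norm_on_def)
  have q_smooth': "equi_C n {x. q x \<noteq> 0} {q}" if "enat n \<le> k" for n
    using q_smooth[OF that bounded_linear_ident] by simp
  have sigma_smooth: "equi_C n {x. \<sigma> B x \<noteq> 0} {\<sigma> B}" if "enat n \<le> k" "B \<subseteq> \<Lambda>" for n B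
    unfolding \<sigma>_def by (rule q_smooth[OF that(1) residual_bounded_linear[OF that(2)]])
  have one: "enat (Suc 0) \<le> k" using k by (simp add: one_enat_def)
  \<comment> \<open>One norm for each pair of a level and a radius.\<close>
  define lev where "lev = (\<lambda>j. fst (prod_decode j))"
  define rad where "rad = (\<lambda>j. real (snd (prod_decode j)) + 1)"
  have rad: "0 < rad j" for j by (simp add: rad_def)
  define M where "M = (\<lambda>j. level_norm \<Lambda> \<pi> \<sigma> q D (lev j) (rad j))"
  define M' where "M' = (\<lambda>i j. level_norm \<Lambda> (\<pi>' i) \<sigma> q D (lev j) (rad j))"
  have Me: "equivalent_norm_on UNIV (M j)" for j unfolding M_def by (rule S.level_norm_equivalent[OF rad])
  have Me': "equivalent_norm_on UNIV (M' i j)" for i j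
    unfolding M'_def by (rule coordinate_system.level_norm_equivalent[OF sys' rad])
  have Ms: "seminorm (M j)" "seminorm (M' i j)" for i j
    by (rule equivalent_norm_on_UNIV_D(1)[OF Me], rule equivalent_norm_on_UNIV_D(1)[OF Me'])
  have M_le: "M' i j x \<le> a i * M j x" "M j x \<le> a i * M' i j x" for i j x
    unfolding M_def M'_def
    by (rule level_norm_comparison[OF sys sys' rad a(2) pi'_le(1)], assumption,
        rule level_norm_comparison[OF sys' sys rad a(2) pi'_le(2)])
  have M_smooth: "equi_C 1 (- {0}) {M j}" for j
  proof -
    have "equi_C (Suc 0) (- {0}) {M j}" unfolding M_def
    proof (rule S.level_norm_smooth[OF rad])
      show "equi_C (Suc 0) {x. \<pi> \<gamma> x \<noteq> 0} {\<pi> \<gamma>}" if "\<gamma> \<in> \<Lambda>" for \<gamma>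
        unfolding \<pi>_def by (rule range_smooth[OF p(2)[OF that] _ that]) (simp add: one_enat_def)
    qed (use sigma_smooth q_smooth' one in \<open>auto simp del: equi_C.simps\<close>)
    then show ?thesis by simp
  qed
  have M'_smooth: "equi_C (Suc n) (- {0}) {M' i j}" if "enat (Suc n) \<le> k" for n i j
    unfolding M'_def
  proof (rule coordinate_system.level_norm_smooth[OF sys' rad])
    show "equi_C (Suc n) {x. \<pi>' i \<gamma> x \<noteq> 0} {\<pi>' i \<gamma>}" if "\<gamma> \<in> \<Lambda>" for \<gamma>
      unfolding \<pi>'_def by (rule range_smooth[OF s(1)[OF that] \<open>enat (Suc n) \<le> k\<close> that])
  qed (use sigma_smooth q_smooth' that in \<open>auto simp del: equi_C.simps\<close>)
  have "\<exists>K>0. \<forall>x. M j x \<le> K * norm x" for j using Me[of j] unfolding equivalent_norm_on_def by blast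
  then obtain K where K: "\<And>j. 0 < K j" "\<And>j x. M j x \<le> K j * norm x" by metis
  define w where "w = (\<lambda>j. ((1 / 2) ^ j / K j)\<^sup>2)"
  interpret N: norm_sequence w M
  proof
    show "0 < w j" for j using K(1)[of j] by (simp add: w_def)
    show "seminorm (M j)" for j by (rule Ms(1))
    show "sqrt (w j) * M j x \<le> (1 / 2) ^ j * norm x" for j x
    proof -
      have "sqrt (w j) = (1 / 2) ^ j / K j" using K(1)[of j] by (simp add: w_def)
      then have "sqrt (w j) * M j x = (1 / 2) ^ j * (M j x / K j)" by simp
      also have "\<dots> \<le> (1 / 2) ^ j * norm x"
        using K(1)[of j] K(2)[of j x] by (intro mult_left_mono) (auto simp: divide_le_eq mult.commute)
      finally show ?thesis .
    qed
    show "\<exists>c>0. \<forall>x. c * norm x \<le> M 0 x" using Me[of 0] unfolding equivalent_norm_on_def by blast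
  qed
  let ?N = "l2_total w M"
  have Nn: "norm_on UNIV ?N" using N.N_equivalent by (simp add: equivalent_norm_on_def)
  have "smooth_norm_on UNIV 1 ?N"
  proof (rule smooth_norm_onI[OF Nn])
    fix n assume "enat n \<le> 1"
    then have "n \<le> 1" by (simp add: one_enat_def)
    then show "equi_C n (- {0}) {?N}" by (rule equi_C_le[OF _ N.N_smooth[OF M_smooth]])
  qed
  moreover have "limit_of_smooth_norms_on UNIV k ?N"
    unfolding limit_of_smooth_norms_on_def
  proof (intro exI[of _ "\<lambda>i. l2_norm w (M' i) (Suc i)"] conjI allI impI)
    fix i
    note ls = l2_norm_seminorm[of w "M' i", OF N.w_pos Ms(2)]
    note pos = equivalent_norm_on_UNIV_D(2)[OF Me'[of i 0]]
    have "l2_norm w (M' i) (Suc i) x \<noteq> 0" if "x \<noteq> 0" for x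
    proof -
      have "0 < w 0 * (M' i 0 x)\<^sup>2" using pos[OF that] N.w_pos[of 0] by simp
      also have "\<dots> \<le> (\<Sum>j<Suc i. w j * (M' i j x)\<^sup>2)"
        using N.w_pos by (intro member_le_sum[of 0 _ "\<lambda>j. w j * (M' i j x)\<^sup>2"]) (auto simp: less_imp_le)
      finally show ?thesis by (simp add: l2_norm_def del: sum.lessThan_Suc)
    qed
    then have nn: "norm_on UNIV (l2_norm w (M' i) (Suc i))"
      using ls seminorm_nonneg[OF ls] seminorm_0[OF ls] unfolding norm_on_def seminorm_def by auto
    show "smooth_norm_on UNIV k (l2_norm w (M' i) (Suc i))"
    proof (rule smooth_norm_onI[OF nn])
      fix n assume n: "enat n \<le> k"
      have "enat (max n 1) \<le> k" using n one by (simp add: max_def)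
      then obtain m where m: "max n 1 = Suc m" "enat (Suc m) \<le> k" by (metis Suc_eq_plus1 le_add_diff_inverse2 max.cobounded2)
      have "equi_C (Suc m) (- {0}) {l2_norm w (M' i) (Suc i)}"
        using N.w_pos pos M'_smooth[OF m(2)] by (intro l2_norm_smooth) auto
      then show "equi_C n (- {0}) {l2_norm w (M' i) (Suc i)}" using m(1) by (intro equi_C_le[of n "Suc m"]) auto
    qed
  next
    fix B :: "'a set" assume "bounded B"
    then show "uniform_limit B (\<lambda>i. l2_norm w (M' i) (Suc i)) ?N sequentially"
      by (rule N.N_limit[OF a(1,2) Ms(2) M_le])
  qed
  moreover have "LUR_on UNIV ?N"
    unfolding LUR_on_def
  proof (intro ballI allI impI)
    fix x :: 'a and xs :: "nat \<Rightarrow> 'a"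
    assume lim: "(\<lambda>r. 2 * (?N (xs r))\<^sup>2 + 2 * (?N x)\<^sup>2 - (?N (xs r + x))\<^sup>2) \<longlonglongrightarrow> 0"
    show "(\<lambda>r. ?N (xs r - x)) \<longlonglongrightarrow> 0"
    proof (cases "x = 0")
      case True
      then have "(\<lambda>r. (?N (xs r))\<^sup>2) \<longlonglongrightarrow> 0" using lim by (simp add: seminorm_0[OF N.N_seminorm])
      from tendsto_real_sqrt[OF this] show ?thesis using True N.N_nonneg by simp
    next
      case False
      have "(\<lambda>r. q (xs r - x)) \<longlonglongrightarrow> 0"
      proof (rule order_tendstoI)
        show "\<forall>\<^sub>F r in sequentially. u < q (xs r - x)" if "u < 0" for u
          using that seminorm_nonneg[OF qs] by (intro always_eventually allI) (rule less_le_trans)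
        fix e :: real assume e: "0 < e"
        define d where "d = e / (2 * Cq + 3)"
        have d: "0 < d" "(2 * Cq + 3) * d = e" using e Cq(1) by (auto simp: d_def)
        obtain B where B: "finite B" "B \<subseteq> \<Lambda>" "\<forall>\<gamma>\<in>B. Q \<gamma> x \<noteq> 0" "norm (residual B x) < d"
          using supported_approximation[OF d(1), of x] by blast
        have pi_pos: "0 < \<pi> \<gamma> x" if "\<gamma> \<in> \<Lambda>" "Q \<gamma> x \<noteq> 0" for \<gamma>
        proof -
          have "p \<gamma> (Q \<gamma> x) \<noteq> 0" using norm_onD(1)[OF pn[OF that(1)], of "Q \<gamma> x"] that(2) by simp
          then have "\<pi> \<gamma> x \<noteq> 0" using R(1)[OF that(1)] by (simp add: \<pi>_def)
          then show ?thesis using seminorm_nonneg[OF pis[OF that(1)], of x] by simp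
        qed
        obtain \<gamma>0 where \<gamma>0: "\<gamma>0 \<in> \<Lambda>" "Q \<gamma>0 x \<noteq> 0" using coordinates_nonzero[OF False] by blast
        \<comment> \<open>If the gauge of \<open>x\<close> is at most \<open>m0\<close>, the coordinates in \<open>B\<close> are at least \<open>4\<close> after scaling \<open>x\<close> to the unit
            sphere, and the bound for \<open>\<sigma> B (xs r)\<close> is of order \<open>d\<close>.\<close>
        define m0 where "m0 = Min (insert d ((\<lambda>\<gamma>. \<pi> \<gamma> x / 4) ` B))"
        have m0: "0 < m0" "m0 \<le> d" "\<And>\<gamma>. \<gamma> \<in> B \<Longrightarrow> m0 \<le> \<pi> \<gamma> x / 4"
        proof -
          have "0 < \<pi> \<gamma> x" if "\<gamma> \<in> B" for \<gamma> using that B(2,3) pi_pos by blast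
          then show "0 < m0" unfolding m0_def using B(1) d(1) by (subst Min_gr_iff) auto
          show "m0 \<le> d" "\<And>\<gamma>. \<gamma> \<in> B \<Longrightarrow> m0 \<le> \<pi> \<gamma> x / 4"
            unfolding m0_def using B(1) by (intro Min_le; simp)+
        qed
        from S.good_parameters[OF \<gamma>0(1) pi_pos[OF \<gamma>0] m0(1)]
        obtain n \<rho>0 where n: "\<And>\<rho>. \<rho>0 \<le> \<rho> \<Longrightarrow> 0 < \<rho> \<Longrightarrow> 0 < level_norm \<Lambda> \<pi> \<sigma> q D n \<rho> x \<and>
            level_norm \<Lambda> \<pi> \<sigma> q D n \<rho> x \<le> m0 \<and> q x \<le> level_norm \<Lambda> \<pi> \<sigma> q D n \<rho> x * \<rho> / 2"
          by blast
        obtain l :: nat where l: "\<rho>0 \<le> l" using real_arch_simple by blast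
        define j where "j = prod_encode (n, l)"
        have Mj: "M j = level_norm \<Lambda> \<pi> \<sigma> q D n (rad j)" and rj: "\<rho>0 \<le> rad j"
          using l by (simp_all add: M_def j_def lev_def rad_def)
        define m where "m = M j x"
        have m: "0 < m" "m \<le> m0" "q x \<le> m * rad j / 2" using n[OF rj rad] by (auto simp: m_def Mj)
        have big: "2 \<le> ramp (\<pi> \<gamma> x / m - 1)" if "\<gamma> \<in> B" for \<gamma>
        proof -
          have "4 * m \<le> \<pi> \<gamma> x" using m0(3)[OF that] m(2) by simp
          then have "4 \<le> \<pi> \<gamma> x / m" using m(1) by (simp add: le_divide_eq)
          then show ?thesis using ramp_ge[of "\<pi> \<gamma> x / m - 1"] by simp
        qed
        have l1: "(\<lambda>r. level_norm \<Lambda> \<pi> \<sigma> q D n (rad j) (xs r)) \<longlonglongrightarrow> m"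
          and l2: "(\<lambda>r. level_norm \<Lambda> \<pi> \<sigma> q D n (rad j) (xs r + x)) \<longlonglongrightarrow> 2 * m"
          using N.gap_transfer[OF lim, of j] by (simp_all add: Mj m_def)
        have mx: "level_norm \<Lambda> \<pi> \<sigma> q D n (rad j) x = m" by (simp add: m_def Mj)
        note T = S.transfer[OF rad mx m(1) l1 l2 B(1,2) big m(3)]
        have coords: "(\<lambda>r. q (Q \<gamma> (xs r - x))) \<longlonglongrightarrow> 0" if g: "\<gamma> \<in> B" for \<gamma>
        proof -
          have gL: "\<gamma> \<in> \<Lambda>" using g B by blast
          note Rg = R(1)[OF gL]
          have t1: "(\<lambda>r. p \<gamma> (Q \<gamma> (xs r))) \<longlonglongrightarrow> p \<gamma> (Q \<gamma> x)"
            using tendsto_mult_left[OF T(1)[OF _ g], of "R \<gamma>"] Rg by (simp add: \<pi>_def)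
          have t2: "(\<lambda>r. p \<gamma> (Q \<gamma> (xs r + x))) \<longlonglongrightarrow> 2 * p \<gamma> (Q \<gamma> x)"
            using tendsto_mult_left[OF T(2)[OF _ g], of "R \<gamma>"] Rg by (simp add: \<pi>_def)
          have "(\<lambda>r. 2 * (p \<gamma> (Q \<gamma> (xs r)))\<^sup>2 + 2 * (p \<gamma> (Q \<gamma> x))\<^sup>2 - (p \<gamma> (Q \<gamma> (xs r + x)))\<^sup>2) \<longlonglongrightarrow>
              2 * (p \<gamma> (Q \<gamma> x))\<^sup>2 + 2 * (p \<gamma> (Q \<gamma> x))\<^sup>2 - (2 * p \<gamma> (Q \<gamma> x))\<^sup>2"
            by (intro tendsto_intros t1 t2)
          then have "(\<lambda>r. 2 * (p \<gamma> (Q \<gamma> (xs r)))\<^sup>2 + 2 * (p \<gamma> (Q \<gamma> x))\<^sup>2 - (p \<gamma> (Q \<gamma> (xs r) + Q \<gamma> x))\<^sup>2) \<longlonglongrightarrow> 0"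
            by (simp add: power_mult_distrib linear_add[OF Q_linear[OF gL]])
          then have lp: "(\<lambda>r. p \<gamma> (Q \<gamma> (xs r) - Q \<gamma> x)) \<longlonglongrightarrow> 0"
            using p(3)[OF gL] unfolding LUR_on_def by (auto dest!: bspec[of _ _ "Q \<gamma> x"] spec[of _ "\<lambda>r. Q \<gamma> (xs r)"])
          obtain c' where c': "0 < c'" "\<And>v. v \<in> range (Q \<gamma>) \<Longrightarrow> c' * norm v \<le> p \<gamma> v"
            using p(1)[OF gL] unfolding equivalent_norm_on_def by blast
          show ?thesis
          proof (rule tendsto_0_le[OF lp, of _ "Cq / c'"])
            have "norm (q (Q \<gamma> (xs r - x))) \<le> norm (p \<gamma> (Q \<gamma> (xs r) - Q \<gamma> x)) * (Cq / c')" for r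
            proof -
              have "q (Q \<gamma> (xs r - x)) \<le> Cq * norm (Q \<gamma> (xs r - x))" by (rule Cq(2))
              also have "\<dots> = (Cq / c') * (c' * norm (Q \<gamma> (xs r - x)))" using c'(1) by simp
              also have "\<dots> \<le> (Cq / c') * p \<gamma> (Q \<gamma> (xs r - x))" using Cq(1) c' by (intro mult_left_mono) auto
              finally have "q (Q \<gamma> (xs r - x)) \<le> (Cq / c') * p \<gamma> (Q \<gamma> (xs r - x))" .
              moreover have "(Cq / c') * p \<gamma> (Q \<gamma> (xs r - x)) \<le> (Cq / c') * \<bar>p \<gamma> (Q \<gamma> (xs r - x))\<bar>"
                using Cq(1) c'(1) by (intro mult_left_mono) auto
              ultimately show ?thesis using seminorm_nonneg[OF qs, of "Q \<gamma> (xs r - x)"]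
                by (simp add: linear_diff[OF Q_linear[OF gL]] mult.commute)
            qed
            then show "\<forall>\<^sub>F r in sequentially. norm (q (Q \<gamma> (xs r - x))) \<le> norm (p \<gamma> (Q \<gamma> (xs r) - Q \<gamma> x)) * (Cq / c')" by simp
          qed
        qed
        have "(\<lambda>r. \<Sum>\<gamma>\<in>B. q (Q \<gamma> (xs r - x))) \<longlonglongrightarrow> (\<Sum>\<gamma>\<in>B. 0)" by (intro tendsto_sum coords)
        then have "(\<lambda>r. \<Sum>\<gamma>\<in>B. q (Q \<gamma> (xs r - x))) \<longlonglongrightarrow> 0" by simp
        from order_tendstoD(2)[OF this d(1)]
        have ev1: "\<forall>\<^sub>F r in sequentially. (\<Sum>\<gamma>\<in>B. q (Q \<gamma> (xs r - x))) < d" .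
        have ev2: "\<forall>\<^sub>F r in sequentially. \<sigma> B (xs r) < max (\<sigma> B x) m + d" by (rule T(3)[OF _ d(1)])
        have "\<sigma> B x \<le> Cq * norm (residual B x)" unfolding \<sigma>_def by (rule Cq(2))
        also have "\<dots> \<le> Cq * d" using B(4) Cq(1) by (intro mult_left_mono) auto
        finally have sx: "\<sigma> B x \<le> Cq * d" .
        from ev1 ev2 show "\<forall>\<^sub>F r in sequentially. q (xs r - x) < e"
        proof eventually_elim
          case (elim r)
          have "xs r - x = residual B (xs r) + - residual B x + (\<Sum>\<gamma>\<in>B. Q \<gamma> (xs r - x))"
          proof -
            have "(\<Sum>\<gamma>\<in>B. Q \<gamma> (xs r - x)) = (\<Sum>\<gamma>\<in>B. Q \<gamma> (xs r) - Q \<gamma> x)"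
              using B(2) by (intro sum.cong refl linear_diff Q_linear) auto
            then show ?thesis by (simp add: residual_def sum_subtractf)
          qed
          then have "q (xs r - x) \<le> \<sigma> B (xs r) + \<sigma> B x + q (\<Sum>\<gamma>\<in>B. Q \<gamma> (xs r - x))"
            using seminorm_triangle[OF qs, of "residual B (xs r) + - residual B x" "\<Sum>\<gamma>\<in>B. Q \<gamma> (xs r - x)"]
              seminorm_triangle[OF qs, of "residual B (xs r)" "- residual B x"]
            by (simp add: \<sigma>_def seminorm_minus[OF qs])
          also have "q (\<Sum>\<gamma>\<in>B. Q \<gamma> (xs r - x)) \<le> (\<Sum>\<gamma>\<in>B. q (Q \<gamma> (xs r - x)))"
            by (rule seminorm_sum_le[OF qs])
          finally have "q (xs r - x) < max (\<sigma> B x) m + d + \<sigma> B x + d" using elim by linarith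
          also have "\<dots> \<le> (Cq * d + d) + d + Cq * d + d"
          proof -
            have "0 \<le> Cq * d" using Cq(1) d(1) by simp
            then have "max (\<sigma> B x) m \<le> Cq * d + d" using sx m(2) m0(2) d(1) by linarith
            then show ?thesis using sx by linarith
          qed
          also have "\<dots> = e" unfolding d(2)[symmetric] by (simp add: algebra_simps)
          finally show ?case .
        qed
      qed
      then show ?thesis
      proof (rule tendsto_0_le[of _ _ _ "2 / c"])
        have "norm (?N v) \<le> norm (q v) * (2 / c)" for v
        proof -
          have "?N v \<le> 2 * norm v" by (rule N.N_upper)
          also have "\<dots> = (2 / c) * (c * norm v)" using c(1) by simp
          also have "\<dots> \<le> (2 / c) * q v" using c by (intro mult_left_mono c(2)) auto
          finally show ?thesis using N.N_nonneg[of v] seminorm_nonneg[OF qs, of v] by (simp add: mult.commute)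
        qed
        then show "\<forall>\<^sub>F r in sequentially. norm (?N (xs r - x)) \<le> norm (q (xs r - x)) * (2 / c)" by simp
      qed
    qed
  qed
  ultimately show ?thesis using N.N_equivalent by blast
qed

end

theorem theorem3p1:
  fixes P :: "'i::wellorder \<Rightarrow> 'a::banach \<Rightarrow> 'a" and \<mu> :: 'i and k :: enat
  assumes "1 \<le> k"
    and "PRI \<mu> P"
    and "\<forall>\<gamma>\<in>PRI_index \<mu>. \<exists>p. equivalent_norm_on (range (PRI_diff P \<gamma>)) p \<and>
           smooth_norm_on (range (PRI_diff P \<gamma>)) 1 p \<and>
           LUR_on (range (PRI_diff P \<gamma>)) p \<and>
           limit_of_smooth_norms_on (range (PRI_diff P \<gamma>)) k p"
    and "\<exists>q. equivalent_norm_on (UNIV :: 'a set) q \<and> smooth_norm_on (UNIV :: 'a set) k q"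
  shows "\<exists>p. equivalent_norm_on (UNIV :: 'a set) p \<and> smooth_norm_on (UNIV :: 'a set) 1 p \<and>
           LUR_on (UNIV :: 'a set) p \<and> limit_of_smooth_norms_on (UNIV :: 'a set) k p"
proof (cases "\<exists>y :: 'a. y \<noteq> 0")
  case True
  then obtain y :: 'a where "y \<noteq> 0" by blast
  interpret orthogonal_decomposition "PRI_index \<mu>" "PRI_diff P"
    by (rule PRI_orthogonal_decomposition[OF assms(2) \<open>y \<noteq> 0\<close>])
  show ?thesis by (rule renorming[OF assms(1) _ assms(4)]) (use assms(3) in blast)
next
  case False
  \<comment> \<open>In the zero space the density ordinal is finite, and the empty decomposition takes over.\<close>
  interpret orthogonal_decomposition "{} :: 'i set" "\<lambda>_ x. x :: 'a"
  proof (rule orthogonal_decomposition.intro)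
    fix e :: real and x :: 'a assume "0 < e"
    moreover have "x = 0" using False by blast
    ultimately show "\<exists>A. finite A \<and> A \<subseteq> {} \<and> norm (x - (\<Sum>\<gamma>\<in>A. x)) < e"
      by (intro exI[of _ "{}"]) simp
  qed auto
  show ?thesis by (rule renorming[OF assms(1) _ assms(4)]) simp
qed

end
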